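(* Let $F:\mathbb{R}^n\rightrightarrows\mathbb{R}^n$ be a set-valued mapping, $(\bar x,\bar y)\in\mathrm{gph}\,F$, with $\mathrm{gph}\,F$ locally closed around $(\bar x,\bar y)$, and assume that $F$ is locally monotone at $(\bar x,\bar y)$. Then the following statements are equivalent: (i) $F$ is strongly metrically regular around $(\bar x,\bar y)$. (ii) $F$ is metrically regular around $(\bar x,\bar y)$. (iii) $F$ is SCD regular around $(\bar x,\bar y)$ and locally maximally monotone at $(\bar x,\bar y)$. In this case, the matrices $C_L$, $L\in\mathcal{S}F(\bar x,\bar y)$, are positive semidefinite (i.e. $\langle C_Lp,p\rangle\ge0$ for all $p\in\mathbb{R}^n$; symmetry is not required).
   Context: Norms are Euclidean. $\mathrm{gph}\,F=\{(x,y)\mid y\in F(x)\}$. For a set $A$ and $\bar z\in A$, the tangent cone $T_A(\bar z)$ is the set of all $w$ for which there are $t_k\downarrow0$, $w_k\to w$ with $\bar z+t_kw_k\in A$ for all $k$. Monotonicity. $T:\mathbb{R}^n\rightrightarrows\mathbb{R}^n$ is monotone if $\langle y_1-y_2,x_1-x_2\rangle\ge0$ for all $(x_i,y_i)\in\mathrm{gph}\,T$, $i=1,2$. $F$ is locally monotone at $(x,y)\in\mathrm{gph}\,F$ if there is an open neighborhood $X\times Y$ of $(x,y)$ such that $\langle y_1-y_2,x_1-x_2\rangle\ge0$ for all $(x_i,y_i)\in\mathrm{gph}\,F\cap(X\times Y)$, $i=1,2$. It is locally maximally monotone at $(x,y)$ if (for some such $X\times Y$), in addition, $\mathrm{gph}\,F\cap(X\times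 Y)=\mathrm{gph}\,T\cap(X\times Y)$ for every monotone $T$ with $\mathrm{gph}\,F\cap(X\times Y)\subseteq\mathrm{gph}\,T$. Subspaces. $\mathcal{Z}_n$ is the set of $n$-dimensional linear subspaces of $\mathbb{R}^{2n}=\mathbb{R}^n\times\mathbb{R}^n$ with metric $d_{\mathcal{Z}}(L_1,L_2)=\|P_1-P_2\|$, $P_i$ the orthogonal projection onto $L_i$. $L^*:=\{(-v^*,u^* )\mid(u^*,v^* )\in L^\perp\}$. $\mathcal{Z}_n^{\rm reg}$ is the set of all $L\in\mathcal{Z}_n$ such that $(y^*,0)\in L\Rightarrow y^*=0$. Each $L\in\mathcal{Z}_n^{\rm reg}$ can be written as $L=\{(C_Lp,p)\mid p\in\mathbb{R}^n\}$ with a unique $n\times n$ matrix $C_L$; moreover $L\in\mathcal{Z}_n^{\rm reg}$ iff $L^*\in\mathcal{Z}_n^{\rm reg}$. SCD notions. $\mathcal{O}_F$ is the set of $(x,y)\in\mathrm{gph}\,F$ with $T_{\mathrm{gph}\,F}(x,y)\in\mathcal{Z}_n$. For $(x,y)\in\mathrm{gph}\,F$, $\mathcal{S}F(x,y)$ (resp. $\mathcal{S}^*F(x,y)$) is the set of all $L\in\mathcal{Z}_n$ for which there is a sequence $(x_k,y_k)\to(x,y)$ in $\mathcal{O}_F$ with $d_{\mathcal{Z}}(L,T_{\mathrm{gph}\,F}(x_k,y_k))\to0$ (resp. $d_{\mathcal{Z}}(L,T_{\mathrm{gph}\,F}(x_k,y_k)^* )\to0$); thus $\mathcal{S}^*F(x,y)=\{L^*\mid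 L\in\mathcal{S}F(x,y)\}$. $F$ has the SCD property at $(x,y)$ if $\mathcal{S}^*F(x,y)\neq\emptyset$, and around $(x,y)$ if it has it at all points of $\mathrm{gph}\,F$ in some neighborhood of $(x,y)$. $F$ is SCD regular around $(x,y)$ if it has the SCD property around $(x,y)$ and $\mathcal{S}^*F(x,y)\subseteq\mathcal{Z}_n^{\rm reg}$. Metric regularity. $F$ is metrically regular around $(\bar x,\bar y)$ if there are $\kappa\ge0$ and neighborhoods $X$ of $\bar x$, $Y$ of $\bar y$ with $\mathrm{dist}(x,F^{-1}(y))\le\kappa\,\mathrm{dist}(y,F(x))$ for all $(x,y)\in X\times Y$. It is strongly metrically regular around $(\bar x,\bar y)$ if, in addition, there are open neighborhoods $Y'$ of $\bar y$, $X'$ of $\bar x$ and a mapping $h:Y'\to\mathbb{R}^n$ with $h(\bar y)=\bar x$ and $\mathrm{gph}\,F\cap(X'\times Y')=\{(h(y),y)\mid y\in Y'\}$. *)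

theory Defs
  imports "HOL-Analysis.Analysis"
begin

text \<open>
  A set-valued mapping from R^n to R^n is a function \<open>F :: real^'n \<Rightarrow> (real^'n) set\<close>.  The space
  R^n x R^n is the product type \<open>(real^'n) \<times> (real^'n)\<close>, whose library norm and inner product are the
  Euclidean ones.
\<close>

definition gph :: "(real^'n \<Rightarrow> (real^'n) set) \<Rightarrow> ((real^'n) \<times> (real^'n)) set" where
  "gph F = {(x, y). y \<in> F x}"

definition inverse_map :: "(real^'n \<Rightarrow> (real^'n) set) \<Rightarrow> real^'n \<Rightarrow> (real^'n) set" where
  "inverse_map F y = {x. y \<in> F x}"

definition locally_closed_around :: "'a::metric_space set \<Rightarrow> 'a \<Rightarrow> bool" where
  "locally_closed_around A z \<longleftrightarrow> (\<exists>e>0. closed (A \<inter> cball z e))"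

definition tangent_cone :: "'a::real_normed_vector set \<Rightarrow> 'a \<Rightarrow> 'a set" where
  "tangent_cone A z = {w. \<exists>(t :: nat \<Rightarrow> real) (v :: nat \<Rightarrow> 'a).
     (\<forall>k. t k > 0) \<and> t \<longlonglongrightarrow> 0 \<and> v \<longlonglongrightarrow> w \<and> (\<forall>k. z + t k *\<^sub>R v k \<in> A)}"


subsection \<open>Monotonicity\<close>

definition monotone_graph :: "((real^'n) \<times> (real^'n)) set \<Rightarrow> bool" where
  "monotone_graph G \<longleftrightarrow>
     (\<forall>x1 y1 x2 y2. (x1, y1) \<in> G \<longrightarrow> (x2, y2) \<in> G \<longrightarrow> (y1 - y2) \<bullet> (x1 - x2) \<ge> 0)"

definition monotone_mapping :: "(real^'n \<Rightarrow> (real^'n) set) \<Rightarrow> bool" where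
  "monotone_mapping T \<longleftrightarrow> monotone_graph (gph T)"

definition locally_monotone_at :: "(real^'n \<Rightarrow> (real^'n) set) \<Rightarrow> real^'n \<Rightarrow> real^'n \<Rightarrow> bool" where
  "locally_monotone_at F x y \<longleftrightarrow>
     (\<exists>X Y. open X \<and> open Y \<and> x \<in> X \<and> y \<in> Y \<and> monotone_graph (gph F \<inter> X \<times> Y))"

definition locally_maximally_monotone_at ::
    "(real^'n \<Rightarrow> (real^'n) set) \<Rightarrow> real^'n \<Rightarrow> real^'n \<Rightarrow> bool" where
  "locally_maximally_monotone_at F x y \<longleftrightarrow>
     (\<exists>X Y. open X \<and> open Y \<and> x \<in> X \<and> y \<in> Y \<and> monotone_graph (gph F \<inter> X \<times> Y) \<and>
        (\<forall>T. monotone_mapping T \<longrightarrow> gph F \<inter> X \<times> Y \<subseteq> gph T \<longrightarrow>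
           gph F \<inter> X \<times> Y = gph T \<inter> X \<times> Y))"


subsection \<open>Subspaces\<close>

definition Zn :: "((real^'n) \<times> (real^'n)) set set" where
  "Zn = {L. subspace L \<and> dim L = CARD('n)}"

definition orth_proj :: "'a::euclidean_space set \<Rightarrow> 'a \<Rightarrow> 'a" where
  "orth_proj L z = (THE p. p \<in> L \<and> z - p \<in> orthogonal_comp L)"

definition dZ :: "((real^'n) \<times> (real^'n)) set \<Rightarrow> ((real^'n) \<times> (real^'n)) set \<Rightarrow> real" where
  "dZ L1 L2 = onorm (\<lambda>z. orth_proj L1 z - orth_proj L2 z)"

definition dual_subspace :: "((real^'n) \<times> (real^'n)) set \<Rightarrow> ((real^'n) \<times> (real^'n)) set" where
  "dual_subspace L = {(- v, u) | u v. (u, v) \<in> orthogonal_comp L}"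

definition Zn_reg :: "((real^'n) \<times> (real^'n)) set set" where
  "Zn_reg = {L \<in> Zn. \<forall>u. (u, 0) \<in> L \<longrightarrow> u = 0}"

text \<open>The matrix \<open>C\<^sub>L\<close>; it is determined by this description only for \<open>L \<in> Zn_reg\<close>.\<close>

definition C_mat :: "((real^'n) \<times> (real^'n)) set \<Rightarrow> real^'n^'n" where
  "C_mat L = (THE C. L = {(C *v p, p) | p. True})"


subsection \<open>SCD notions\<close>

definition O_set :: "(real^'n \<Rightarrow> (real^'n) set) \<Rightarrow> ((real^'n) \<times> (real^'n)) set" where
  "O_set F = {z \<in> gph F. tangent_cone (gph F) z \<in> Zn}"

definition SCD :: "(real^'n \<Rightarrow> (real^'n) set) \<Rightarrow> (real^'n) \<times> (real^'n) \<Rightarrow> ((real^'n) \<times> (real^'n)) set set"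
  where
  "SCD F z = {L \<in> Zn. \<exists>zs :: nat \<Rightarrow> (real^'n) \<times> (real^'n).
     (\<forall>k. zs k \<in> O_set F) \<and> zs \<longlonglongrightarrow> z \<and>
     (\<lambda>k. dZ L (tangent_cone (gph F) (zs k))) \<longlonglongrightarrow> 0}"

definition SCD_dual ::
    "(real^'n \<Rightarrow> (real^'n) set) \<Rightarrow> (real^'n) \<times> (real^'n) \<Rightarrow> ((real^'n) \<times> (real^'n)) set set" where
  "SCD_dual F z = {L \<in> Zn. \<exists>zs :: nat \<Rightarrow> (real^'n) \<times> (real^'n).
     (\<forall>k. zs k \<in> O_set F) \<and> zs \<longlonglongrightarrow> z \<and>
     (\<lambda>k. dZ L (dual_subspace (tangent_cone (gph F) (zs k)))) \<longlonglongrightarrow> 0}"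

definition SCD_property_at ::
    "(real^'n \<Rightarrow> (real^'n) set) \<Rightarrow> (real^'n) \<times> (real^'n) \<Rightarrow> bool" where
  "SCD_property_at F z \<longleftrightarrow> SCD_dual F z \<noteq> {}"

definition SCD_property_around ::
    "(real^'n \<Rightarrow> (real^'n) set) \<Rightarrow> (real^'n) \<times> (real^'n) \<Rightarrow> bool" where
  "SCD_property_around F z \<longleftrightarrow>
     (\<exists>W. open W \<and> z \<in> W \<and> (\<forall>z' \<in> gph F \<inter> W. SCD_property_at F z'))"

definition SCD_regular_around ::
    "(real^'n \<Rightarrow> (real^'n) set) \<Rightarrow> real^'n \<Rightarrow> real^'n \<Rightarrow> bool" where
  "SCD_regular_around F x y \<longleftrightarrow>
     SCD_property_around F (x, y) \<and> SCD_dual F (x, y) \<subseteq> Zn_reg"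


subsection \<open>Metric regularity\<close>

text \<open>
  The distance to the empty set is \<open>\<infinity>\<close>, so the library's \<open>infdist\<close>, which is \<open>0\<close> there, cannot
  be used.  The convention \<open>0 * \<infinity> = 0\<close> of \<open>ereal\<close> is immaterial below, since \<open>\<kappa>\<close> may always be
  enlarged.
\<close>

definition edist_set :: "'a::metric_space \<Rightarrow> 'a set \<Rightarrow> ereal" where
  "edist_set x A = (INF a\<in>A. ereal (dist x a))"

definition metrically_regular_around ::
    "(real^'n \<Rightarrow> (real^'n) set) \<Rightarrow> real^'n \<Rightarrow> real^'n \<Rightarrow> bool" where
  "metrically_regular_around F x0 y0 \<longleftrightarrow>
     (\<exists>\<kappa>::real. \<kappa> \<ge> 0 \<and> (\<exists>X Y. open X \<and> open Y \<and> x0 \<in> X \<and> y0 \<in> Y \<and>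
        (\<forall>x\<in>X. \<forall>y\<in>Y. edist_set x (inverse_map F y) \<le> ereal \<kappa> * edist_set y (F x))))"

definition strongly_metrically_regular_around ::
    "(real^'n \<Rightarrow> (real^'n) set) \<Rightarrow> real^'n \<Rightarrow> real^'n \<Rightarrow> bool" where
  "strongly_metrically_regular_around F x0 y0 \<longleftrightarrow>
     metrically_regular_around F x0 y0 \<and>
     (\<exists>X' Y' h. open X' \<and> open Y' \<and> x0 \<in> X' \<and> y0 \<in> Y' \<and> h y0 = x0 \<and>
        gph F \<inter> X' \<times> Y' = {(h y, y) | y. y \<in> Y'})"

end

theory Submission
  imports Defs
begin

text \<open>
  Metric regularity and local monotonicity force the inverse to be single-valued, monotone and
  Lipschitz near the base point; this gives strong regularity, local maximality, and a bound
  \<open>norm p \<le> \<kappa> * norm q\<close> on nearby tangent spaces which survives in the limit.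

  Conversely, by Minty's parametrisation the graph of a locally maximally monotone mapping is,
  near the base point, the image of a Lipschitz map \<open>\<Phi>\<close> of \<open>u = x + y\<close>.  By Rademacher's theorem
  \<open>\<Phi>\<close> is differentiable a.e., and its derivatives parametrise the tangent spaces.  If all limits
  of their duals are regular, compactness of the Grassmannian bounds the slopes of the nearby tangent spaces.
  With \<open>Q u = y\<close>, monotonicity turns this into \<open>(Q'(u) w) \<bullet> w \<ge> m * (w \<bullet> w)\<close> a.e., so \<open>Q\<close> is
  strongly monotone, and invariance of domain yields a Lipschitz inverse.
\<close>

section \<open>Rademacher's theorem\<close>

text \<open>Both directions run through one quantitative form of regularity,
  \<open>slope_le \<kappa>\<close>. It survives limits in \<open>dZ\<close>, and a subspace in
  \<open>Zn\<close> has it iff its dual does, because a matrix and its transpose have the same norm.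
  Tangent spaces, their limits and the limits of their duals thus share one constant. The obstacle
  in the direction from SCD regularity is that its hypothesis concerns only points whose tangent
  cone is a subspace, and the derivatives there need not vary continuously, so the inverse function
  theorem does not apply. Local maximality is tested on extensions by a single point: the point
  found for \<open>u\<close> is, in each component, no farther from the base point than
  \<open>u\<close> is from \<open>xbar + ybar\<close>, so it stays where maximality is available and
  the chart covers a full ball. Almost every parameter in that ball yields a point of
  \<open>O_set F\<close>, but a given segment may miss all of them; hence the averaging. The
  constant is \<open>m = 1 / (\<kappa> + 1)^2\<close>: for a tangent vector \<open>(p, q)\<close>
  and \<open>w = p + q\<close>, one has \<open>norm w \<le> (\<kappa> + 1) * norm q\<close> and
  \<open>q \<bullet> w \<ge> q \<bullet> q\<close>.\<close>

lemma indefinite_integral_right_derivative_ae: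
  fixes f \<phi> :: "real \<Rightarrow> real"
  assumes int: "\<And>a b. a \<le> b \<Longrightarrow> (\<phi> has_integral (f b - f a)) {a..b}"
  shows "\<exists>N. negligible N \<and> (\<forall>x. x \<notin> N \<longrightarrow> ((\<lambda>h. (f (x + h) - f x) / h) \<longlongrightarrow> \<phi> x) (at_right 0))"
proof -
  have "\<phi> integrable_on cbox a b" for a b
    using int[of a b] by (cases "a \<le> b") (auto simp: integrable_on_def)
  \<comment> \<open>The differentiation theorem averages over boxes with lower corner
    \<open>x\<close>; this is why only the limit from the right is obtained.\<close>
  then obtain N where N: "negligible N" and lim: "\<And>x e. \<lbrakk>x \<notin> N; 0 < e\<rbrakk> \<Longrightarrow>
     \<exists>d>0. \<forall>h. 0 < h \<and> h < d \<longrightarrow>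
        norm(integral (cbox x (x + h *\<^sub>R One)) \<phi> /\<^sub>R h ^ DIM(real) - \<phi> x) < e"
    by (rule integrable_ccontinuous_explicit) blast
  have "((\<lambda>h. (f (x + h) - f x) / h) \<longlongrightarrow> \<phi> x) (at_right 0)" if "x \<notin> N" for x
  proof (rule tendstoI)
    fix e :: real assume "0 < e"
    from lim[OF that this] obtain d where "d > 0" and
      d: "\<And>h. 0 < h \<Longrightarrow> h < d \<Longrightarrow> norm(integral (cbox x (x + h)) \<phi> /\<^sub>R h - \<phi> x) < e"
      by auto
    have "dist ((f (x + h) - f x) / h) (\<phi> x) < e" if "0 < h" "h < d" for h
      using d[OF that] integral_unique[OF int[of x "x + h"]] that
      by (simp add: dist_norm divide_inverse mult.commute)
    then show "\<forall>\<^sub>F h in at_right 0. dist ((f (x + h) - f x) / h) (\<phi> x) < e"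
      unfolding eventually_at_right_field using \<open>d > 0\<close> by auto
  qed
  with N show ?thesis by blast
qed

text \<open>The limit from the left is the limit from the right for the reflected function
  \<open>f (- x)\<close>, an indefinite integral of \<open>- \<phi> (- x)\<close>.\<close>

lemma indefinite_integral_derivative_ae:
  fixes f \<phi> :: "real \<Rightarrow> real"
  assumes int: "\<And>a b. a \<le> b \<Longrightarrow> (\<phi> has_integral (f b - f a)) {a..b}"
  shows "\<exists>N. negligible N \<and> (\<forall>x. x \<notin> N \<longrightarrow> (f has_real_derivative \<phi> x) (at x))"
proof -
  obtain N1 where N1: "negligible N1"
    "\<And>x. x \<notin> N1 \<Longrightarrow> ((\<lambda>h. (f (x + h) - f x) / h) \<longlongrightarrow> \<phi> x) (at_right 0)"
    using indefinite_integral_right_derivative_ae[OF int] by blast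
  have "((\<lambda>x. - \<phi> (- x)) has_integral (f (- b) - f (- a))) {a..b}" if "a \<le> b" for a b
    using has_integral_neg[OF has_integral_reflect_lemma_real[OF int[of "-b" "-a"]]] that by simp
  then obtain N2 where N2: "negligible N2"
    "\<And>x. x \<notin> N2 \<Longrightarrow> ((\<lambda>h. (f (- (x + h)) - f (- x)) / h) \<longlongrightarrow> - \<phi> (- x)) (at_right 0)"
    using indefinite_integral_right_derivative_ae[of "\<lambda>x. - \<phi> (- x)" "\<lambda>x. f (- x)"] by blast
  have neg: "negligible (N1 \<union> uminus ` N2)"
    using N1 N2 by (auto intro!: negligible_differentiable_image_negligible derivative_intros)
  have "(f has_real_derivative \<phi> x) (at x)" if x: "x \<notin> N1 \<union> uminus ` N2" for x
  proof -
    have r: "((\<lambda>h. (f (x + h) - f x) / h) \<longlongrightarrow> \<phi> x) (at_right 0)" using N1 x by auto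
    have "- x \<notin> N2" using x by (metis UnCI imageI minus_minus)
    from tendsto_minus[OF N2(2)[OF this]]
    have "((\<lambda>h. (f (x + - h) - f x) / - h) \<longlongrightarrow> \<phi> x) (at_right 0)" by simp
    then have l: "((\<lambda>h. (f (x + h) - f x) / h) \<longlongrightarrow> \<phi> x) (at_left 0)"
      by (subst at_left_minus) (simp add: filterlim_filtermap)
    show ?thesis
      unfolding DERIV_def using filterlim_split_at[OF l r] .
  qed
  with neg show ?thesis by blast
qed

text \<open>Radon-Nikodym. Adding a steep linear function makes \<open>f\<close> an increasing
  homeomorphism \<open>G\<close>, whose Stieltjes measure assigns to \<open>A\<close> the Lebesgue
  measure of the image of \<open>A\<close> under \<open>G\<close>. Since \<open>G\<close> is
  Lipschitz, null sets have null images, so this measure has a density; subtracting the added slope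
  gives \<open>\<phi>\<close>.\<close>

lemma lipschitz_real_indefinite_integral:
  fixes f :: "real \<Rightarrow> real"
  assumes lip: "K-lipschitz_on UNIV f"
  shows "\<exists>\<phi>. \<forall>a b. a \<le> b \<longrightarrow> (\<phi> has_integral (f b - f a)) {a..b}"
proof -
  \<comment> \<open>The slope \<open>K\<close> would only make \<open>G\<close> monotone; the extra
    \<open>1\<close> makes it expanding, so that its inverse is 1-Lipschitz and in particular
    Borel.\<close>
  define G where "G = (\<lambda>x. f x + (K + 1) * x)"
  have G_diff: "y - x \<le> G y - G x" if "x \<le> y" for x y
    using lipschitz_onD[OF lip, of y x] that by (auto simp: G_def dist_real_def algebra_simps)
  then have mono: "G x \<le> G y" if "x \<le> y" for x y using that by (smt (verit))
  have "continuous_on UNIV f" using lip by (rule lipschitz_on_continuous_on)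
  then have contG: "continuous_on UNIV G" unfolding G_def by (intro continuous_intros)
  have G_le: "G x \<le> G y \<longleftrightarrow> x \<le> y" for x y
    using G_diff[of x y] G_diff[of y x] by linarith
  have "inj G" using G_le by (metis antisym injI order_refl)
  have "\<exists>x. G x = y" for y
  proof -
    define M where "M = \<bar>y\<bar> + \<bar>G 0\<bar>"
    have "G (- M) \<le> y" "y \<le> G M"
      using G_diff[of "-M" 0] G_diff[of 0 M] unfolding M_def by linarith+
    then show ?thesis
      using IVT'[of G "- M" y M] contG M_def by (auto intro: continuous_on_subset)
  qed
  then have "surj G" by (metis surjI)
  define g where "g = inv G"
  have gG: "g (G x) = x" and Gg: "G (g x) = x" for x
    using \<open>inj G\<close> \<open>surj G\<close> by (auto simp: g_def surj_f_inv_f)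
  have "\<bar>g x - g y\<bar> \<le> \<bar>x - y\<bar>" for x y
    using G_diff[of "g x" "g y"] G_diff[of "g y" "g x"] Gg by (smt (verit))
  then have "1-lipschitz_on UNIV g" by (intro lipschitz_onI) (auto simp: dist_real_def)
  then have gm[measurable]: "g \<in> borel_measurable borel"
    by (intro borel_measurable_continuous_onI lipschitz_on_continuous_on)
  have vim: "g -` A = G ` A" for A
  proof (intro subset_antisym subsetI)
    show "x \<in> G ` A" if "x \<in> g -` A" for x using that Gg[of x, symmetric] by blast
  qed (auto simp: gG)
  \<comment> \<open>The Stieltjes measure of \<open>G\<close>, written as the push-forward of
    Lebesgue measure under \<open>g\<close>, the inverse of \<open>G\<close>.\<close>
  define N where "N = distr lborel borel g"
  have "absolutely_continuous lborel N"
    unfolding absolutely_continuous_def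
  proof
    fix A :: "real set" assume A: "A \<in> null_sets lborel"
    then have Ab: "A \<in> sets borel" by auto
    have "negligible A" using A by (simp add: negligible_iff_null_sets null_sets_completionI)
    then have "negligible (G ` A)"
    proof (rule negligible_locally_Lipschitz_image[rotated])
      fix x
      have "\<bar>G y - G x\<bar> \<le> (2 * K + 1) * \<bar>y - x\<bar>" for y
      proof -
        have "\<bar>f y - f x\<bar> \<le> K * \<bar>y - x\<bar>" using lipschitz_onD[OF lip] by (auto simp: dist_real_def)
        moreover have "\<bar>(K + 1) * (y - x)\<bar> = (K + 1) * \<bar>y - x\<bar>"
          using lipschitz_on_nonneg[OF lip] by (simp add: abs_mult)
        moreover have "G y - G x = (f y - f x) + (K + 1) * (y - x)"
          by (simp add: G_def algebra_simps)
        moreover have "(2 * K + 1) * \<bar>y - x\<bar> = K * \<bar>y - x\<bar> + (K + 1) * \<bar>y - x\<bar>"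
          by (simp add: algebra_simps)
        ultimately show ?thesis by linarith
      qed
      then show "\<exists>T B. open T \<and> x \<in> T \<and> (\<forall>y\<in>A \<inter> T. norm (G y - G x) \<le> B * norm (y - x))"
        by (intro exI[of _ UNIV]) auto
    qed simp
    moreover have "G ` A \<in> sets borel"
      using measurable_sets[OF gm Ab] vim by simp
    ultimately have "emeasure lborel (G ` A) = 0"
      unfolding negligible_iff_null_sets by (simp add: null_sets_def)
    then show "A \<in> null_sets N"
      using Ab by (auto simp: N_def null_sets_def emeasure_distr vim)
  qed
  then obtain \<phi> where \<phi>[measurable]: "\<phi> \<in> borel_measurable lborel" and dens: "density lborel \<phi> = N"
    using sigma_finite_measure.Radon_Nikodym[OF sigma_finite_lborel, of N] by (auto simp: N_def)
  have nn: "(\<integral>\<^sup>+x. \<phi> x * indicator {a..b} x \<partial>lborel) = ennreal (G b - G a)" if "a \<le> b" for a b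
  proof -
    have "(\<integral>\<^sup>+x. \<phi> x * indicator {a..b} x \<partial>lborel) = emeasure N {a..b}"
      by (subst dens[symmetric]) (simp add: emeasure_density)
    also have "\<dots> = emeasure lborel (g -` {a..b})" by (simp add: N_def emeasure_distr)
    also have "g -` {a..b} = {G a..G b}"

    proof -
      have "a \<le> g x \<longleftrightarrow> G a \<le> x" "g x \<le> b \<longleftrightarrow> x \<le> G b" for x
        using G_le[of a "g x"] G_le[of "g x" b] Gg by simp_all
      then show ?thesis by auto
    qed
    finally show ?thesis using mono[OF that] by simp
  qed
  have "((\<lambda>x. enn2real (\<phi> x)) has_integral (G b - G a)) {a..b}" if ab: "a \<le> b" for a b
  proof -
    \<comment> \<open>\<open>enn2real\<close> sends infinity to 0, so the passage to a real density
      is legitimate only because \<open>\<phi>\<close> has finite integral over the interval and is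
      therefore finite almost everywhere there.\<close>
    have "AE x in lborel. \<phi> x * indicator {a..b} x \<noteq> \<infinity>"
      by (rule nn_integral_PInf_AE) (simp_all add: nn[OF ab])
    then have "AE x in lborel. ennreal (enn2real (\<phi> x) * indicator {a..b} x) = \<phi> x * indicator {a..b} x"
      by eventually_elim (auto simp: indicator_def less_top[symmetric] split: if_splits)
    then have "(\<integral>\<^sup>+x. ennreal (enn2real (\<phi> x) * indicator {a..b} x) \<partial>lborel) = ennreal (G b - G a)"
      using nn[OF ab] by (simp add: nn_integral_cong_AE)
    then have "((\<lambda>x. enn2real (\<phi> x) * indicator {a..b} x) has_integral (G b - G a)) UNIV"
      using mono[OF ab] by (intro nn_integral_has_integral) auto
    moreover have "(\<lambda>x. enn2real (\<phi> x) * indicator {a..b} x) = (\<lambda>x. if x \<in> {a..b} then enn2real (\<phi> x) else 0)"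
      by (auto simp: indicator_def)
    ultimately show ?thesis by (simp only: has_integral_restrict_UNIV)
  qed
  from has_integral_diff[OF this has_integral_const_real[of "K + 1"]]
  have "((\<lambda>x. enn2real (\<phi> x) - (K + 1)) has_integral (f b - f a)) {a..b}" if "a \<le> b" for a b
    using that by (force simp: G_def algebra_simps)
  then show ?thesis by blast
qed

lemma lipschitz_real_differentiable_ae:
  fixes f :: "real \<Rightarrow> real"
  assumes "K-lipschitz_on UNIV f"
  shows "negligible {x. \<not> f differentiable (at x)}"
proof -
  obtain \<phi> where "\<And>a b. a \<le> b \<Longrightarrow> (\<phi> has_integral (f b - f a)) {a..b}"
    using lipschitz_real_indefinite_integral[OF assms] by blast
  from indefinite_integral_derivative_ae[OF this] obtain N where
    "negligible N" "\<And>x. x \<notin> N \<Longrightarrow> (f has_real_derivative \<phi> x) (at x)" by blast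
  then show ?thesis
    by (elim negligible_subset) (auto simp: real_differentiable_def)
qed

section \<open>Directional derivatives of Lipschitz functions on Euclidean space\<close>

definition dir_quot :: "('a::real_vector \<Rightarrow> real) \<Rightarrow> 'a \<Rightarrow> 'a \<Rightarrow> real \<Rightarrow> real" where
  "dir_quot f w x t = (f (x + t *\<^sub>R w) - f x) / t"

text \<open>A limit along one fixed sequence of steps, so that Borel measurability in
  \<open>x\<close> is immediate for every continuous \<open>f\<close>. The value is meaningful only
  where the directional derivative exists.\<close>

definition dir_deriv :: "('a::real_vector \<Rightarrow> real) \<Rightarrow> 'a \<Rightarrow> 'a \<Rightarrow> real" where
  "dir_deriv f w x = lim (\<lambda>k. dir_quot f w x (inverse (real (Suc k))))"

text \<open>Fubini in sheared form: exchanging the two quantifiers produces a single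
  \<open>t\<close> for which the translate of \<open>B\<close> by \<open>- t *\<^sub>R w\<close> is
  null, and Lebesgue measure is translation invariant. No coordinates adapted to \<open>w\<close>
  enter.\<close>

lemma null_lines_imp_AE:
  fixes B :: "'a::euclidean_space set"
  assumes [measurable]: "B \<in> sets borel" and slices: "\<And>x. AE t in lborel. x + t *\<^sub>R w \<notin> B"
  shows "AE x in lborel. x \<notin> B"
proof -
  have "AE x in lborel. AE t in lborel. x + t *\<^sub>R w \<notin> B" using slices by simp
  then have "AE t in lborel. AE x in lborel. x + t *\<^sub>R w \<notin> B"
    by (rule lborel_pair.AE_commute[THEN iffD1, rotated]) measurable
  moreover have "ae_filter (lborel :: real measure) \<noteq> bot"
    by (simp add: ae_filter_eq_bot_iff)
  ultimately obtain t where "AE x in lborel. x + t *\<^sub>R w \<notin> B"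
    using eventually_happens by blast
  then have "AE x in distr lborel borel ((+) (t *\<^sub>R w)). x \<notin> B"
    by (subst AE_distr_iff) (simp_all add: add.commute)
  then show ?thesis unfolding lborel_distr_plus .
qed

lemma lipschitz_line:
  fixes f :: "'a::real_normed_vector \<Rightarrow> 'b::real_normed_vector"
  assumes "K-lipschitz_on UNIV f"
  shows "(K * norm w)-lipschitz_on UNIV (\<lambda>t::real. f (x + t *\<^sub>R w))"
proof (rule lipschitz_onI)
  fix s t :: real
  have "dist (f (x + s *\<^sub>R w)) (f (x + t *\<^sub>R w)) \<le> K * dist (x + s *\<^sub>R w) (x + t *\<^sub>R w)"
    using lipschitz_onD[OF assms] by blast
  also have "dist (x + s *\<^sub>R w) (x + t *\<^sub>R w) = norm w * dist s t"
    by (simp add: dist_norm scaleR_diff_left[symmetric])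
  finally show "dist (f (x + s *\<^sub>R w)) (f (x + t *\<^sub>R w)) \<le> K * norm w * dist s t" by (simp add: mult.assoc)
qed (use lipschitz_on_nonneg[OF assms] in simp)

text \<open>The Cauchy criterion for difference quotients, with tolerances and radii restricted to
  reciprocals of naturals. It turns differentiability into a countable combination of conditions,
  from which the exceptional set in \<open>lipschitz_dir_differentiable_ae\<close> is seen to be
  Borel.\<close>

lemma real_differentiable_iff_Cauchy:
  fixes g :: "real \<Rightarrow> real"
  shows "g differentiable (at 0) \<longleftrightarrow>
    (\<forall>n::nat. \<exists>m::nat. \<forall>s t. 0 < \<bar>s\<bar> \<and> \<bar>s\<bar> < inverse (real (Suc m)) \<and> 0 < \<bar>t\<bar> \<and> \<bar>t\<bar> < inverse (real (Suc m)) \<longrightarrow>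
       \<bar>(g s - g 0) / s - (g t - g 0) / t\<bar> \<le> inverse (real (Suc n)))"
    (is "_ \<longleftrightarrow> ?C")
proof
  define q where "q = (\<lambda>t. (g t - g 0) / t)"
  assume "g differentiable (at 0)"
  then obtain d where "(q \<longlongrightarrow> d) (at 0)"
    by (auto simp: real_differentiable_def DERIV_def q_def)
  show ?C
  proof
    fix n :: nat
    define e where "e = inverse (real (Suc n)) / 2"
    have "e > 0" by (simp add: e_def)
    with \<open>(q \<longlongrightarrow> d) (at 0)\<close> obtain r where r: "r > 0" "\<And>t. 0 < \<bar>t\<bar> \<Longrightarrow> \<bar>t\<bar> < r \<Longrightarrow> \<bar>q t - d\<bar> < e"
      unfolding LIM_def by (auto simp: dist_real_def)
    obtain m where m: "inverse (real (Suc m)) < r" using reals_Archimedean[OF r(1)] by auto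
    have "\<bar>q s - q t\<bar> \<le> inverse (real (Suc n))"
      if "0 < \<bar>s\<bar>" "\<bar>s\<bar> < inverse (real (Suc m))" "0 < \<bar>t\<bar>" "\<bar>t\<bar> < inverse (real (Suc m))" for s t
      using r(2)[of s] r(2)[of t] that m unfolding e_def by linarith
    then show "\<exists>m::nat. \<forall>s t. 0 < \<bar>s\<bar> \<and> \<bar>s\<bar> < inverse (real (Suc m)) \<and> 0 < \<bar>t\<bar> \<and> \<bar>t\<bar> < inverse (real (Suc m)) \<longrightarrow>
       \<bar>(g s - g 0) / s - (g t - g 0) / t\<bar> \<le> inverse (real (Suc n))"
      unfolding q_def by blast
  qed
next
  define q where "q = (\<lambda>t. (g t - g 0) / t)"
  assume C: ?C
  \<comment> \<open>The factor \<open>1 / 2\<close> puts the sample point strictly inside the radius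
    already for \<open>k = m\<close>.\<close>
  define u where "u = (\<lambda>k. q (inverse (real (Suc k)) / 2))"
  have C': "\<exists>m::nat. inverse (real (Suc m)) > 0 \<and> (\<forall>s t. 0 < \<bar>s\<bar> \<and> \<bar>s\<bar> < inverse (real (Suc m)) \<and> 0 < \<bar>t\<bar> \<and> \<bar>t\<bar> < inverse (real (Suc m)) \<longrightarrow>
       \<bar>q s - q t\<bar> < e)" if e: "e > 0" for e
  proof -
    obtain n where "inverse (real (Suc n)) < e" using reals_Archimedean[OF e] by auto
    moreover obtain m where "\<forall>s t. 0 < \<bar>s\<bar> \<and> \<bar>s\<bar> < inverse (real (Suc m)) \<and> 0 < \<bar>t\<bar> \<and> \<bar>t\<bar> < inverse (real (Suc m)) \<longrightarrow>
       \<bar>q s - q t\<bar> \<le> inverse (real (Suc n))" using C unfolding q_def by metis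
    ultimately show ?thesis by (intro exI[of _ m]) fastforce
  qed
  have small: "0 < \<bar>inverse (real (Suc k)) / 2\<bar>" "\<bar>inverse (real (Suc k)) / 2\<bar> < inverse (real (Suc m))"
    if "k \<ge> m" for k m :: nat
    using that by (auto simp: field_simps)
  have "Cauchy u"
  proof (rule CauchyI)
    fix e :: real assume "0 < e"
    from C'[OF this] obtain m where "\<And>s t. 0 < \<bar>s\<bar> \<Longrightarrow> \<bar>s\<bar> < inverse (real (Suc m)) \<Longrightarrow> 0 < \<bar>t\<bar> \<Longrightarrow> \<bar>t\<bar> < inverse (real (Suc m)) \<Longrightarrow>
       \<bar>q s - q t\<bar> < e" by blast
    then show "\<exists>M. \<forall>m\<ge>M. \<forall>n\<ge>M. norm (u m - u n) < e"
      unfolding u_def real_norm_def using small by blast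
  qed
  then obtain d where d: "u \<longlonglongrightarrow> d" using Cauchy_convergent convergent_def by blast
  have "(q \<longlongrightarrow> d) (at 0)"
    unfolding LIM_def
  proof (intro allI impI)
    fix e :: real assume "0 < e"
    then have "0 < e / 2" by simp
    from C'[OF this] obtain m where m: "\<And>s t. 0 < \<bar>s\<bar> \<Longrightarrow> \<bar>s\<bar> < inverse (real (Suc m)) \<Longrightarrow> 0 < \<bar>t\<bar> \<Longrightarrow> \<bar>t\<bar> < inverse (real (Suc m)) \<Longrightarrow>
       \<bar>q s - q t\<bar> < e / 2" by blast
    have "\<bar>q s - d\<bar> \<le> e / 2" if s: "0 < \<bar>s\<bar>" "\<bar>s\<bar> < inverse (real (Suc m))" for s
    proof (rule tendsto_upperbound)
      show "(\<lambda>k. \<bar>q s - u k\<bar>) \<longlonglongrightarrow> \<bar>q s - d\<bar>" by (intro tendsto_intros d)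
      show "\<forall>\<^sub>F k in sequentially. \<bar>q s - u k\<bar> \<le> e / 2"
        using eventually_ge_at_top[of m]
      proof eventually_elim
        case (elim k)
        show ?case unfolding u_def using m[OF s small[OF elim]] by simp
      qed
    qed simp
    then show "\<exists>r>0. \<forall>x. x \<noteq> 0 \<and> dist x 0 < r \<longrightarrow> dist (q x) d < e"
      using \<open>0 < e\<close> by (intro exI[of _ "inverse (real (Suc m))"]) (fastforce simp: dist_real_def)
  qed
  then show "g differentiable (at 0)"
    by (auto simp: real_differentiable_def DERIV_def q_def)
qed

text \<open>Along each line parallel to \<open>w\<close> the one-dimensional theorem applies, so the
  exceptional set meets every such line in a null set; \<open>null_lines_imp_AE\<close> concludes
  once that set is known to be Borel.\<close>

lemma lipschitz_dir_differentiable_ae: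
  fixes f :: "'a::euclidean_space \<Rightarrow> real"
  assumes lip: "K-lipschitz_on UNIV f"
  shows "AE x in lborel. (\<lambda>t. f (x + t *\<^sub>R w)) differentiable (at 0)"
proof -
  have contf: "continuous_on UNIV f" using lip by (rule lipschitz_on_continuous_on)
  define C where "C = (\<lambda>(n::nat) (m::nat). {x. \<forall>s t. 0 < \<bar>s\<bar> \<and> \<bar>s\<bar> < inverse (real (Suc m)) \<and> 0 < \<bar>t\<bar> \<and> \<bar>t\<bar> < inverse (real (Suc m)) \<longrightarrow>
       \<bar>dir_quot f w x s - dir_quot f w x t\<bar> \<le> inverse (real (Suc n))})"
  define B where "B = - (\<Inter>n. \<Union>m. C n m)"
  have iff: "(\<lambda>t. f (x + t *\<^sub>R w)) differentiable (at 0) \<longleftrightarrow> x \<notin> B" for x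
    unfolding real_differentiable_iff_Cauchy B_def C_def dir_quot_def
    by (simp only: Compl_iff not_not INT_iff UN_iff mem_Collect_eq ball_UNIV bex_UNIV scaleR_zero_left add_0_right)
  \<comment> \<open>For fixed nonzero \<open>s\<close> and \<open>t\<close> both quotients are
    continuous in \<open>x\<close>; the uncountable intersection over \<open>s\<close> and
    \<open>t\<close> is harmless because it consists of closed sets.\<close>
  have "closed (C n m)" for n m
  proof -
    define S where "S = {s. 0 < \<bar>s\<bar> \<and> \<bar>s\<bar> < inverse (real (Suc m))}"
    have "closed {x. \<bar>dir_quot f w x s - dir_quot f w x t\<bar> \<le> inverse (real (Suc n))}" if "s \<in> S" "t \<in> S" for s t
      unfolding dir_quot_def using that
      by (intro closed_Collect_le continuous_intros continuous_on_compose2[OF contf]) (auto simp: S_def)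
    then have "closed (\<Inter>s\<in>S. \<Inter>t\<in>S. {x. \<bar>dir_quot f w x s - dir_quot f w x t\<bar> \<le> inverse (real (Suc n))})"
      by blast
    also have "(\<Inter>s\<in>S. \<Inter>t\<in>S. {x. \<bar>dir_quot f w x s - dir_quot f w x t\<bar> \<le> inverse (real (Suc n))}) = C n m"
      unfolding C_def S_def by blast
    finally show ?thesis .
  qed
  then have [measurable]: "B \<in> sets borel" unfolding B_def by (intro borel_comp sets.countable_INT sets.countable_UN) auto
  have "AE x in lborel. x \<notin> B"
  proof (rule null_lines_imp_AE)
    fix x
    have "negligible {t. \<not> (\<lambda>t. f (x + t *\<^sub>R w)) differentiable (at t)}"
      by (rule lipschitz_real_differentiable_ae[OF lipschitz_line[OF lip]])
    moreover have "{t. x + t *\<^sub>R w \<in> B} = {t. \<not> (\<lambda>t. f (x + t *\<^sub>R w)) differentiable (at t)}"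
    proof -
      have "(\<lambda>s. f (x + t *\<^sub>R w + s *\<^sub>R w)) differentiable (at 0) \<longleftrightarrow> (\<lambda>t. f (x + t *\<^sub>R w)) differentiable (at t)" for t
        using DERIV_shift[of "\<lambda>t. f (x + t *\<^sub>R w)" _ 0 t]
        by (simp add: real_differentiable_def algebra_simps)
      then show ?thesis using iff by blast
    qed
    moreover have "{t. x + t *\<^sub>R w \<in> B} \<in> sets lborel" by measurable
    ultimately have "{t. x + t *\<^sub>R w \<in> B} \<in> null_sets lborel"
      by (auto simp: negligible_iff_null_sets null_sets_def)
    then show "AE t in lborel. x + t *\<^sub>R w \<notin> B" by (rule AE_I') auto
  qed simp
  then show ?thesis by (simp add: iff)
qed

lemma inverse_Suc_filterlim_at: "filterlim (\<lambda>k. inverse (real (Suc k))) (at 0) sequentially"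
  by (intro filterlim_atI) (use LIMSEQ_inverse_real_of_nat in \<open>auto\<close>)

lemma dir_quot_tendsto_iff:
  "(dir_quot f w x \<longlongrightarrow> d) (at 0) \<longleftrightarrow> ((\<lambda>t. f (x + t *\<^sub>R w)) has_real_derivative d) (at 0)"
proof -
  have "dir_quot f w x = (\<lambda>t. (f (x + t *\<^sub>R w) - f x) / t)" by (simp add: fun_eq_iff dir_quot_def)
  then show ?thesis by (simp add: DERIV_def)
qed

lemma dir_deriv_eqI:
  assumes "((\<lambda>t. f (x + t *\<^sub>R w)) has_real_derivative d) (at 0)"
  shows "dir_deriv f w x = d"
proof -
  have "(dir_quot f w x \<longlongrightarrow> d) (at 0)"
    using assms by (simp add: dir_quot_tendsto_iff)
  then have "(\<lambda>k. dir_quot f w x (inverse (real (Suc k)))) \<longlonglongrightarrow> d"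
    by (rule filterlim_compose[OF _ inverse_Suc_filterlim_at])
  then show ?thesis unfolding dir_deriv_def by (rule limI)
qed

lemma lipschitz_dir_deriv_ae:
  fixes f :: "'a::euclidean_space \<Rightarrow> real"
  assumes lip: "K-lipschitz_on UNIV f"
  shows "AE x in lborel. ((\<lambda>t. f (x + t *\<^sub>R w)) has_real_derivative dir_deriv f w x) (at 0)"
  using lipschitz_dir_differentiable_ae[OF lip, of w]
  by eventually_elim (use dir_deriv_eqI in \<open>fastforce simp: real_differentiable_def\<close>)

lemma dir_deriv_scale:
  fixes f :: "'a::real_vector \<Rightarrow> real"
  assumes "((\<lambda>t. f (x + t *\<^sub>R w)) has_real_derivative d) (at 0)"
  shows "((\<lambda>t. f (x + t *\<^sub>R (c *\<^sub>R w))) has_real_derivative c * d) (at 0)"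
proof -
  have "((\<lambda>t. f (x + t *\<^sub>R w)) has_real_derivative d) (at (c * 0))" using assms by simp
  from DERIV_chain2[OF this DERIV_cmult[OF DERIV_ident, of c 0 UNIV]]
  show ?thesis by (simp add: mult.commute scaleR_scaleR)
qed

lemma borel_measurable_dir_quot[measurable]:
  fixes f :: "'a::euclidean_space \<Rightarrow> real"
  assumes "continuous_on UNIV f"
  shows "(\<lambda>x. dir_quot f w x t) \<in> borel_measurable borel"
  unfolding dir_quot_def divide_inverse
  by (intro borel_measurable_continuous_onI continuous_intros continuous_on_compose2[OF assms]) auto

lemma dir_quot_bound:
  fixes f :: "'a::real_normed_vector \<Rightarrow> real"
  assumes lip: "K-lipschitz_on UNIV f"
  shows "\<bar>dir_quot f w x t\<bar> \<le> K * norm w"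
proof (cases "t = 0")
  case False
  have "\<bar>f (x + t *\<^sub>R w) - f x\<bar> \<le> K * norm (t *\<^sub>R w)"
    using lipschitz_onD[OF lip, of "x + t *\<^sub>R w" x] by (simp add: dist_norm)
  then show ?thesis using False by (simp add: dir_quot_def abs_divide divide_le_eq mult.assoc mult.commute mult.left_commute)
qed (use lipschitz_on_nonneg[OF lip] in \<open>simp add: dir_quot_def\<close>)

text \<open>Almost everywhere \<open>g x\<close> is the limit of averages of \<open>g\<close> over
  small boxes with corner \<open>x\<close>, and all these averages vanish.\<close>

lemma AE_zero_if_box_integrals_zero:
  fixes g :: "'a::euclidean_space \<Rightarrow> real"
  assumes "\<And>a b. (g has_integral 0) (cbox a b)"
  shows "AE x in lborel. g x = 0"
proof -
  have "g integrable_on cbox a b" for a b using assms by (auto simp: integrable_on_def)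
  then obtain N where N: "negligible N" and lim: "\<And>x e. \<lbrakk>x \<notin> N; 0 < e\<rbrakk> \<Longrightarrow>
     \<exists>d>0. \<forall>h. 0 < h \<and> h < d \<longrightarrow>
        norm(integral (cbox x (x + h *\<^sub>R One)) g /\<^sub>R h ^ DIM('a) - g x) < e"
    by (rule integrable_ccontinuous_explicit) blast
  have "g x = 0" if "x \<notin> N" for x
  proof -
    have "\<bar>g x\<bar> < e" if "0 < e" for e
    proof -
      from lim[OF \<open>x \<notin> N\<close> that] obtain d where "d > 0"
        "\<And>h. 0 < h \<Longrightarrow> h < d \<Longrightarrow> norm(integral (cbox x (x + h *\<^sub>R One)) g /\<^sub>R h ^ DIM('a) - g x) < e" by blast
      from this(2)[of "d / 2"] this(1) show ?thesis using integral_unique[OF assms] by simp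
    qed
    then show ?thesis using order.irrefl zero_less_abs_iff by metis
  qed
  then have "AE x in lebesgue. g x = 0"
    using N by (intro AE_I'[of N]) (auto simp: negligible_iff_null_sets)
  then show ?thesis by (rule AE_completion_iff[THEN iffD1])
qed

lemma indicator_translate_tendsto:
  fixes C :: "'a::real_normed_vector set"
  assumes x: "x \<notin> frontier C" and t: "t \<longlonglongrightarrow> 0"
  shows "(\<lambda>k. indicator C (x - t k *\<^sub>R v) :: real) \<longlonglongrightarrow> indicator C x"
proof -
  have lim: "(\<lambda>k. x - t k *\<^sub>R v) \<longlonglongrightarrow> x"
    using tendsto_diff[OF tendsto_const tendsto_scaleR[OF t tendsto_const], of x v] by simp
  consider "x \<in> interior C" | "x \<in> - closure C" using x by (auto simp: frontier_def)
  then show ?thesis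
  proof cases
    case 1
    have "\<forall>\<^sub>F k in sequentially. indicator C (x - t k *\<^sub>R v) = (indicator C x :: real)"
      using topological_tendstoD[OF lim open_interior 1]
      by eventually_elim (use 1 interior_subset[of C] in \<open>auto simp: indicator_def\<close>)
    then show ?thesis by (simp add: tendsto_eventually)
  next
    case 2
    have "\<forall>\<^sub>F k in sequentially. x - t k *\<^sub>R v \<in> - closure C"
      using topological_tendstoD[OF lim _ 2] by auto
    then have "\<forall>\<^sub>F k in sequentially. indicator C (x - t k *\<^sub>R v) = (indicator C x :: real)"
      by eventually_elim (use 2 closure_subset[of C] in \<open>auto simp: indicator_def\<close>)
    then show ?thesis by (simp add: tendsto_eventually)
  qed
qed

lemma lborel_integral_translate:
  fixes h :: "'a::euclidean_space \<Rightarrow> real"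
  assumes [measurable]: "h \<in> borel_measurable borel"
  shows "(\<integral>x. h (x + c) \<partial>lborel) = (\<integral>x. h x \<partial>lborel)"
proof -
  have "(\<integral>x. h x \<partial>lborel) = (\<integral>x. h x \<partial>distr lborel borel ((+) c))" unfolding lborel_distr_plus ..
  also have "\<dots> = (\<integral>x. h (c + x) \<partial>lborel)" by (subst integral_distr) auto
  finally show ?thesis by (simp add: add.commute)
qed

text \<open>Averaging over a box turns \<open>f (x + t (v + w)) - f (x + t v)\<close> into a quotient over a translated
  box, which makes the averaged directional derivatives additive; boxes then separate functions a.e.\<close>
lemma dir_deriv_add_ae:
  fixes f :: "'a::euclidean_space \<Rightarrow> real"
  assumes lip: "K-lipschitz_on UNIV f"
  shows "AE x in lborel. dir_deriv f (v + w) x = dir_deriv f v x + dir_deriv f w x"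
proof -
  have K: "K \<ge> 0" using lip by (rule lipschitz_on_nonneg)
  have contf: "continuous_on UNIV f" using lip by (rule lipschitz_on_continuous_on)
  note [measurable] = borel_measurable_dir_quot[OF contf]
  define t where "t = (\<lambda>k. inverse (real (Suc k)))"
  have t: "t \<longlonglongrightarrow> 0" "\<And>k. 0 < t k" "\<And>k. t k \<le> 1"
    using LIMSEQ_inverse_real_of_nat by (auto simp: t_def field_simps)
  have D_m[measurable]: "dir_deriv f u \<in> borel_measurable borel" for u
    unfolding dir_deriv_def by (intro borel_measurable_lim_metric) simp
  have q_lim: "AE x in lborel. (\<lambda>k. dir_quot f u x (t k)) \<longlonglongrightarrow> dir_deriv f u x" for u
    using lipschitz_dir_deriv_ae[OF lip, of u]
  proof eventually_elim
    case (elim x)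
    then have "(dir_quot f u x \<longlongrightarrow> dir_deriv f u x) (at 0)" by (simp add: dir_quot_tendsto_iff)
    then show ?case unfolding t_def by (rule filterlim_compose[OF _ inverse_Suc_filterlim_at])
  qed
  have D_b: "AE x in lborel. \<bar>dir_deriv f u x\<bar> \<le> K * norm u" for u
    using q_lim[of u]
  proof eventually_elim
    case (elim x)
    show ?case
      by (rule tendsto_upperbound[OF tendsto_rabs[OF elim]]) (auto intro!: always_eventually dir_quot_bound[OF lip])
  qed
  have intD: "integrable lborel (\<lambda>x. indicator (cbox a b) x * dir_deriv f u x)" for u a b
  proof (rule Bochner_Integration.integrable_bound)
    show "integrable lborel (\<lambda>x. K * norm u * indicator (cbox a b) x)"
      by (intro integrable_mult_right integrable_real_indicator) (auto simp: emeasure_lborel_cbox_eq)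
    show "AE x in lborel. norm (indicator (cbox a b) x * dir_deriv f u x) \<le> norm (K * norm u * indicator (cbox a b) x)"
      using D_b[of u] by eventually_elim (use K in \<open>auto simp: indicator_def abs_mult\<close>)
  qed simp
  have lim: "(\<lambda>k. \<integral>x. indicator (cbox a b) (x - t k *\<^sub>R z) * dir_quot f u x (t k) \<partial>lborel)
      \<longlonglongrightarrow> (\<integral>x. indicator (cbox a b) x * dir_deriv f u x \<partial>lborel)" for a b u z
  proof -
    obtain R where R: "\<And>x. x \<in> cbox a b \<Longrightarrow> norm x \<le> R"
      using bounded_cbox[of a b] by (auto simp: bounded_iff)
    show ?thesis
    proof (rule integral_dominated_convergence)
      \<comment> \<open>The dominating function has to cover all translated boxes at once; the
        radius \<open>R + norm z\<close> suffices because \<open>t k \<le> 1\<close>.\<close>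
      show "integrable lborel (\<lambda>x. K * norm u * indicator (cball 0 (R + norm z)) x)"
        by (intro integrable_mult_right integrable_real_indicator) (use emeasure_bounded_finite[OF bounded_cball] in \<open>auto simp: less_top\<close>)
      have "negligible (frontier (cbox a b))" by (simp add: negligible_convex_frontier)
      then have "AE x in lborel. x \<notin> frontier (cbox a b)"
        by (intro AE_I'[of "frontier (cbox a b)"]) (auto simp: negligible_iff_null_sets null_sets_def)
      with q_lim[of u]
      show "AE x in lborel. (\<lambda>k. indicator (cbox a b) (x - t k *\<^sub>R z) * dir_quot f u x (t k))
               \<longlonglongrightarrow> indicator (cbox a b) x * dir_deriv f u x"
        by eventually_elim (intro tendsto_mult indicator_translate_tendsto t)
      fix k
      show "AE x in lborel. norm (indicator (cbox a b) (x - t k *\<^sub>R z) * dir_quot f u x (t k))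
               \<le> K * norm u * indicator (cball 0 (R + norm z)) x"
      proof (intro AE_I2)
        fix x
        show "norm (indicator (cbox a b) (x - t k *\<^sub>R z) * dir_quot f u x (t k))
               \<le> K * norm u * indicator (cball 0 (R + norm z)) x"
        proof (cases "x - t k *\<^sub>R z \<in> cbox a b")
          case True
          have "norm x \<le> norm (x - t k *\<^sub>R z) + norm (t k *\<^sub>R z)" using norm_triangle_ineq[of "x - t k *\<^sub>R z" "t k *\<^sub>R z"] by simp
          also have "norm (t k *\<^sub>R z) \<le> norm z" using t(2,3)[of k] by (simp add: mult_left_le_one_le)
          finally have "x \<in> cball 0 (R + norm z)" using R[OF True] by simp
          then show ?thesis using dir_quot_bound[OF lip] True by simp
        qed (use K in simp)
      qed
    qed measurable
  qed
  have add: "(\<integral>x. indicator (cbox a b) x * dir_deriv f (v + w) x \<partial>lborel)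
     = (\<integral>x. indicator (cbox a b) x * dir_deriv f v x \<partial>lborel) + (\<integral>x. indicator (cbox a b) x * dir_deriv f w x \<partial>lborel)" for a b
  proof (rule LIMSEQ_unique)
    show "(\<lambda>k. (\<integral>x. indicator (cbox a b) (x - t k *\<^sub>R 0) * dir_quot f v x (t k) \<partial>lborel)
             + (\<integral>x. indicator (cbox a b) (x - t k *\<^sub>R v) * dir_quot f w x (t k) \<partial>lborel)) \<longlonglongrightarrow>
      (\<integral>x. indicator (cbox a b) x * dir_deriv f v x \<partial>lborel) + (\<integral>x. indicator (cbox a b) x * dir_deriv f w x \<partial>lborel)"
      by (intro tendsto_add lim)
    have intq: "integrable lborel (\<lambda>x. indicator (cbox a b) x * dir_quot f u (x + c) s)" for u s c
    proof (rule Bochner_Integration.integrable_bound)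
      show "integrable lborel (\<lambda>x. K * norm u * indicator (cbox a b) x)"
        by (intro integrable_mult_right integrable_real_indicator) (auto simp: emeasure_lborel_cbox_eq)
      show "AE x in lborel. norm (indicator (cbox a b) x * dir_quot f u (x + c) s) \<le> norm (K * norm u * indicator (cbox a b) x)"
        using dir_quot_bound[OF lip, of u] K by (intro AE_I2) (auto simp: indicator_def abs_mult)
    qed measurable
    have "(\<integral>x. indicator (cbox a b) (x - t k *\<^sub>R 0) * dir_quot f v x (t k) \<partial>lborel)
             + (\<integral>x. indicator (cbox a b) (x - t k *\<^sub>R v) * dir_quot f w x (t k) \<partial>lborel)
         = (\<integral>x. indicator (cbox a b) (x - t k *\<^sub>R 0) * dir_quot f (v + w) x (t k) \<partial>lborel)" for k
    proof -
      have "(\<integral>x. indicator (cbox a b) (x - t k *\<^sub>R v) * dir_quot f w x (t k) \<partial>lborel)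
         = (\<integral>x. indicator (cbox a b) x * dir_quot f w (x + t k *\<^sub>R v) (t k) \<partial>lborel)"
        using lborel_integral_translate[of "\<lambda>x. indicator (cbox a b) (x - t k *\<^sub>R v) * dir_quot f w x (t k)" "t k *\<^sub>R v"]
        by simp
      then have "(\<integral>x. indicator (cbox a b) (x - t k *\<^sub>R 0) * dir_quot f v x (t k) \<partial>lborel)
             + (\<integral>x. indicator (cbox a b) (x - t k *\<^sub>R v) * dir_quot f w x (t k) \<partial>lborel)
         = (\<integral>x. indicator (cbox a b) x * dir_quot f v (x + 0) (t k) \<partial>lborel)
             + (\<integral>x. indicator (cbox a b) x * dir_quot f w (x + t k *\<^sub>R v) (t k) \<partial>lborel)" by simp
      also have "\<dots> = (\<integral>x. indicator (cbox a b) x * dir_quot f v (x + 0) (t k)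
             + indicator (cbox a b) x * dir_quot f w (x + t k *\<^sub>R v) (t k) \<partial>lborel)"
        by (rule Bochner_Integration.integral_add[symmetric]; rule intq)
      also have "\<dots> = (\<integral>x. indicator (cbox a b) (x - t k *\<^sub>R 0) * dir_quot f (v + w) x (t k) \<partial>lborel)"
      proof (rule Bochner_Integration.integral_cong)
        fix x
        have "dir_quot f v x (t k) + dir_quot f w (x + t k *\<^sub>R v) (t k) = dir_quot f (v + w) x (t k)"
          by (simp add: dir_quot_def add_divide_distrib[symmetric] algebra_simps)
        then show "indicator (cbox a b) x * dir_quot f v (x + 0) (t k) + indicator (cbox a b) x * dir_quot f w (x + t k *\<^sub>R v) (t k)
            = indicator (cbox a b) (x - t k *\<^sub>R 0) * dir_quot f (v + w) x (t k)"
          by (simp flip: distrib_left)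
      qed simp
      finally show ?thesis .
    qed
    then show "(\<lambda>k. (\<integral>x. indicator (cbox a b) (x - t k *\<^sub>R 0) * dir_quot f v x (t k) \<partial>lborel)
             + (\<integral>x. indicator (cbox a b) (x - t k *\<^sub>R v) * dir_quot f w x (t k) \<partial>lborel)) \<longlonglongrightarrow>
      (\<integral>x. indicator (cbox a b) x * dir_deriv f (v + w) x \<partial>lborel)"
      using lim[of a b 0 "v + w"] by simp
  qed
  define g where "g = (\<lambda>x. dir_deriv f (v + w) x - dir_deriv f v x - dir_deriv f w x)"
  have "(g has_integral 0) (cbox a b)" for a b
  proof -
    have "has_bochner_integral lborel (\<lambda>x. indicator (cbox a b) x * dir_deriv f (v + w) x
        - indicator (cbox a b) x * dir_deriv f v x - indicator (cbox a b) x * dir_deriv f w x) 0"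
      using add[of a b] intD by (simp add: has_bochner_integral_iff)
    from has_integral_integral_lborel[OF has_bochner_integral_iff[THEN iffD1, THEN conjunct1, OF this]] this
    have "((\<lambda>x. indicator (cbox a b) x * dir_deriv f (v + w) x
        - indicator (cbox a b) x * dir_deriv f v x - indicator (cbox a b) x * dir_deriv f w x) has_integral 0) UNIV"
      by (simp only: has_bochner_integral_integral_eq)
    also have "(\<lambda>x. indicator (cbox a b) x * dir_deriv f (v + w) x
        - indicator (cbox a b) x * dir_deriv f v x - indicator (cbox a b) x * dir_deriv f w x)
      = (\<lambda>x. if x \<in> cbox a b then g x else 0)" by (auto simp: g_def indicator_def)
    finally show ?thesis by (simp only: has_integral_restrict_UNIV)
  qed
  from AE_zero_if_box_integrals_zero[OF this]
  show ?thesis by eventually_elim (simp add: g_def)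
qed

text \<open>The exceptional set depends on \<open>v\<close>. Additivity is used once per basis
  vector, so only finitely many null sets accumulate.\<close>

lemma lipschitz_dir_deriv_linear_ae:
  fixes f :: "'a::euclidean_space \<Rightarrow> real"
  assumes lip: "K-lipschitz_on UNIV f"
  shows "AE x in lborel. ((\<lambda>t. f (x + t *\<^sub>R v)) has_real_derivative
           (\<Sum>b\<in>Basis. (v \<bullet> b) * dir_deriv f b x)) (at 0)"
proof -
  have sum: "AE x in lborel. dir_deriv f (\<Sum>b\<in>B. (v \<bullet> b) *\<^sub>R b) x = (\<Sum>b\<in>B. (v \<bullet> b) * dir_deriv f b x)"
    if "finite B" for B :: "'a set"
    using that
  proof induction
    case empty
    have "dir_deriv f 0 x = 0" for x by (rule dir_deriv_eqI) simp
    then show ?case by simp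
  next
    case (insert b B)
    have "AE x in lborel. dir_deriv f ((v \<bullet> b) *\<^sub>R b) x = (v \<bullet> b) * dir_deriv f b x"
      using lipschitz_dir_deriv_ae[OF lip, of b]
      by eventually_elim (rule dir_deriv_eqI[OF dir_deriv_scale])
    with insert.IH dir_deriv_add_ae[OF lip, of "(v \<bullet> b) *\<^sub>R b" "\<Sum>b\<in>B. (v \<bullet> b) *\<^sub>R b"]
    show ?case by eventually_elim (simp add: insert.hyps)
  qed
  from sum[OF finite_Basis] lipschitz_dir_deriv_ae[OF lip, of v]
  show ?thesis by eventually_elim (simp add: euclidean_representation)
qed

section \<open>From directional to total derivatives\<close>

lemma real_derivative_0_bound:
  fixes h :: "real \<Rightarrow> real"
  assumes "(h has_real_derivative a) (at 0)" "c > 0"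
  shows "\<exists>d>0. \<forall>t. \<bar>t\<bar> < d \<longrightarrow> \<bar>h t - h 0 - t * a\<bar> \<le> c * \<bar>t\<bar>"
proof -
  have "(h has_derivative (\<lambda>t. t * a)) (at 0)"
    using assms(1) by (simp add: has_field_derivative_def mult_commute_abs)
  from this[unfolded has_derivative_at_alt, THEN conjunct2, rule_format, OF assms(2)]
  show ?thesis by simp
qed

text \<open>By compactness of the unit sphere finitely many directions of \<open>S\<close> come
  within \<open>c\<close> of every unit vector. The difference quotients in these directions
  converge uniformly, being finitely many, and the Lipschitz bound controls the change to a
  neighbouring direction.\<close>

lemma has_derivative_from_dense_directions:
  fixes f :: "'a::euclidean_space \<Rightarrow> real"
  assumes lip: "K-lipschitz_on UNIV f"
    and dense: "\<And>X :: 'a set. open X \<Longrightarrow> X \<noteq> {} \<Longrightarrow> \<exists>d\<in>S. d \<in> X"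
    and der: "\<And>v. v \<in> S \<Longrightarrow> ((\<lambda>t. f (x + t *\<^sub>R v)) has_real_derivative g \<bullet> v) (at 0)"
  shows "(f has_derivative (\<lambda>h. g \<bullet> h)) (at x)"
  unfolding has_derivative_at_alt
proof (intro conjI allI impI bounded_linear_inner_right)
  fix e :: real assume "0 < e"
  have K: "K \<ge> 0" using lip by (rule lipschitz_on_nonneg)
  \<comment> \<open>Three errors must add up to \<open>e\<close>: \<open>K * c\<close> for moving
    \<open>f\<close> to the nearby direction, \<open>c\<close> for the quotient in that direction,
    and \<open>norm g * c\<close> for moving the linear term.\<close>
  define c where "c = e / (K + norm g + 1)"
  have c: "c > 0" unfolding c_def using \<open>0 < e\<close> K norm_ge_zero[of g] by (intro divide_pos_pos) linarith+
  have c_eq: "K * c + c + norm g * c = e"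
  proof -
    have "K + norm g + 1 \<noteq> 0" using K norm_ge_zero[of g] by linarith
    then have "c * (K + norm g + 1) = e" by (simp add: c_def)
    then show ?thesis by (simp add: algebra_simps)
  qed
  have "sphere (0::'a) 1 \<subseteq> (\<Union>v\<in>S. ball v c)"
  proof
    fix w :: 'a
    obtain v where "v \<in> S" "v \<in> ball w c" using dense[of "ball w c"] c by auto
    then show "w \<in> (\<Union>v\<in>S. ball v c)" by (auto simp: dist_commute)
  qed
  from compactE_image[OF compact_sphere open_ball this]
  obtain S' where S': "S' \<subseteq> S" "finite S'" "sphere (0::'a) 1 \<subseteq> (\<Union>v\<in>S'. ball v c)" .
  have "\<exists>d>0. \<forall>t. \<bar>t\<bar> < d \<longrightarrow> \<bar>f (x + t *\<^sub>R v) - f x - t * (g \<bullet> v)\<bar> \<le> c * \<bar>t\<bar>" if "v \<in> S'" for v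
    using real_derivative_0_bound[OF der[of v] c] that S'(1) by auto
  then have "\<exists>d. \<forall>v\<in>S'. d v > 0 \<and> (\<forall>t. \<bar>t\<bar> < d v \<longrightarrow> \<bar>f (x + t *\<^sub>R v) - f x - t * (g \<bullet> v)\<bar> \<le> c * \<bar>t\<bar>)"
    by (intro bchoice) blast
  then obtain d where d: "\<And>v. v \<in> S' \<Longrightarrow> d v > 0"
    "\<And>v t. v \<in> S' \<Longrightarrow> \<bar>t\<bar> < d v \<Longrightarrow> \<bar>f (x + t *\<^sub>R v) - f x - t * (g \<bullet> v)\<bar> \<le> c * \<bar>t\<bar>"
    by blast
  \<comment> \<open>The inserted 1 keeps the set nonempty, as \<open>Min\<close> requires.\<close>
  define r where "r = Min (insert 1 (d ` S'))"
  have r: "r > 0" "\<And>v. v \<in> S' \<Longrightarrow> r \<le> d v"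
    unfolding r_def using S'(2) d(1) by (auto simp: Min_gr_iff)
  have "norm (f y - f x - g \<bullet> (y - x)) \<le> e * norm (y - x)" if y: "norm (y - x) < r" for y
  proof (cases "y = x")
    case False
    define t where "t = norm (y - x)"
    define w where "w = (1 / t) *\<^sub>R (y - x)"
    have "t > 0" using False by (simp add: t_def)
    then have t: "t > 0" "y = x + t *\<^sub>R w" by (simp_all add: w_def)
    have w: "norm w = 1" unfolding w_def t_def using False by simp
    then have "w \<in> (\<Union>v\<in>S'. ball v c)" using S'(3) by (auto simp del: mem_ball)
    then obtain v where v: "v \<in> S'" "norm (w - v) < c" by (auto simp: dist_norm norm_minus_commute)
    have "\<bar>f (x + t *\<^sub>R v) - f x - t * (g \<bullet> v)\<bar> \<le> c * t"
    proof -
      have "\<bar>t\<bar> < d v" using y r(2)[OF v(1)] \<open>t > 0\<close> by (simp add: t_def)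
      from d(2)[OF v(1) this] show ?thesis using \<open>t > 0\<close> by simp
    qed
    moreover have "\<bar>f (x + t *\<^sub>R w) - f (x + t *\<^sub>R v)\<bar> \<le> K * c * t"
    proof -
      have "\<bar>f (x + t *\<^sub>R w) - f (x + t *\<^sub>R v)\<bar> \<le> K * norm (t *\<^sub>R (w - v))"
        using lipschitz_onD[OF lip, of "x + t *\<^sub>R w" "x + t *\<^sub>R v"] by (simp add: dist_norm scaleR_diff_right)
      also have "\<dots> \<le> K * (c * t)" using K t(1) v(2) by (intro mult_left_mono) auto
      finally show ?thesis by (simp add: mult.assoc)
    qed
    moreover have "\<bar>t * (g \<bullet> v) - t * (g \<bullet> w)\<bar> \<le> norm g * c * t"
    proof -
      have "\<bar>t * (g \<bullet> v) - t * (g \<bullet> w)\<bar> = t * \<bar>g \<bullet> (w - v)\<bar>"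
        using t(1) by (simp add: inner_diff_right abs_mult right_diff_distrib[symmetric] abs_minus_commute)
      also have "\<dots> \<le> t * (norm g * c)"
        using t(1) v(2) Cauchy_Schwarz_ineq2[of g "w - v"] mult_left_mono[of "norm (w - v)" c "norm g"]
        by (intro mult_left_mono) auto
      finally show ?thesis by (simp add: mult_ac)
    qed
    moreover have fy: "f y = f (x + t *\<^sub>R w)" using t(2) by (rule arg_cong)
    moreover have "g \<bullet> (y - x) = t * (g \<bullet> w)" by (simp add: t(2))
    ultimately have "\<bar>f y - f x - g \<bullet> (y - x)\<bar> \<le> K * c * t + c * t + norm g * c * t"
      unfolding fy by linarith
    also have "\<dots> = (K * c + c + norm g * c) * t" by (simp add: algebra_simps)
    also have "\<dots> = e * t" unfolding c_eq ..
    finally show ?thesis by (simp add: t_def)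
  qed simp
  with r(1) show "\<exists>d>0. \<forall>y. norm (y - x) < d \<longrightarrow> norm (f y - f x - g \<bullet> (y - x)) \<le> e * norm (y - x)"
    by blast
qed

text \<open>A countable dense set of directions suffices, so the null sets excluded for the
  individual directions still have a null union.\<close>

lemma Rademacher_real:
  fixes f :: "'a::euclidean_space \<Rightarrow> real"
  assumes lip: "K-lipschitz_on UNIV f"
  shows "AE x in lborel. f differentiable (at x)"
proof -
  have "\<exists>S::'a set. countable S \<and> (\<forall>X. open X \<longrightarrow> X \<noteq> {} \<longrightarrow> (\<exists>d\<in>S. d \<in> X))"
    by (rule countable_dense_exists)
  then obtain S :: "'a set" where S: "countable S"
    and dense: "\<forall>X. open X \<longrightarrow> X \<noteq> {} \<longrightarrow> (\<exists>d\<in>S. d \<in> X)"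
    by (elim exE conjE)
  have "AE x in lborel. \<forall>v\<in>S. ((\<lambda>t. f (x + t *\<^sub>R v)) has_real_derivative
           (\<Sum>b\<in>Basis. (v \<bullet> b) * dir_deriv f b x)) (at 0)"
    unfolding AE_ball_countable[OF S] by (intro ballI lipschitz_dir_deriv_linear_ae[OF lip])
  then show ?thesis
  proof eventually_elim
    case (elim x)
    define g where "g = (\<Sum>b\<in>Basis. dir_deriv f b x *\<^sub>R b)"
    have g: "g \<bullet> v = (\<Sum>b\<in>Basis. (v \<bullet> b) * dir_deriv f b x)" for v
      unfolding g_def inner_sum_left by (intro sum.cong refl) (simp add: inner_commute)
    have der: "((\<lambda>t. f (x + t *\<^sub>R v)) has_real_derivative g \<bullet> v) (at 0)" if "v \<in> S" for v
      unfolding g by (rule bspec[OF elim that])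
    have "(f has_derivative (\<lambda>h. g \<bullet> h)) (at x)"
    proof (rule has_derivative_from_dense_directions[OF lip])
      show "\<exists>d\<in>S. d \<in> X" if "open X" "X \<noteq> {}" for X using dense[rule_format, OF that] .
    qed (rule der)
    then show ?case by (rule differentiableI)
  qed
qed

theorem Rademacher:
  fixes f :: "'a::euclidean_space \<Rightarrow> 'b::euclidean_space"
  assumes lip: "K-lipschitz_on UNIV f"
  shows "AE x in lborel. f differentiable (at x)"
proof -
  have "AE x in lborel. \<forall>b\<in>Basis. (\<lambda>x. f x \<bullet> b) differentiable (at x)"
    unfolding AE_ball_countable[OF countable_finite[OF finite_Basis]]
  proof
    fix b :: 'b assume b: "b \<in> Basis"
    have "K-lipschitz_on UNIV (\<lambda>x. f x \<bullet> b)"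
    proof (rule lipschitz_onI)
      fix x y
      have "dist (f x \<bullet> b) (f y \<bullet> b) \<le> dist (f x) (f y)"
        using Basis_le_norm[OF b, of "f x - f y"] by (simp add: dist_norm inner_diff_left)
      also have "\<dots> \<le> K * dist x y" using lipschitz_onD[OF lip] by blast
      finally show "dist (f x \<bullet> b) (f y \<bullet> b) \<le> K * dist x y" .
    qed (use lipschitz_on_nonneg[OF lip] in simp)
    then show "AE x in lborel. (\<lambda>x. f x \<bullet> b) differentiable (at x)" by (rule Rademacher_real)
  qed
  then show ?thesis by eventually_elim (rule differentiable_componentwise_within[THEN iffD2])
qed

text \<open>Composing with the nearest-point projection onto the ball, which is 1-Lipschitz, extends
  \<open>f\<close> to the whole space without changing it on the open ball.\<close>

lemma Rademacher_cball:
  fixes f :: "'a::euclidean_space \<Rightarrow> 'b::euclidean_space"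
  assumes lip: "K-lipschitz_on (cball c r) f"
  shows "AE x in lborel. x \<in> ball c r \<longrightarrow> f differentiable (at x)"
proof (cases "r > 0")
  case True
  define p where "p = closest_point (cball c r)"
  have "1-lipschitz_on UNIV p"
    unfolding p_def using True by (intro lipschitz_onI) (auto intro: closest_point_lipschitz)
  moreover have "p ` UNIV \<subseteq> cball c r"
    unfolding p_def using True by (auto intro: closest_point_in_set simp del: mem_cball)
  ultimately have "(K * 1)-lipschitz_on UNIV (f \<circ> p)"
    unfolding comp_def using lipschitz_on_subset[OF lip] by (intro lipschitz_on_compose2)
  from Rademacher[OF this] show ?thesis
  proof eventually_elim
    case (elim x)
    show ?case
    proof
      assume x: "x \<in> ball c r"
      have eq: "(f \<circ> p) y = f y" if "y \<in> ball c r" for y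
        using that by (simp add: p_def closest_point_self)
      obtain D where D: "(f \<circ> p has_derivative D) (at x)"
        using elim by (auto simp: differentiable_def)
      have "(f has_derivative D) (at x)"
        by (rule has_derivative_transform_within_open[OF D open_ball x eq])
      then show "f differentiable (at x)" by (auto simp: differentiable_def)
    qed
  qed
next
  case False
  then have "x \<notin> ball c r" for x using zero_le_dist[of c x] False unfolding mem_ball by linarith
  then show ?thesis by simp
qed

section \<open>Minty's one-point extension\<close>

text \<open>The common point is \<open>s0 / 2\<close>, where \<open>s0\<close> is the first component of a maximiser of the Lagrangian
  dual function \<open>r - (norm s)\<^sup>2 / 4\<close> over the convex hull of the points \<open>(s, a, c, r) = (a + c, a, c, a \<bullet> c)\<close>;
  monotonicity makes \<open>r \<le> a \<bullet> c\<close> on this hull, so the dual value is nonpositive.\<close>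
lemma monotone_finite_point:
  fixes S :: "('a::euclidean_space \<times> 'a) set"
  assumes fin: "finite S"
    and mono: "\<And>a c a' c'. (a, c) \<in> S \<Longrightarrow> (a', c') \<in> S \<Longrightarrow> (c - c') \<bullet> (a - a') \<le> 0"
  shows "\<exists>x. \<forall>(a, c) \<in> S. (x - c) \<bullet> (x - a) \<le> 0"
proof (cases "S = {}")
  case False
  \<comment> \<open>The dual function reads only the first and the last slot; \<open>a\<close> and
    \<open>c\<close> are carried along so that the last slot of a convex combination can be compared
    with the product of their averages.\<close>
  define S' where "S' = (\<lambda>(a, c). (a + c, a, c, a \<bullet> c)) ` S"
  define C where "C = convex hull S'"
  \<comment> \<open>The constraint on \<open>x\<close> expands to
    \<open>x \<bullet> x - x \<bullet> (a + c) + a \<bullet> c \<le> 0\<close>. For averaged data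
    \<open>s\<close>, \<open>r\<close> the left side is minimal at \<open>x = s / 2\<close>, with
    value \<open>D\<close>.\<close>
  define D where "D = (\<lambda>z :: 'a \<times> 'a \<times> 'a \<times> real. snd (snd (snd z)) - (norm (fst z))\<^sup>2 / 4)"
  have finS': "finite S'" using fin by (simp add: S'_def)
  have "compact C" unfolding C_def by (intro finite_imp_compact_convex_hull finS')
  moreover have "C \<noteq> {}" using False by (auto simp: C_def S'_def)
  moreover have "continuous_on C D" unfolding D_def by (intro continuous_intros) auto
  ultimately obtain m where m: "m \<in> C" "\<And>z. z \<in> C \<Longrightarrow> D z \<le> D m"
    using continuous_attains_sup by metis
  obtain s0 a0 c0 r0 where m_eq: "m = (s0, a0, c0, r0)" by (metis prod.collapse)
  have Dm: "D m \<le> 0"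
  proof -
    from m(1) obtain l where l: "\<And>z. z \<in> S' \<Longrightarrow> 0 \<le> l z" "sum l S' = 1" and ms: "(\<Sum>z\<in>S'. l z *\<^sub>R z) = m"
      unfolding C_def convex_hull_finite[OF finS'] by auto
    define A where "A = (\<lambda>z :: 'a \<times> 'a \<times> 'a \<times> real. fst (snd z))"
    define B where "B = (\<lambda>z :: 'a \<times> 'a \<times> 'a \<times> real. fst (snd (snd z)))"
    have S'p: "fst z = A z + B z" "snd (snd (snd z)) = A z \<bullet> B z" if "z \<in> S'" for z
      using that by (auto simp: S'_def A_def B_def)
    have S'm: "(B z - B w) \<bullet> (A z - A w) \<le> 0" if "z \<in> S'" "w \<in> S'" for z w
      using that mono unfolding S'_def A_def B_def by fastforce
    have a0: "a0 = (\<Sum>z\<in>S'. l z *\<^sub>R A z)" and c0: "c0 = (\<Sum>z\<in>S'. l z *\<^sub>R B z)"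
      and s0: "s0 = (\<Sum>z\<in>S'. l z *\<^sub>R fst z)" and r0: "r0 = (\<Sum>z\<in>S'. l z * snd (snd (snd z)))"
      using ms unfolding m_eq A_def B_def by (auto simp: prod_eq_iff fst_sum snd_sum)
    have s0': "s0 = a0 + c0"
      unfolding s0 a0 c0 by (simp add: S'p(1) scaleR_add_right sum.distrib)
    have r0': "r0 = (\<Sum>z\<in>S'. l z * (A z \<bullet> B z))" unfolding r0 by (intro sum.cong) (auto simp: S'p(2))
    \<comment> \<open>Expanded, this double sum equals \<open>2 * (r0 - a0 \<bullet> c0)\<close>;
      monotonicity makes each of its terms nonpositive.\<close>
    have "(\<Sum>z\<in>S'. \<Sum>w\<in>S'. l z * l w * ((B z - B w) \<bullet> (A z - A w))) \<le> 0"
      by (intro sum_nonpos mult_nonneg_nonpos mult_nonneg_nonneg l S'm)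
    also have "(\<Sum>z\<in>S'. \<Sum>w\<in>S'. l z * l w * ((B z - B w) \<bullet> (A z - A w)))
       = (\<Sum>z\<in>S'. \<Sum>w\<in>S'. l w * (l z * (A z \<bullet> B z))) + (\<Sum>z\<in>S'. \<Sum>w\<in>S'. l z * (l w * (A w \<bullet> B w)))
         - (\<Sum>z\<in>S'. \<Sum>w\<in>S'. (l z *\<^sub>R A z) \<bullet> (l w *\<^sub>R B w)) - (\<Sum>z\<in>S'. \<Sum>w\<in>S'. (l w *\<^sub>R A w) \<bullet> (l z *\<^sub>R B z))"
      by (simp add: sum.distrib[symmetric] sum_subtractf[symmetric] inner_simps inner_commute algebra_simps)
    also have "(\<Sum>z\<in>S'. \<Sum>w\<in>S'. (l w *\<^sub>R A w) \<bullet> (l z *\<^sub>R B z)) = (\<Sum>z\<in>S'. \<Sum>w\<in>S'. (l z *\<^sub>R A z) \<bullet> (l w *\<^sub>R B w))"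
      by (rule sum.swap)
    also have "(\<Sum>z\<in>S'. \<Sum>w\<in>S'. (l z *\<^sub>R A z) \<bullet> (l w *\<^sub>R B w)) = a0 \<bullet> c0"
      unfolding a0 c0 by (subst inner_sum_left) (simp only: inner_sum_right)
    also have "(\<Sum>z\<in>S'. \<Sum>w\<in>S'. l w * (l z * (A z \<bullet> B z))) = r0"
      by (simp add: r0' sum_distrib_right[symmetric] l(2))
    also have "(\<Sum>z\<in>S'. \<Sum>w\<in>S'. l z * (l w * (A w \<bullet> B w))) = r0"
      by (simp add: r0' sum_distrib_left[symmetric] sum_distrib_right[symmetric] l(2))
    finally have "r0 \<le> a0 \<bullet> c0" by simp
    also have "\<dots> \<le> (norm s0)\<^sup>2 / 4"
      using zero_le_power2[of "norm (a0 - c0)"] unfolding s0' power2_norm_eq_inner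
      by (simp add: inner_simps inner_commute)
    finally show ?thesis by (simp add: D_def m_eq)
  qed
  have "((1/2) *\<^sub>R s0 - c) \<bullet> ((1/2) *\<^sub>R s0 - a) \<le> 0" if ac: "(a, c) \<in> S" for a c
  proof -
    define z where "z = (a + c, a, c, a \<bullet> c)"
    have zC: "z \<in> C" unfolding C_def S'_def z_def by (rule hull_inc) (use ac in force)
    \<comment> \<open>Along the segment from \<open>m\<close> to \<open>z\<close>, at parameter
      \<open>t\<close>, the dual function equals \<open>D m + t * e - t^2 * n\<close>. Maximality at
      \<open>m\<close> forces its initial slope \<open>e\<close> to be nonpositive.\<close>
    define e where "e = a \<bullet> c - r0 - s0 \<bullet> (a + c - s0) / 2"
    define n where "n = (norm (a + c - s0))\<^sup>2 / 4"
    have ineq: "e \<le> t * n" if t: "0 < t" "t \<le> 1" for t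
    proof -
      have "(1 - t) *\<^sub>R m + t *\<^sub>R z \<in> C"
        using m(1) zC t convex_convex_hull[of S'] unfolding C_def convex_alt by auto
      from m(2)[OF this] have "t * e \<le> t * (t * n)"
        unfolding D_def m_eq z_def e_def n_def power2_norm_eq_inner
        by (simp add: inner_simps inner_commute algebra_simps power2_eq_square add_divide_distrib diff_divide_distrib)
      then show ?thesis using t by simp
    qed
    have "e \<le> 0"
    proof (rule ccontr)
      assume "\<not> e \<le> 0"
      then have e: "e > 0" by simp
      have n: "n \<ge> 0" by (simp add: n_def)
      define t where "t = min 1 (e / (2 * (n + 1)))"
      have "t > 0" "t \<le> 1" "t \<le> e / (2 * (n + 1))" using e n by (auto simp: t_def)
      moreover from this have "t * n \<le> e / (2 * (n + 1)) * n" using n by (intro mult_right_mono)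
      moreover have "e / (2 * (n + 1)) * n < e"
      proof -
        have "e * n < e * (2 * (n + 1))" using e n by (intro mult_strict_left_mono) auto
        then show ?thesis using n by (simp add: field_simps)
      qed
      ultimately show False using ineq[of t] by linarith
    qed
    \<comment> \<open>The left-hand side is exactly \<open>e + D m\<close>.\<close>
    then have "((1/2) *\<^sub>R s0 - c) \<bullet> ((1/2) *\<^sub>R s0 - a) \<le> D m"
      unfolding e_def D_def m_eq power2_norm_eq_inner
      by (simp add: inner_simps inner_commute field_simps)
    with Dm show ?thesis by linarith
  qed
  then show ?thesis by auto
qed auto

text \<open>Produces a point \<open>(x, u - x)\<close> monotonically related to all of
  \<open>G\<close>, with prescribed sum \<open>u\<close>. For each \<open>(a, b)\<close> the
  admissible \<open>x\<close> form the ball with diameter from \<open>a\<close> to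
  \<open>u - b\<close>, a compact set; \<open>monotone_finite_point\<close> gives the finite
  intersection property.\<close>

lemma monotone_extension_point:
  fixes G :: "('a::euclidean_space \<times> 'a) set"
  assumes mono: "\<And>a b a' b'. (a, b) \<in> G \<Longrightarrow> (a', b') \<in> G \<Longrightarrow> (b - b') \<bullet> (a - a') \<ge> 0"
  shows "\<exists>x. \<forall>(a, b) \<in> G. (u - x - b) \<bullet> (x - a) \<ge> 0"
proof -
  define B where "B = (\<lambda>(a, b). {x. (u - x - b) \<bullet> (x - a) \<ge> 0})"
  have "\<Inter> (B ` G) \<noteq> {}"
  proof (rule compact_fip_Heine_Borel)
    fix T assume "T \<in> B ` G"
    then obtain a b where T: "T = {x. (u - x - b) \<bullet> (x - a) \<ge> 0}" by (auto simp: B_def)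
    have "closed T" unfolding T by (intro closed_Collect_le continuous_intros)
    moreover have "T \<subseteq> cball a (norm (u - b - a))"
    proof
      fix x assume "x \<in> T"
      then have "(norm (x - a))\<^sup>2 \<le> (u - b - a) \<bullet> (x - a)"
        by (simp add: T power2_norm_eq_inner inner_simps inner_commute)
      also have "\<dots> \<le> norm (u - b - a) * norm (x - a)" by (rule norm_cauchy_schwarz)
      finally have "norm (x - a) \<le> norm (u - b - a)"
        by (cases "norm (x - a) = 0") (auto simp: power2_eq_square)
      then show "x \<in> cball a (norm (u - b - a))" by (simp add: dist_norm norm_minus_commute)
    qed
    ultimately show "compact T"
      by (metis bounded_cball bounded_subset compact_eq_bounded_closed)
  next
    fix \<F> assume "finite \<F>" "\<F> \<subseteq> B ` G"
    then obtain S where S: "finite S" "S \<subseteq> G" "\<F> = B ` S" by (metis finite_subset_image)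
    have "\<exists>x. \<forall>(a, c) \<in> (\<lambda>(a, b). (a, u - b)) ` S. (x - c) \<bullet> (x - a) \<le> 0"
    proof (rule monotone_finite_point)
      fix a c a' c' assume "(a, c) \<in> (\<lambda>(a, b). (a, u - b)) ` S" "(a', c') \<in> (\<lambda>(a, b). (a, u - b)) ` S"
      then have "(a, u - c) \<in> G" "(a', u - c') \<in> G" using S by auto
      from mono[OF this] show "(c - c') \<bullet> (a - a') \<le> 0" by (simp add: inner_diff_left)
    qed (use S in simp)
    then obtain x where "\<And>a b. (a, b) \<in> S \<Longrightarrow> (x - (u - b)) \<bullet> (x - a) \<le> 0" by fastforce
    then have "x \<in> \<Inter>\<F>" unfolding S B_def by (force simp: inner_diff_left)
    then show "\<Inter>\<F> \<noteq> {}" by blast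
  qed
  then show ?thesis unfolding B_def by auto
qed

section \<open>The space \<open>Zn\<close>\<close>

text \<open>Indexed families instead of sets, so that bases of different subspaces can be compared
  vector by vector and passed to a limit.\<close>

definition orthonormal_upto :: "nat \<Rightarrow> (nat \<Rightarrow> 'a::real_inner) \<Rightarrow> bool" where
  "orthonormal_upto n e \<longleftrightarrow> (\<forall>i<n. \<forall>j<n. e i \<bullet> e j = (if i = j then 1 else 0))"

lemma orthonormal_uptoD:
  "orthonormal_upto n e \<Longrightarrow> i < n \<Longrightarrow> j < n \<Longrightarrow> e i \<bullet> e j = (if i = j then 1 else 0)"
  by (simp add: orthonormal_upto_def)

lemma orthonormal_upto_norm: "orthonormal_upto n e \<Longrightarrow> i < n \<Longrightarrow> norm (e i) = 1"
  by (simp add: orthonormal_upto_def norm_eq_sqrt_inner)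

lemma orth_proj_eqI:
  assumes L: "subspace L" and p: "p \<in> L" "z - p \<in> orthogonal_comp L"
  shows "orth_proj L z = p"
  unfolding orth_proj_def
proof (rule the_equality)
  fix q assume q: "q \<in> L \<and> z - q \<in> orthogonal_comp L"
  then have "q - p \<in> L" using L p by (blast intro: subspace_diff)
  then have "(q - p) \<bullet> (z - p) = 0" "(q - p) \<bullet> (z - q) = 0"
    using p q by (auto simp: orthogonal_comp_def orthogonal_def)
  then have "(q - p) \<bullet> (q - p) = 0" by (simp add: inner_diff_right)
  then show "q = p" by simp
qed (use p in simp)

lemma orth_proj_self: "subspace L \<Longrightarrow> z \<in> L \<Longrightarrow> orth_proj L z = z"
  by (rule orth_proj_eqI) (auto simp: orthogonal_comp_def orthogonal_def)

lemma orth_proj_orthonormal: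
  assumes e: "orthonormal_upto n e"
  shows "orth_proj (span (e ` {..<n})) z = (\<Sum>i<n. (z \<bullet> e i) *\<^sub>R e i)"
proof (rule orth_proj_eqI)
  show "(\<Sum>i<n. (z \<bullet> e i) *\<^sub>R e i) \<in> span (e ` {..<n})"
    by (intro span_sum span_scale span_base) auto
  have orth: "orthogonal (z - (\<Sum>i<n. (z \<bullet> e i) *\<^sub>R e i)) (e j)" if "j < n" for j
  proof -
    have "(\<Sum>i<n. (z \<bullet> e i) * (e i \<bullet> e j)) = (\<Sum>i<n. if i = j then z \<bullet> e j else 0)"
      using e that by (intro sum.cong) (auto simp: orthonormal_upto_def)
    also have "\<dots> = z \<bullet> e j" using that by simp
    finally show ?thesis by (simp add: orthogonal_def inner_diff_left inner_sum_left)
  qed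
  have "orthogonal (z - (\<Sum>i<n. (z \<bullet> e i) *\<^sub>R e i)) y" if "y \<in> span (e ` {..<n})" for y
    using that
  proof (rule orthogonal_to_span)
    fix y assume "y \<in> e ` {..<n}"
    then obtain j where "j < n" "y = e j" by blast
    then show "orthogonal (z - (\<Sum>i<n. (z \<bullet> e i) *\<^sub>R e i)) y" using orth by blast
  qed
  then show "z - (\<Sum>i<n. (z \<bullet> e i) *\<^sub>R e i) \<in> orthogonal_comp (span (e ` {..<n}))"
    unfolding orthogonal_comp_def mem_Collect_eq using orthogonal_commute by blast
qed simp

lemma dim_span_orthonormal:
  fixes e :: "nat \<Rightarrow> 'a::euclidean_space"
  assumes e: "orthonormal_upto n e"
  shows "dim (span (e ` {..<n})) = n"
proof -
  have inj: "inj_on e {..<n}"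
  proof (rule inj_onI, rule ccontr)
    fix i j assume ij: "i \<in> {..<n}" "j \<in> {..<n}" "e i = e j" "i \<noteq> j"
    then have "e i \<bullet> e j = 0" "e i \<bullet> e i = 1"
      using orthonormal_uptoD[OF e, of i j] orthonormal_uptoD[OF e, of i i] by simp_all
    then show False using ij(3) by simp
  qed
  have "independent (e ` {..<n})"
  proof (rule pairwise_orthogonal_independent)
    show "pairwise orthogonal (e ` {..<n})"
      using e by (auto simp: pairwise_def orthogonal_def orthonormal_upto_def)
    show "0 \<notin> e ` {..<n}" using orthonormal_upto_norm[OF e] by fastforce
  qed
  then show ?thesis using inj by (simp add: dim_eq_card_independent card_image)
qed

lemma Zn_span_orthonormal:
  fixes e :: "nat \<Rightarrow> (real^'n) \<times> (real^'n)"
  assumes "orthonormal_upto CARD('n) e"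
  shows "span (e ` {..<CARD('n)}) \<in> Zn"
  using dim_span_orthonormal[OF assms] by (simp add: Zn_def)

lemma Zn_orthonormal_basis:
  fixes L :: "((real^'n) \<times> (real^'n)) set"
  assumes L: "L \<in> Zn"
  shows "\<exists>e. orthonormal_upto CARD('n) e \<and> L = span (e ` {..<CARD('n)})"
proof -
  have sub: "subspace L" and dim: "dim L = CARD('n)" using L by (auto simp: Zn_def)
  obtain B where B: "B \<subseteq> L" "pairwise orthogonal B" "\<And>x. x \<in> B \<Longrightarrow> norm x = 1"
    "independent B" "card B = dim L" "span B = L"
    using orthonormal_basis_subspace[OF sub] by blast
  have "finite B" using B(4) by (rule independent_imp_finite)
  then obtain h where h: "bij_betw h {0..<card B} B" using ex_bij_betw_nat_finite by blast
  then have im: "h ` {..<CARD('n)} = B" and inj: "inj_on h {..<CARD('n)}"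
    using B(5) dim by (auto simp: bij_betw_def lessThan_atLeast0)
  have "orthonormal_upto CARD('n) h"
    unfolding orthonormal_upto_def
  proof (intro allI impI)
    fix i j assume ij: "i < CARD('n)" "j < CARD('n)"
    then have hB: "h i \<in> B" "h j \<in> B" using im by auto
    show "h i \<bullet> h j = (if i = j then 1 else 0)"
    proof (cases "i = j")
      case True
      then show ?thesis using B(3)[OF hB(1)] by (simp add: norm_eq_1)
    next
      case False
      then have "h i \<noteq> h j" using inj ij by (auto simp: inj_on_def)
      then show ?thesis using B(2) hB False by (auto simp: pairwise_def orthogonal_def)
    qed
  qed
  then show ?thesis using im B(6) by blast
qed

lemma linear_orth_proj:
  fixes L :: "((real^'n) \<times> (real^'n)) set"
  assumes "L \<in> Zn"
  shows "linear (orth_proj L)"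
proof -
  obtain e where e: "orthonormal_upto CARD('n) e" "L = span (e ` {..<CARD('n)})"
    using Zn_orthonormal_basis[OF assms] by blast
  have "orth_proj L = (\<lambda>z. \<Sum>i<CARD('n). (z \<bullet> e i) *\<^sub>R e i)"
    using orth_proj_orthonormal[OF e(1)] e(2) by auto
  then show ?thesis by (simp only:) (intro linear_compose_sum ballI linearI; simp only: inner_add_left scaleR_add_left inner_scaleR_left scaleR_scaleR)
qed

lemma orth_proj_in:
  fixes L :: "((real^'n) \<times> (real^'n)) set"
  assumes "L \<in> Zn"
  shows "orth_proj L z \<in> L"
proof -
  obtain e where e: "orthonormal_upto CARD('n) e" "L = span (e ` {..<CARD('n)})"
    using Zn_orthonormal_basis[OF assms] by blast
  show ?thesis unfolding e(2) orth_proj_orthonormal[OF e(1)]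
    by (intro span_sum span_scale span_base) auto
qed

section \<open>The metric \<open>dZ\<close>: limits and compactness\<close>

lemma bounded_linear_orth_proj_diff:
  fixes L :: "((real^'n) \<times> (real^'n)) set"
  assumes "L \<in> Zn" "M \<in> Zn"
  shows "bounded_linear (\<lambda>z. orth_proj L z - orth_proj M z)"
  using linear_orth_proj assms by (intro bounded_linear_sub) (auto simp: linear_conv_bounded_linear)

lemma dZ_bound:
  fixes L :: "((real^'n) \<times> (real^'n)) set"
  assumes "L \<in> Zn" "M \<in> Zn"
  shows "norm (orth_proj L z - orth_proj M z) \<le> dZ L M * norm z"
  unfolding dZ_def by (rule onorm[OF bounded_linear_orth_proj_diff[OF assms]])

text \<open>Each \<open>z k\<close> is fixed by the projection onto \<open>L k\<close>, so the
  projection onto \<open>M\<close> moves it by at most \<open>dZ M (L k) * norm (z k)\<close>, which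
  tends to 0.\<close>

lemma Zn_limit_mem:
  fixes M :: "((real^'n) \<times> (real^'n)) set"
  assumes M: "M \<in> Zn" and L: "\<And>k. L k \<in> Zn" and lim: "(\<lambda>k. dZ M (L k)) \<longlonglongrightarrow> 0"
    and z: "\<And>k. z k \<in> L k" "z \<longlonglongrightarrow> z0"
  shows "z0 \<in> M"
proof -
  have a: "(\<lambda>k. orth_proj M (z k) - z k) \<longlonglongrightarrow> 0"
  proof (rule Lim_null_comparison)
    show "\<forall>\<^sub>F k in sequentially. norm (orth_proj M (z k) - z k) \<le> dZ M (L k) * norm (z k)"
    proof (intro always_eventually allI)
      fix k
      have "orth_proj (L k) (z k) = z k" using L[of k] z(1) by (auto simp: Zn_def orth_proj_self)
      then show "norm (orth_proj M (z k) - z k) \<le> dZ M (L k) * norm (z k)"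
        using dZ_bound[OF M L, of "z k" k] by simp
    qed
    show "(\<lambda>k. dZ M (L k) * norm (z k)) \<longlonglongrightarrow> 0"
      using tendsto_mult[OF lim tendsto_norm[OF z(2)]] by simp
  qed
  have b: "(\<lambda>k. orth_proj M (z k) - z k) \<longlonglongrightarrow> orth_proj M z0 - z0"
    using linear_orth_proj[OF M] z(2)
    by (intro tendsto_diff bounded_linear.tendsto[of "orth_proj M"]) (simp_all add: linear_conv_bounded_linear)
  have "orth_proj M z0 = z0" using LIMSEQ_unique[OF b a] by simp
  then show ?thesis using orth_proj_in[OF M, of z0] by simp
qed

text \<open>The counterpart of \<open>Zn_limit_mem\<close>: no vector of \<open>M\<close> is lost,
  since its projections onto the \<open>L k\<close> converge back to it. Closed conditions on the
  \<open>L k\<close> thereby pass to \<open>M\<close>.\<close>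

lemma Zn_limit_approx:
  fixes M :: "((real^'n) \<times> (real^'n)) set"
  assumes M: "M \<in> Zn" and L: "\<And>k. L k \<in> Zn" and lim: "(\<lambda>k. dZ M (L k)) \<longlonglongrightarrow> 0"
    and z: "z \<in> M"
  shows "(\<lambda>k. orth_proj (L k) z) \<longlonglongrightarrow> z"
proof -
  have "(\<lambda>k. z - orth_proj (L k) z) \<longlonglongrightarrow> 0"
  proof (rule Lim_null_comparison)
    show "\<forall>\<^sub>F k in sequentially. norm (z - orth_proj (L k) z) \<le> dZ M (L k) * norm z"
      using dZ_bound[OF M L, of z] orth_proj_self[of M z] z M by (auto simp: Zn_def)
    show "(\<lambda>k. dZ M (L k) * norm z) \<longlonglongrightarrow> 0"
      using tendsto_mult_right[OF lim, of "norm z"] by simp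
  qed
  from tendsto_diff[OF tendsto_const[of z] this] show ?thesis by simp
qed

lemma bounded_finite_family_convergent_subseq:
  fixes e :: "nat \<Rightarrow> nat \<Rightarrow> 'a::euclidean_space"
  assumes "\<And>k i. i < n \<Longrightarrow> norm (e k i) \<le> R"
  shows "\<exists>r l. strict_mono (r :: nat \<Rightarrow> nat) \<and> (\<forall>i<n. (\<lambda>k. e (r k) i) \<longlonglongrightarrow> l i)"
  using assms
proof (induction n)
  case 0
  show ?case by (intro exI[of _ id]) (auto simp: strict_mono_def)
next
  case (Suc n)
  have "norm (e k i) \<le> R" if "i < n" for k i using Suc.prems that by simp
  from Suc.IH[OF this] obtain r l where r: "strict_mono (r :: nat \<Rightarrow> nat)" "\<And>i. i < n \<Longrightarrow> (\<lambda>k. e (r k) i) \<longlonglongrightarrow> l i"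
    by blast
  have "bounded (range (\<lambda>k. e (r k) n))" using Suc.prems by (auto simp: bounded_iff)
  then obtain l' s where s: "strict_mono (s :: nat \<Rightarrow> nat)" "((\<lambda>k. e (r k) n) \<circ> s) \<longlonglongrightarrow> l'"
    using bounded_imp_convergent_subsequence by blast
  have "(\<lambda>k. e ((r \<circ> s) k) i) \<longlonglongrightarrow> (if i = n then l' else l i)" if "i < Suc n" for i
  proof (cases "i = n")
    case False
    with that have "(\<lambda>k. e (r k) i) \<longlonglongrightarrow> l i" by (intro r(2)) simp
    from LIMSEQ_subseq_LIMSEQ[OF this s(1)] show ?thesis using False by (simp add: comp_def)
  qed (use s(2) in \<open>simp add: comp_def\<close>)
  then show ?case using strict_mono_o[OF r(1) s(1)]
    by (intro exI[of _ "r \<circ> s"] exI[of _ "\<lambda>i. if i = n then l' else l i"]) blast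
qed

text \<open>Orthonormal bases form a compact set, a limit of orthonormal families is orthonormal,
  and the projection depends continuously on the basis.\<close>

lemma Zn_seq_compact:
  fixes L :: "nat \<Rightarrow> ((real^'n) \<times> (real^'n)) set"
  assumes L: "\<And>k. L k \<in> Zn"
  shows "\<exists>r M. strict_mono (r :: nat \<Rightarrow> nat) \<and> M \<in> Zn \<and> (\<lambda>k. dZ M (L (r k))) \<longlonglongrightarrow> 0"
proof -
  let ?n = "CARD('n)"
  have "\<forall>k. \<exists>e. orthonormal_upto ?n e \<and> L k = span (e ` {..<?n})" using Zn_orthonormal_basis[OF L] by blast
  from choice[OF this] obtain e where e: "\<And>k. orthonormal_upto ?n (e k)" "\<And>k. L k = span (e k ` {..<?n})" by blast
  obtain r l where r: "strict_mono (r :: nat \<Rightarrow> nat)" "\<And>i. i < ?n \<Longrightarrow> (\<lambda>k. e (r k) i) \<longlonglongrightarrow> l i"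
    using bounded_finite_family_convergent_subseq[of ?n e 1] orthonormal_upto_norm[OF e(1)] by auto
  have l: "orthonormal_upto ?n l"
    unfolding orthonormal_upto_def
  proof (intro allI impI)
    fix i j assume ij: "i < ?n" "j < ?n"
    have "(\<lambda>k. e (r k) i \<bullet> e (r k) j) \<longlonglongrightarrow> l i \<bullet> l j" using ij by (intro tendsto_inner r(2))
    moreover have "(\<lambda>k. e (r k) i \<bullet> e (r k) j) = (\<lambda>k. if i = j then 1 else 0)"
      using e(1) ij by (auto simp: orthonormal_upto_def)
    ultimately show "l i \<bullet> l j = (if i = j then 1 else 0)" by (simp add: LIMSEQ_const_iff)
  qed
  define M where "M = span (l ` {..<?n})"
  have M: "M \<in> Zn" unfolding M_def by (rule Zn_span_orthonormal[OF l])
  have "(\<lambda>k. dZ M (L (r k))) \<longlonglongrightarrow> 0"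
  proof (rule Lim_null_comparison)
    \<comment> \<open>The factor 2 arises because every basis vector enters its rank-one term twice,
      once as coefficient functional and once as direction.\<close>
    have "norm (dZ M (L (r k))) \<le> (\<Sum>i<?n. 2 * norm (l i - e (r k) i))" for k
    proof -
      have "norm (orth_proj M z - orth_proj (L (r k)) z) \<le> (\<Sum>i<?n. 2 * norm (l i - e (r k) i)) * norm z" for z
      proof -
        have "orth_proj M z - orth_proj (L (r k)) z = (\<Sum>i<?n. (z \<bullet> l i) *\<^sub>R l i - (z \<bullet> e (r k) i) *\<^sub>R e (r k) i)"
          unfolding M_def e(2) orth_proj_orthonormal[OF l] orth_proj_orthonormal[OF e(1)] by (simp add: sum_subtractf)
        also have "norm \<dots> \<le> (\<Sum>i<?n. 2 * norm (l i - e (r k) i) * norm z)"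
        proof (rule sum_norm_le)
          fix i assume "i \<in> {..<?n}"
          then have n1: "norm (l i) = 1" "norm (e (r k) i) = 1"
            using orthonormal_upto_norm[OF l] orthonormal_upto_norm[OF e(1)] by auto
          have "(z \<bullet> l i) *\<^sub>R l i - (z \<bullet> e (r k) i) *\<^sub>R e (r k) i
             = (z \<bullet> l i) *\<^sub>R (l i - e (r k) i) + (z \<bullet> (l i - e (r k) i)) *\<^sub>R e (r k) i"
            by (simp add: inner_diff_right scaleR_diff_right scaleR_diff_left)
          also have "norm \<dots> \<le> \<bar>z \<bullet> l i\<bar> * norm (l i - e (r k) i) + \<bar>z \<bullet> (l i - e (r k) i)\<bar> * norm (e (r k) i)"
            by (rule order_trans[OF norm_triangle_ineq]) simp
          also have "\<dots> \<le> norm z * norm (l i - e (r k) i) + norm z * norm (l i - e (r k) i)"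
            using Cauchy_Schwarz_ineq2[of z "l i"] Cauchy_Schwarz_ineq2[of z "l i - e (r k) i"] n1
            by (intro add_mono) (auto intro: mult_right_mono)
          finally show "norm ((z \<bullet> l i) *\<^sub>R l i - (z \<bullet> e (r k) i) *\<^sub>R e (r k) i) \<le> 2 * norm (l i - e (r k) i) * norm z"
            by (simp add: algebra_simps)
        qed
        finally show ?thesis by (simp add: sum_distrib_right)
      qed
      then have "dZ M (L (r k)) \<le> (\<Sum>i<?n. 2 * norm (l i - e (r k) i))" unfolding dZ_def by (rule onorm_le)
      moreover have "0 \<le> dZ M (L (r k))"
        unfolding dZ_def by (rule onorm_pos_le[OF bounded_linear_orth_proj_diff[OF M L]])
      ultimately show ?thesis by simp
    qed
    then show "\<forall>\<^sub>F k in sequentially. norm (dZ M (L (r k))) \<le> (\<Sum>i<?n. 2 * norm (l i - e (r k) i))"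
      by (simp add: always_eventually)
    have "(\<lambda>k. \<Sum>i<?n. 2 * norm (l i - e (r k) i)) \<longlonglongrightarrow> (\<Sum>i<?n. 2 * norm (l i - l i))"
      by (intro tendsto_sum tendsto_mult tendsto_const tendsto_norm tendsto_diff r(2)) simp
    then show "(\<lambda>k. \<Sum>i<?n. 2 * norm (l i - e (r k) i)) \<longlonglongrightarrow> 0" by simp
  qed
  with r(1) M show ?thesis by blast
qed

section \<open>Duality and slope bounds\<close>

lemma dual_subspace_Zn:
  fixes L :: "((real^'n) \<times> (real^'n)) set"
  assumes L: "L \<in> Zn"
  shows "dual_subspace L \<in> Zn"
proof -
  have sub: "subspace L" and dim: "dim L = CARD('n)" using L by (auto simp: Zn_def)
  \<comment> \<open>The dual is the image of the orthogonal complement, of dimension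
    \<open>2 * n - n\<close> for \<open>n = CARD('n)\<close>, under this injective rotation.\<close>
  define f where "f = (\<lambda>z :: (real^'n) \<times> (real^'n). (- snd z, fst z))"
  have lin: "linear f" by (rule linearI) (auto simp: f_def)
  have inj: "inj f" by (auto simp: f_def inj_def prod_eq_iff)
  have eq: "dual_subspace L = f ` orthogonal_comp L"
    by (force simp: dual_subspace_def f_def image_iff)
  have "dim (orthogonal_comp L) + dim L = dim (UNIV :: ((real^'n) \<times> (real^'n)) set)"
    using dim_subspace_orthogonal_to_vectors[OF sub subspace_UNIV] by (simp add: orthogonal_comp_def)
  then have "dim (orthogonal_comp L) = CARD('n)" using dim by simp
  then have "dim (dual_subspace L) = CARD('n)"
    unfolding eq using dim_image_eq[OF lin] inj by (simp add: inj_on_subset[OF inj])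
  moreover have "subspace (dual_subspace L)"
    unfolding eq by (intro linear_subspace_image lin subspace_orthogonal_comp)
  ultimately show ?thesis by (simp add: Zn_def)
qed

text \<open>For \<open>L\<close> in \<open>Zn\<close> this says that \<open>L\<close> is regular
  with operator norm of \<open>C_mat L\<close> at most \<open>\<kappa>\<close>. Unlike membership in
  \<open>Zn_reg\<close>, it is closed under limits in \<open>dZ\<close>.\<close>

definition slope_le :: "real \<Rightarrow> ((real^'n) \<times> (real^'n)) set \<Rightarrow> bool" where
  "slope_le \<kappa> L \<longleftrightarrow> (\<forall>(p, q) \<in> L. norm p \<le> \<kappa> * norm q)"

lemma slope_leD: "slope_le \<kappa> L \<Longrightarrow> (p, q) \<in> L \<Longrightarrow> norm p \<le> \<kappa> * norm q"
  by (auto simp: slope_le_def)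

lemma Zn_reg_if_slope_le: "L \<in> Zn \<Longrightarrow> slope_le \<kappa> L \<Longrightarrow> L \<in> Zn_reg"
  using slope_leD by (fastforce simp: Zn_reg_def)

text \<open>Regularity makes \<open>snd\<close> injective on \<open>L\<close>, and \<open>L\<close>
  has the dimension of the target, so \<open>snd\<close> maps \<open>L\<close> onto it.\<close>

lemma Zn_reg_surj:
  fixes L :: "((real^'n) \<times> (real^'n)) set"
  assumes L: "L \<in> Zn_reg"
  shows "\<exists>p. (p, q) \<in> L"
proof -
  have sub: "subspace L" and dim: "dim L = CARD('n)" using L by (auto simp: Zn_def Zn_reg_def)
  have "inj_on snd L"
  proof (rule inj_onI)
    fix x y assume xy: "x \<in> L" "y \<in> L" "snd x = snd y"
    have "(fst x - fst y, 0) \<in> L" using subspace_diff[OF sub xy(1,2)] xy(3) by (simp add: minus_prod_def)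
    then have "fst x - fst y = 0" using L by (auto simp: Zn_reg_def)
    then show "x = y" using xy(3) by (simp add: prod_eq_iff)
  qed
  then have "dim (snd ` L) = CARD('n)"
    using dim_image_eq[OF linear_snd, of L] sub dim by (simp add: span_eq_iff[THEN iffD2])
  then have "span (snd ` L) = UNIV" by (simp add: dim_eq_full[symmetric])
  moreover have "span (snd ` L) = snd ` L"
    using sub by (simp add: linear_subspace_image linear_snd span_eq_iff)
  ultimately show ?thesis by (metis (mono_tags, lifting) UNIV_I imageE prod.collapse)
qed

text \<open>Pairing \<open>(u, v)\<close> with the vector \<open>(p, v)\<close> of \<open>L\<close>
  gives \<open>v \<bullet> v = - (p \<bullet> u)\<close>, which is at most
  \<open>\<kappa> * norm v * norm u\<close>; then \<open>norm v\<close> is cancelled.\<close>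

lemma slope_le_orthogonal:
  fixes L :: "((real^'n) \<times> (real^'n)) set"
  assumes L: "L \<in> Zn" "slope_le \<kappa> L" and uv: "(u, v) \<in> orthogonal_comp L"
  shows "norm v \<le> \<kappa> * norm u"
proof -
  obtain p where p: "(p, v) \<in> L" using Zn_reg_surj[OF Zn_reg_if_slope_le[OF L]] by blast
  then have "p \<bullet> u + v \<bullet> v = 0" using uv by (auto simp: orthogonal_comp_def orthogonal_def inner_Pair)
  then have "norm v * norm v = - (p \<bullet> u)" by (simp add: norm_eq_sqrt_inner)
  also have "\<dots> \<le> norm p * norm u" using Cauchy_Schwarz_ineq2[of p u] by linarith
  also have "\<dots> \<le> (\<kappa> * norm v) * norm u" using slope_leD[OF L(2) p] by (intro mult_right_mono) auto
  finally have "norm v * norm v \<le> norm v * (\<kappa> * norm u)" by (simp add: mult_ac)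
  then have "norm v \<noteq> 0 \<Longrightarrow> norm v \<le> \<kappa> * norm u" using norm_ge_zero[of v] by (simp add: mult_le_cancel_left_pos)
  \<comment> \<open>The sign of \<open>\<kappa>\<close> is not given; that
    \<open>\<kappa> * norm u\<close> is nonnegative is read off from a vector of \<open>L\<close>
    lying over \<open>u\<close>.\<close>
  moreover have "norm v = 0 \<Longrightarrow> norm v \<le> \<kappa> * norm u"
  proof -
    assume v: "norm v = 0"
    obtain p' where "(p', u) \<in> L" using Zn_reg_surj[OF Zn_reg_if_slope_le[OF L]] by blast
    from slope_leD[OF L(2) this] show ?thesis using v norm_ge_zero[of p'] by linarith
  qed
  ultimately show ?thesis by blast
qed

text \<open>For regular \<open>L\<close> the matrix of the dual is the transpose of the matrix of
  \<open>L\<close>. One direction is \<open>slope_le_orthogonal\<close> itself; for the other, the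
  rotated vector \<open>(- q, p)\<close> is orthogonal to the dual, so the same estimate applies
  there with the same constant.\<close>

lemma slope_le_dual_iff:
  fixes L :: "((real^'n) \<times> (real^'n)) set"
  assumes L: "L \<in> Zn"
  shows "slope_le \<kappa> (dual_subspace L) \<longleftrightarrow> slope_le \<kappa> L"
proof
  assume "slope_le \<kappa> L"
  then show "slope_le \<kappa> (dual_subspace L)"
    using slope_le_orthogonal[OF L] unfolding slope_le_def dual_subspace_def by auto
next
  assume s: "slope_le \<kappa> (dual_subspace L)"
  have "norm p \<le> \<kappa> * norm q" if "(p, q) \<in> L" for p q
  proof -
    have "(- q, p) \<in> orthogonal_comp (dual_subspace L)"
    proof -
      have "b \<bullet> q + a \<bullet> p = 0" if "(a, b) \<in> orthogonal_comp L" for a b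
        using that \<open>(p, q) \<in> L\<close> by (auto simp: orthogonal_comp_def orthogonal_def inner_Pair inner_commute)
      then have "orthogonal y (- q, p)" if "y \<in> dual_subspace L" for y
        using that by (auto simp: dual_subspace_def orthogonal_def inner_Pair)
      then show ?thesis unfolding orthogonal_comp_def by blast
    qed
    from slope_le_orthogonal[OF dual_subspace_Zn[OF L] s this] show ?thesis by simp
  qed
  then show "slope_le \<kappa> L" by (auto simp: slope_le_def)
qed

text \<open>Discharges the definite description in \<open>C_mat\<close>: the fibres of
  \<open>L\<close> over the second component are singletons, and the resulting fibre map is
  linear.\<close>

lemma C_mat_mem:
  fixes L :: "((real^'n) \<times> (real^'n)) set"
  assumes L: "L \<in> Zn_reg"
  shows "(C_mat L *v p, p) \<in> L"
proof -
  have sub: "subspace L" using L by (auto simp: Zn_def Zn_reg_def)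
  have "\<forall>q. \<exists>p. (p, q) \<in> L" using Zn_reg_surj[OF L] by blast
  from choice[OF this] obtain g where g: "\<And>q. (g q, q) \<in> L" by blast
  have uniq: "p = g q" if "(p, q) \<in> L" for p q
    using subspace_diff[OF sub that g[of q]] L by (auto simp: Zn_reg_def)
  have "linear g"
  proof (rule linearI)
    show "g (x + y) = g x + g y" for x y
      using uniq subspace_add[OF sub g[of x] g[of y]] by simp
    show "g (c *\<^sub>R x) = c *\<^sub>R g x" for c x
      using uniq subspace_scale[OF sub g[of x], of c] by simp
  qed
  then have mg: "matrix g *v q = g q" for q by (simp add: matrix_works)
  have ex: "L = {(matrix g *v p, p) | p. True}" using g uniq by (auto simp: mg)
  have "\<exists>!C. L = {(C *v p, p) | p. True}"
  proof (rule ex1I[of _ "matrix g"])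
    fix C :: "real^'n^'n" assume C: "L = {(C *v p, p) | p. True}"
    have "C *v p = matrix g *v p" for p
    proof -
      have "(C *v p, p) \<in> L" unfolding C by blast
      then show ?thesis using uniq[of "C *v p" p] mg[of p] by simp
    qed
    then show "C = matrix g" by (simp add: matrix_eq)
  qed (rule ex)
  then have "L = {(C_mat L *v p, p) | p. True}" unfolding C_mat_def by (rule theI')
  then show ?thesis by blast
qed

section \<open>Tangent cones\<close>

text \<open>Differentiability in Hadamard's form: directions may vary with the step, as they do in
  the definition of the tangent cone.\<close>

lemma has_derivative_seq_quotient:
  fixes f :: "'a::real_normed_vector \<Rightarrow> 'b::real_normed_vector"
  assumes f: "(f has_derivative D) (at x)"
    and t: "\<And>k::nat. t k > 0" "t \<longlonglongrightarrow> 0" and v: "v \<longlonglongrightarrow> w"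
  shows "(\<lambda>k. (1 / t k) *\<^sub>R (f (x + t k *\<^sub>R v k) - f x)) \<longlonglongrightarrow> D w"
proof -
  have bl: "bounded_linear D" using f by (rule has_derivative_bounded_linear)
  \<comment> \<open>Division by zero gives \<open>g 0 = 0\<close>, so \<open>g\<close> is continuous
    at 0 and vanishing \<open>v k\<close> cause no exception in the limit.\<close>
  define g where "g = (\<lambda>h. norm (f (x + h) - f x - D h) / norm h)"
  have "(g \<longlongrightarrow> g 0) (at 0)" using f by (simp add: has_derivative_at g_def)
  then have "isCont g 0" by (simp add: isCont_def)
  moreover have "(\<lambda>k. t k *\<^sub>R v k) \<longlonglongrightarrow> 0" using tendsto_scaleR[OF t(2) v] by simp
  ultimately have g0: "(\<lambda>k. g (t k *\<^sub>R v k)) \<longlonglongrightarrow> 0"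
    using isCont_tendsto_compose[of 0 g] by (force simp: g_def)
  have "(\<lambda>k. (1 / t k) *\<^sub>R (f (x + t k *\<^sub>R v k) - f x) - D (v k)) \<longlonglongrightarrow> 0"
  proof (rule Lim_null_comparison)
    show "(\<lambda>k. g (t k *\<^sub>R v k) * norm (v k)) \<longlonglongrightarrow> 0"
      using tendsto_mult[OF g0 tendsto_norm[OF v]] by simp
    have "norm ((1 / t k) *\<^sub>R (f (x + t k *\<^sub>R v k) - f x) - D (v k)) = g (t k *\<^sub>R v k) * norm (v k)" for k
    proof -
      have "D (t k *\<^sub>R v k) = t k *\<^sub>R D (v k)" using bl by (simp add: linear_simps)
      then have "(1 / t k) *\<^sub>R (f (x + t k *\<^sub>R v k) - f x) - D (v k)
         = (1 / t k) *\<^sub>R (f (x + t k *\<^sub>R v k) - f x - D (t k *\<^sub>R v k))"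
        using t(1)[of k] by (simp add: scaleR_diff_right)
      then have eq: "norm ((1 / t k) *\<^sub>R (f (x + t k *\<^sub>R v k) - f x) - D (v k))
         = norm (f (x + t k *\<^sub>R v k) - f x - D (t k *\<^sub>R v k)) / t k" using t(1)[of k] by simp
      show ?thesis
      proof (cases "v k = 0")
        case True
        then show ?thesis unfolding eq using bl by (simp add: linear_simps)
      next
        case False
        then show ?thesis unfolding eq g_def using t(1)[of k] by simp
      qed
    qed
    then show "\<forall>\<^sub>F k in sequentially. norm ((1 / t k) *\<^sub>R (f (x + t k *\<^sub>R v k) - f x) - D (v k))
        \<le> g (t k *\<^sub>R v k) * norm (v k)" by (simp add: always_eventually)
  qed
  from tendsto_add[OF this bounded_linear.tendsto[OF bl v]] show ?thesis by simp
qed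

text \<open>Near \<open>\<Phi> u\<close> every point of \<open>A\<close> is recovered from its image
  under \<open>\<pi>\<close>, so tangent sequences in \<open>A\<close> come from sequences in the
  parameter domain; conversely, difference quotients of \<open>\<Phi>\<close> are tangent
  sequences.\<close>

lemma tangent_cone_chart:
  fixes \<Phi> :: "'a::real_normed_vector \<Rightarrow> 'b::real_normed_vector"
  assumes V: "open V" "u \<in> V" and \<Phi>: "\<And>u. u \<in> V \<Longrightarrow> \<Phi> u \<in> A"
    and W: "open W" "\<Phi> u \<in> W" and \<pi>: "bounded_linear \<pi>" "\<pi> (\<Phi> u) = u"
    and inv: "\<And>z. z \<in> A \<Longrightarrow> z \<in> W \<Longrightarrow> \<Phi> (\<pi> z) = z"
    and D: "(\<Phi> has_derivative D) (at u)"
  shows "tangent_cone A (\<Phi> u) = range D"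
proof (intro subset_antisym subsetI)
  fix w assume "w \<in> tangent_cone A (\<Phi> u)"
  then obtain t v where t: "\<And>k::nat. t k > 0" "t \<longlonglongrightarrow> 0" and v: "v \<longlonglongrightarrow> w"
    and mem: "\<And>k. \<Phi> u + t k *\<^sub>R v k \<in> A" unfolding tangent_cone_def by blast
  have "(\<lambda>k. \<Phi> u + t k *\<^sub>R v k) \<longlonglongrightarrow> \<Phi> u"
    using tendsto_add[OF tendsto_const tendsto_scaleR[OF t(2) v], of "\<Phi> u"] by simp
  from topological_tendstoD[OF this W]
  have "\<forall>\<^sub>F k in sequentially. v k = (1 / t k) *\<^sub>R (\<Phi> (u + t k *\<^sub>R \<pi> (v k)) - \<Phi> u)"
  proof eventually_elim
    case (elim k)
    have "\<pi> (\<Phi> u + t k *\<^sub>R v k) = u + t k *\<^sub>R \<pi> (v k)" using \<pi> by (simp add: linear_simps)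
    with inv[OF mem elim] show ?case using t(1)[of k] by simp
  qed
  moreover have "(\<lambda>k. (1 / t k) *\<^sub>R (\<Phi> (u + t k *\<^sub>R \<pi> (v k)) - \<Phi> u)) \<longlonglongrightarrow> D (\<pi> w)"
    by (rule has_derivative_seq_quotient[OF D t bounded_linear.tendsto[OF \<pi>(1) v]])
  ultimately have "v \<longlonglongrightarrow> D (\<pi> w)" by (simp add: tendsto_cong)
  from LIMSEQ_unique[OF v this] show "w \<in> range D" by blast
next
  fix w assume "w \<in> range D"
  then obtain d where d: "w = D d" by blast
  obtain r where r: "r > 0" "ball u r \<subseteq> V" using V open_contains_ball by blast
  \<comment> \<open>The tangent cone asks for membership at every index, so the steps are scaled to
    stay in \<open>ball u r\<close> from the start; the added 1 covers \<open>d = 0\<close>.\<close>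
  define c where "c = r / (norm d + 1)"
  have c: "c > 0" using r(1) norm_ge_zero[of d] unfolding c_def by (intro divide_pos_pos) linarith+
  define t where "t = (\<lambda>k. c * inverse (real (Suc k)))"
  have t: "\<And>k. t k > 0" "t \<longlonglongrightarrow> 0"
    using c tendsto_mult_right_zero[OF LIMSEQ_inverse_real_of_nat, of c] by (auto simp: t_def)
  have "u + t k *\<^sub>R d \<in> V" for k
  proof -
    have "t k \<le> c" using c unfolding t_def by (simp add: mult_left_le field_simps)
    then have "norm (t k *\<^sub>R d) \<le> c * norm d" using t(1)[of k] by (simp add: mult_right_mono)
    also have "\<dots> < c * (norm d + 1)" using c by simp
    also have "norm d + 1 \<noteq> 0" using norm_ge_zero[of d] by linarith
    then have "c * (norm d + 1) = r" unfolding c_def by simp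
    finally show ?thesis using r(2) by (auto simp: dist_norm)
  qed
  then have mem: "\<Phi> u + t k *\<^sub>R ((1 / t k) *\<^sub>R (\<Phi> (u + t k *\<^sub>R d) - \<Phi> u)) \<in> A" for k
    using \<Phi> t(1)[of k] by simp
  have "(\<lambda>k. (1 / t k) *\<^sub>R (\<Phi> (u + t k *\<^sub>R d) - \<Phi> u)) \<longlonglongrightarrow> D d"
    by (rule has_derivative_seq_quotient[OF D t tendsto_const])
  then show "w \<in> tangent_cone A (\<Phi> u)"
    unfolding tangent_cone_def d using t mem by blast
qed

text \<open>Transfers an inequality between pairs of points of \<open>A\<close> to tangent vectors,
  provided it is continuous and invariant under positive scaling. It serves for the Lipschitz bound
  and for monotonicity alike.\<close>

lemma tangent_cone_pair_inequality:
  fixes A :: "('a::real_normed_vector) set"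
  assumes U: "open U" "z \<in> U" "z \<in> A" and cont: "continuous_on UNIV q"
    and hom: "\<And>t w. t > 0 \<Longrightarrow> q (t *\<^sub>R w) \<ge> (0::real) \<Longrightarrow> q w \<ge> 0"
    and ineq: "\<And>z z'. z \<in> A \<inter> U \<Longrightarrow> z' \<in> A \<inter> U \<Longrightarrow> q (z' - z) \<ge> 0"
    and w: "w \<in> tangent_cone A z"
  shows "q w \<ge> 0"
proof -
  obtain t v where t: "\<And>k::nat. t k > 0" "t \<longlonglongrightarrow> 0" and v: "v \<longlonglongrightarrow> w"
    and mem: "\<And>k. z + t k *\<^sub>R v k \<in> A" using w unfolding tangent_cone_def by blast
  have "(\<lambda>k. z + t k *\<^sub>R v k) \<longlonglongrightarrow> z"
    using tendsto_add[OF tendsto_const tendsto_scaleR[OF t(2) v], of z] by simp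
  from topological_tendstoD[OF this U(1,2)]
  have "\<forall>\<^sub>F k in sequentially. 0 \<le> q (v k)"
  proof eventually_elim
    case (elim k)
    have "q (z + t k *\<^sub>R v k - z) \<ge> 0" using U elim mem by (intro ineq) auto
    then show ?case using hom[OF t(1)] by simp
  qed
  moreover have "(\<lambda>k. q (v k)) \<longlonglongrightarrow> q w"
    using cont v by (auto intro: continuous_on_tendsto_compose)
  ultimately show ?thesis by (intro tendsto_lowerbound) auto
qed

lemma Zn_limit_slope_le:
  assumes M: "M \<in> Zn" and L: "\<And>k. L k \<in> Zn" and lim: "(\<lambda>k. dZ M (L k)) \<longlonglongrightarrow> 0"
    and s: "\<forall>\<^sub>F k in sequentially. slope_le \<kappa> (L k)"
  shows "slope_le \<kappa> M"
  unfolding slope_le_def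
proof clarify
  fix p q assume pq: "(p, q) \<in> M"
  have l: "(\<lambda>k. orth_proj (L k) (p, q)) \<longlonglongrightarrow> (p, q)" by (rule Zn_limit_approx[OF M L lim pq])
  have "\<forall>\<^sub>F k in sequentially. 0 \<le> \<kappa> * norm (snd (orth_proj (L k) (p, q))) - norm (fst (orth_proj (L k) (p, q)))"
    using s
  proof eventually_elim
    case (elim k)
    show ?case using slope_leD[OF elim, of "fst (orth_proj (L k) (p, q))" "snd (orth_proj (L k) (p, q))"]
      orth_proj_in[OF L, of k "(p, q)"] by simp
  qed
  moreover have "(\<lambda>k. \<kappa> * norm (snd (orth_proj (L k) (p, q))) - norm (fst (orth_proj (L k) (p, q))))
      \<longlonglongrightarrow> \<kappa> * norm (snd (p, q)) - norm (fst (p, q))"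
    by (intro tendsto_diff tendsto_mult tendsto_const tendsto_norm tendsto_snd tendsto_fst l)
  ultimately have "0 \<le> \<kappa> * norm (snd (p, q)) - norm (fst (p, q))" by (intro tendsto_lowerbound) auto
  then show "norm p \<le> \<kappa> * norm q" by simp
qed

text \<open>Compactness of \<open>Zn\<close>: a sequence of tangent spaces of unbounded slope has, by \<open>slope_le_dual_iff\<close>,
  duals of unbounded slope, and these accumulate at a non-regular element of \<open>SCD_dual\<close>.\<close>
lemma SCD_dual_regular_imp_slope_le:
  fixes F :: "real^'n \<Rightarrow> (real^'n) set"
  assumes reg: "SCD_dual F z \<subseteq> Zn_reg"
  shows "\<exists>\<kappa>>0. \<exists>\<epsilon>>0. \<forall>z' \<in> O_set F. dist z' z < \<epsilon> \<longrightarrow> slope_le \<kappa> (tangent_cone (gph F) z')"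
proof (rule ccontr)
  assume neg: "\<not> ?thesis"
  have "\<exists>z'. z' \<in> O_set F \<and> dist z' z < inverse (real (Suc k)) \<and> \<not> slope_le (real (Suc k)) (tangent_cone (gph F) z')" for k
    using neg[unfolded not_ex de_Morgan_conj, rule_format, of "real (Suc k)"]
    by (metis inverse_positive_iff_positive of_nat_0_less_iff zero_less_Suc)
  then have "\<forall>k. \<exists>z'. z' \<in> O_set F \<and> dist z' z < inverse (real (Suc k)) \<and> \<not> slope_le (real (Suc k)) (tangent_cone (gph F) z')" by blast
  from choice[OF this] obtain zs where zs: "\<And>k. zs k \<in> O_set F" "\<And>k. dist (zs k) z < inverse (real (Suc k))"
    "\<And>k. \<not> slope_le (real (Suc k)) (tangent_cone (gph F) (zs k))" by blast
  define L where "L = (\<lambda>k. dual_subspace (tangent_cone (gph F) (zs k)))"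
  have T: "tangent_cone (gph F) (zs k) \<in> Zn" for k using zs(1) by (auto simp: O_set_def)
  then have L: "L k \<in> Zn" for k unfolding L_def by (rule dual_subspace_Zn)
  \<comment> \<open>Normalised witnesses of large slope: a limit of a subsequence has the form
    \<open>(a, 0)\<close> with \<open>norm a = 1\<close> and lies in the limit subspace,
    contradicting regularity.\<close>
  have "\<exists>w. w \<in> L k \<and> norm (fst w) = 1 \<and> norm (snd w) \<le> inverse (real (Suc k))" for k
  proof -
    have "\<not> slope_le (real (Suc k)) (L k)" using zs(3) slope_le_dual_iff[OF T] unfolding L_def by blast
    then obtain p q where pq: "(p, q) \<in> L k" "norm p > real (Suc k) * norm q" by (auto simp: slope_le_def not_le)
    have np: "norm p > 0" using pq(2) mult_nonneg_nonneg[OF of_nat_0_le_iff norm_ge_zero, of "Suc k" q] by linarith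
    have "(1 / norm p) *\<^sub>R (p, q) \<in> L k" using L[of k] pq(1) by (auto simp: Zn_def intro: subspace_scale simp del: scaleR_Pair)
    moreover have "norm ((1 / norm p) *\<^sub>R q) \<le> inverse (real (Suc k))"
      using pq(2) np by (simp add: field_simps)
    ultimately show ?thesis using np by (intro exI[of _ "(1 / norm p) *\<^sub>R (p, q)"]) auto
  qed
  then have "\<forall>k. \<exists>w. w \<in> L k \<and> norm (fst w) = 1 \<and> norm (snd w) \<le> inverse (real (Suc k))" by blast
  from choice[OF this]
  obtain w where w': "\<forall>k. w k \<in> L k \<and> norm (fst (w k)) = 1 \<and> norm (snd (w k)) \<le> inverse (real (Suc k))"
    by (elim exE)
  then have w: "\<And>k. w k \<in> L k" "\<And>k. norm (fst (w k)) = 1" "\<And>k. norm (snd (w k)) \<le> inverse (real (Suc k))"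
    by simp_all
  from Zn_seq_compact[of L, OF L]
  obtain r M where r: "strict_mono (r :: nat \<Rightarrow> nat)" and M: "M \<in> Zn" "(\<lambda>k. dZ M (L (r k))) \<longlonglongrightarrow> 0"
    by (elim exE conjE)
  have "(\<lambda>k. dist (zs k) z) \<longlonglongrightarrow> 0"
    by (rule Lim_null_comparison[OF _ LIMSEQ_inverse_real_of_nat])
      (use zs(2) in \<open>simp add: always_eventually less_imp_le\<close>)
  then have zs_lim: "zs \<longlonglongrightarrow> z" by (rule tendsto_dist_iff[THEN iffD2])
  have "M \<in> SCD_dual F z"
    unfolding SCD_dual_def mem_Collect_eq
  proof (intro conjI exI[of _ "zs \<circ> r"] allI)
    show "(zs \<circ> r) \<longlonglongrightarrow> z" by (rule LIMSEQ_subseq_LIMSEQ[OF zs_lim r])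
  qed (use M zs(1) in \<open>simp_all add: L_def\<close>)
  then have "M \<in> Zn_reg" using reg by blast
  have "(snd \<circ> w) \<longlonglongrightarrow> 0"
    by (rule Lim_null_comparison[OF _ LIMSEQ_inverse_real_of_nat]) (use w(3) in \<open>auto intro!: always_eventually\<close>)
  then have s0: "(\<lambda>k. snd (w (r k))) \<longlonglongrightarrow> 0" using LIMSEQ_subseq_LIMSEQ[OF _ r, of "snd \<circ> w" 0] by (simp add: comp_def)
  have "bounded (range (\<lambda>k. fst (w (r k))))" using w(2) by (auto simp: bounded_iff intro!: exI[of _ 1])
  then obtain a s where s: "strict_mono (s :: nat \<Rightarrow> nat)" "((\<lambda>k. fst (w (r k))) \<circ> s) \<longlonglongrightarrow> a"
    using bounded_imp_convergent_subsequence by blast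
  have "(\<lambda>k. (fst (w (r (s k))), snd (w (r (s k))))) \<longlonglongrightarrow> (a, 0)"
    using s(2) LIMSEQ_subseq_LIMSEQ[OF s0 s(1)] by (intro tendsto_Pair) (simp_all add: comp_def)
  then have "(\<lambda>k. w (r (s k))) \<longlonglongrightarrow> (a, 0)" by simp
  then have "(a, 0) \<in> M"
    using LIMSEQ_subseq_LIMSEQ[OF M(2) s(1)] w(1) L
    by (intro Zn_limit_mem[OF M(1), of "\<lambda>k. L (r (s k))" "\<lambda>k. w (r (s k))"]) (auto simp: comp_def)
  then have "a = 0" using \<open>M \<in> Zn_reg\<close> by (auto simp: Zn_reg_def)
  moreover have "norm a = 1"
    using tendsto_norm[OF s(2)] w(2) by (simp add: comp_def LIMSEQ_const_iff)
  ultimately show False by simp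
qed

section \<open>Minty charts\<close>

text \<open>The first component of \<open>\<Phi>\<close> is the local resolvent of \<open>F\<close>,
  the inverse of identity plus \<open>F\<close>; the second is its complement. The clauses make
  \<open>\<Phi>\<close> a bijection from the ball onto the part of the graph in \<open>W\<close>,
  with inverse the sum of components.\<close>

definition minty_chart ::
    "(real^'n \<Rightarrow> (real^'n) set) \<Rightarrow> real^'n \<Rightarrow> real \<Rightarrow> (real^'n \<Rightarrow> (real^'n) \<times> (real^'n)) \<Rightarrow>
     ((real^'n) \<times> (real^'n)) set \<Rightarrow> bool" where
  "minty_chart F c \<delta> \<Phi> W \<longleftrightarrow> \<delta> > 0 \<and> open W \<and>
     (\<forall>u\<in>ball c \<delta>. \<Phi> u \<in> gph F \<inter> W \<and> fst (\<Phi> u) + snd (\<Phi> u) = u) \<and>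
     (\<forall>z\<in>gph F \<inter> W. fst z + snd z \<in> ball c \<delta> \<and> \<Phi> (fst z + snd z) = z) \<and>
     monotone_graph (gph F \<inter> W)"

lemma AE_lborel_imp_ex_in_open:
  fixes B :: "'a::euclidean_space set"
  assumes ae: "AE x in lborel. P x" and B: "open B" "B \<noteq> {}"
  shows "\<exists>x\<in>B. P x"
proof (rule ccontr)
  assume neg: "\<not> ?thesis"
  obtain N where N: "N \<in> null_sets lborel" "{x \<in> space lborel. \<not> P x} \<subseteq> N"
    using ae unfolding eventually_ae_filter by blast
  then have "negligible N" by (simp add: negligible_iff_null_sets null_sets_completionI)
  moreover have "B \<subseteq> N" using neg N(2) by auto
  ultimately show False using open_not_negligible[OF B] negligible_subset by blast
qed

lemma norm_Pair_le_norm_add: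
  fixes a b :: "'a::real_inner"
  assumes "b \<bullet> a \<ge> 0"
  shows "(norm a)\<^sup>2 + (norm b)\<^sup>2 \<le> (norm (a + b))\<^sup>2"
  using assms by (simp add: power2_norm_eq_inner inner_simps inner_commute)

lemma norm_le_norm_add:
  fixes a b :: "'a::real_inner"
  assumes "b \<bullet> a \<ge> 0"
  shows "norm a \<le> norm (a + b)" "norm b \<le> norm (a + b)"
proof -
  have "(norm a)\<^sup>2 \<le> (norm (a + b))\<^sup>2" "(norm b)\<^sup>2 \<le> (norm (a + b))\<^sup>2"
    using norm_Pair_le_norm_add[OF assms] zero_le_power2[of "norm a"] zero_le_power2[of "norm b"] by linarith+
  then show "norm a \<le> norm (a + b)" "norm b \<le> norm (a + b)"
    using power2_le_imp_le[OF _ norm_ge_zero] by blast+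
qed

text \<open>Local surjectivity of identity plus \<open>F\<close>. Adjoining the point from
  \<open>monotone_extension_point\<close> keeps the graph monotone, so maximality forces that point
  into the graph, provided it lies in \<open>X \<times> Y\<close>.\<close>

lemma minty_chart_exists:
  fixes F :: "real^'n \<Rightarrow> (real^'n) set"
  assumes max: "locally_maximally_monotone_at F x0 y0" and z0: "(x0, y0) \<in> gph F"
  shows "\<exists>\<delta> \<Phi> W. minty_chart F (x0 + y0) \<delta> \<Phi> W \<and> (x0, y0) \<in> W"
proof -
  obtain X Y where XY: "open X" "open Y" "x0 \<in> X" "y0 \<in> Y" and mono: "monotone_graph (gph F \<inter> X \<times> Y)"
    and mx: "\<And>T. monotone_mapping T \<Longrightarrow> gph F \<inter> X \<times> Y \<subseteq> gph T \<Longrightarrow> gph F \<inter> X \<times> Y = gph T \<inter> X \<times> Y"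
    using max unfolding locally_maximally_monotone_at_def by blast
  define G where "G = gph F \<inter> X \<times> Y"
  have Gm: "(b - b') \<bullet> (a - a') \<ge> 0" if "(a, b) \<in> G" "(a', b') \<in> G" for a b a' b'
    using mono that unfolding monotone_graph_def G_def by blast
  have z0G: "(x0, y0) \<in> G" using z0 XY by (simp add: G_def)
  obtain e1 where e1: "e1 > 0" "ball x0 e1 \<subseteq> X" using XY open_contains_ball by blast
  obtain e2 where e2: "e2 > 0" "ball y0 e2 \<subseteq> Y" using XY open_contains_ball by blast
  define \<delta> where "\<delta> = min e1 e2"
  have \<delta>: "\<delta> > 0" "ball x0 \<delta> \<subseteq> X" "ball y0 \<delta> \<subseteq> Y" using e1 e2 by (auto simp: \<delta>_def)
  have ex: "\<exists>x. (x, u - x) \<in> G" if u: "u \<in> ball (x0 + y0) \<delta>" for u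
  proof -
    obtain x where x: "\<forall>(a, b) \<in> G. (u - x - b) \<bullet> (x - a) \<ge> 0"
      using monotone_extension_point[of G u] Gm by blast
    define y where "y = u - x"
    have xm: "(y - b) \<bullet> (x - a) \<ge> 0" if "(a, b) \<in> G" for a b using x that by (auto simp: y_def)
    \<comment> \<open>Monotonicity against the base point itself locates the new point in
      \<open>X \<times> Y\<close>, where maximality can be applied.\<close>
    have "norm (x - x0) \<le> norm (x - x0 + (y - y0))" "norm (y - y0) \<le> norm (x - x0 + (y - y0))"
      using norm_le_norm_add[OF xm[OF z0G]] by auto
    moreover have "x - x0 + (y - y0) = u - (x0 + y0)" by (simp add: y_def)
    moreover have "norm (u - (x0 + y0)) < \<delta>" using u by (simp add: dist_norm norm_minus_commute)
    ultimately have "x \<in> ball x0 \<delta>" "y \<in> ball y0 \<delta>" by (auto simp: dist_norm norm_minus_commute)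
    then have xy: "x \<in> X" "y \<in> Y" using \<delta> by auto
    define T where "T = (\<lambda>x'. {y'. (x', y') \<in> insert (x, y) G})"
    have gT: "gph T = insert (x, y) G" by (auto simp: gph_def T_def)
    have "monotone_mapping T"
      unfolding monotone_mapping_def gT monotone_graph_def
    proof (intro allI impI)
      fix a b a' b' assume ab: "(a, b) \<in> insert (x, y) G" "(a', b') \<in> insert (x, y) G"
      have sym: "(b - y) \<bullet> (a - x) = (y - b) \<bullet> (x - a)" for a b by (simp add: inner_simps)
      show "0 \<le> (b - b') \<bullet> (a - a')"
        using ab Gm xm sym by auto
    qed
    from mx[OF this] have "gph F \<inter> X \<times> Y = gph T \<inter> X \<times> Y" unfolding gT by (auto simp: G_def)
    then have "(x, y) \<in> G" unfolding G_def gT using xy by blast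
    then show ?thesis unfolding y_def by blast
  qed
  then have "\<forall>u. \<exists>x. u \<in> ball (x0 + y0) \<delta> \<longrightarrow> (x, u - x) \<in> G" by blast
  from choice[OF this] obtain P where P: "\<And>u. u \<in> ball (x0 + y0) \<delta> \<Longrightarrow> (P u, u - P u) \<in> G" by blast
  \<comment> \<open>Restricting by the sum of components makes every graph point of \<open>W\<close>
    have its parameter in the ball.\<close>
  define W where "W = X \<times> Y \<inter> (\<lambda>z. fst z + snd z) -` ball (x0 + y0) \<delta>"
  have "minty_chart F (x0 + y0) \<delta> (\<lambda>u. (P u, u - P u)) W"
    unfolding minty_chart_def
  proof (intro conjI ballI)
    have "open ((\<lambda>z :: (real^'n) \<times> (real^'n). fst z + snd z) -` ball (x0 + y0) \<delta>)"
      by (intro open_vimage open_ball continuous_intros)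
    then show "open W" unfolding W_def by (intro open_Int open_Times XY)
    fix u assume u: "u \<in> ball (x0 + y0) \<delta>"
    then show "(P u, u - P u) \<in> gph F \<inter> W" using P[OF u] by (simp add: G_def W_def)
  next
    fix z assume z: "z \<in> gph F \<inter> W"
    then show u: "fst z + snd z \<in> ball (x0 + y0) \<delta>" by (simp add: W_def)
    obtain a b where ab: "z = (a, b)" by (cases z)
    have abG: "(a, b) \<in> G" using z by (simp add: ab G_def W_def)
    \<comment> \<open>Two points of \<open>G\<close> with equal sums: their difference has the form
      \<open>(d, - d)\<close>, so monotonicity makes it zero.\<close>
    from norm_Pair_le_norm_add[OF Gm[OF abG P[OF u]]]
    have "(norm (a - P (a + b)))\<^sup>2 + (norm (b - (a + b - P (a + b))))\<^sup>2 \<le> 0" by (simp add: ab)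
    then have "(norm (a - P (a + b)))\<^sup>2 \<le> 0"
      using zero_le_power2[of "norm (b - (a + b - P (a + b)))"] by linarith
    then have "P (a + b) = a" by simp
    then show "(P (fst z + snd z), fst z + snd z - P (fst z + snd z)) = z" by (simp add: ab)
  next
    show "monotone_graph (gph F \<inter> W)" unfolding monotone_graph_def using Gm by (auto simp: G_def W_def)
  qed (use \<delta> in simp_all)
  moreover have "(x0, y0) \<in> W" using XY \<delta> by (simp add: W_def)
  ultimately show ?thesis by blast
qed

context
  fixes F :: "real^'n \<Rightarrow> (real^'n) set" and c \<delta> \<Phi> W
  assumes chart: "minty_chart F c \<delta> \<Phi> W"
begin

lemma chart_pos: "\<delta> > 0" and chart_open: "open W"
  and chart_mem: "u \<in> ball c \<delta> \<Longrightarrow> \<Phi> u \<in> gph F" "u \<in> ball c \<delta> \<Longrightarrow> \<Phi> u \<in> W"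
  and chart_sum: "u \<in> ball c \<delta> \<Longrightarrow> fst (\<Phi> u) + snd (\<Phi> u) = u"
  and chart_inv: "z \<in> gph F \<Longrightarrow> z \<in> W \<Longrightarrow> fst z + snd z \<in> ball c \<delta>"
    "z \<in> gph F \<Longrightarrow> z \<in> W \<Longrightarrow> \<Phi> (fst z + snd z) = z"
  using chart unfolding minty_chart_def by blast+

lemma chart_mono:
  assumes "u \<in> ball c \<delta>" "u' \<in> ball c \<delta>"
  shows "(snd (\<Phi> u) - snd (\<Phi> u')) \<bullet> (fst (\<Phi> u) - fst (\<Phi> u')) \<ge> 0"
proof -
  have "(fst (\<Phi> u), snd (\<Phi> u)) \<in> gph F \<inter> W" "(fst (\<Phi> u'), snd (\<Phi> u')) \<in> gph F \<inter> W"
    using chart_mem assms by auto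
  then show ?thesis using chart unfolding minty_chart_def monotone_graph_def by blast
qed

text \<open>Resolvent estimate: for monotonically related differences \<open>a\<close>,
  \<open>b\<close>, the squared product norm of \<open>(a, b)\<close> is at most the squared norm of
  \<open>a + b\<close>, which is the parameter difference.\<close>

lemma chart_lipschitz: "1-lipschitz_on (ball c \<delta>) \<Phi>"
proof (rule lipschitz_onI)
  fix u u' assume u: "u \<in> ball c \<delta>" "u' \<in> ball c \<delta>"
  define a where "a = fst (\<Phi> u) - fst (\<Phi> u')"
  define b where "b = snd (\<Phi> u) - snd (\<Phi> u')"
  have "a + b = u - u'" using chart_sum[OF u(1)] chart_sum[OF u(2)] by (simp add: a_def b_def algebra_simps)
  moreover have "(norm a)\<^sup>2 + (norm b)\<^sup>2 \<le> (norm (a + b))\<^sup>2"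
    using chart_mono[OF u] by (intro norm_Pair_le_norm_add) (simp add: a_def b_def)
  moreover have "(dist (\<Phi> u) (\<Phi> u'))\<^sup>2 = (norm a)\<^sup>2 + (norm b)\<^sup>2"
    by (simp add: dist_norm norm_prod_def a_def b_def)
  ultimately have "(dist (\<Phi> u) (\<Phi> u'))\<^sup>2 \<le> (dist u u')\<^sup>2" by (simp add: dist_norm)
  then have "dist (\<Phi> u) (\<Phi> u') \<le> dist u u'" by (rule power2_le_imp_le) simp
  then show "dist (\<Phi> u) (\<Phi> u') \<le> 1 * dist u u'" by simp
qed simp

text \<open>Differentiating the identity that the components of \<open>\<Phi> u\<close> sum to
  \<open>u\<close> shows that \<open>D\<close> is injective. Hence its range has full dimension, and
  every differentiability point of \<open>\<Phi>\<close> gives a point of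
  \<open>O_set F\<close>.\<close>

lemma chart_tangent:
  assumes u: "u \<in> ball c \<delta>" and D: "(\<Phi> has_derivative D) (at u)"
  shows "tangent_cone (gph F) (\<Phi> u) = range D" "fst (D w) + snd (D w) = w" "\<Phi> u \<in> O_set F"
proof -
  define \<pi> where "\<pi> = (\<lambda>z :: (real^'n) \<times> (real^'n). fst z + snd z)"
  have \<pi>: "bounded_linear \<pi>" unfolding \<pi>_def by (intro bounded_linear_add bounded_linear_fst bounded_linear_snd)
  show T: "tangent_cone (gph F) (\<Phi> u) = range D"
  proof (rule tangent_cone_chart[OF open_ball u _ chart_open _ \<pi> _ _ D])
    show "\<And>z. z \<in> gph F \<Longrightarrow> z \<in> W \<Longrightarrow> \<Phi> (\<pi> z) = z" using chart_inv(2) by (simp add: \<pi>_def)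
  qed (use chart_mem chart_sum u in \<open>auto simp: \<pi>_def\<close>)
  have "((\<lambda>u. \<pi> (\<Phi> u)) has_derivative (\<lambda>w. \<pi> (D w))) (at u)"
    by (rule bounded_linear.has_derivative[OF \<pi> D])
  then have "((\<lambda>u. u) has_derivative (\<lambda>w. \<pi> (D w))) (at u)"
    by (rule has_derivative_transform_within_open[OF _ open_ball u]) (use chart_sum in \<open>simp add: \<pi>_def\<close>)
  from has_derivative_unique[OF this has_derivative_ident]
  have id: "\<pi> (D w) = w" for w by (rule fun_cong)
  then show "fst (D w) + snd (D w) = w" by (simp add: \<pi>_def)
  have lin: "linear D" using D has_derivative_linear by blast
  have "inj D" using id by (metis injI)
  have "dim (range D) = CARD('n)"
    using dim_image_eq[OF lin, of UNIV] \<open>inj D\<close> by simp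
  then have "range D \<in> Zn" using lin by (simp add: Zn_def linear_subspace_image)
  then show "\<Phi> u \<in> O_set F" using chart_mem(1)[OF u] T by (simp add: O_set_def)
qed

lemma chart_differentiable_ae:
  assumes "cball a r \<subseteq> ball c \<delta>"
  shows "AE u in lborel. u \<in> ball a r \<longrightarrow> \<Phi> differentiable (at u)"
  by (rule Rademacher_cball[OF lipschitz_on_subset[OF chart_lipschitz assms]])

text \<open>By Rademacher the differentiability points of \<open>\<Phi>\<close> are dense, so every
  graph point in \<open>W\<close> is a limit of points of \<open>O_set F\<close>; compactness of
  \<open>Zn\<close> extracts a limit of the dual tangent spaces.\<close>

lemma chart_SCD_property: "SCD_property_around F z" if zW: "z \<in> W"
  unfolding SCD_property_around_def
proof (intro exI conjI ballI)
  fix z assume z: "z \<in> gph F \<inter> W"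
  define u where "u = fst z + snd z"
  have u: "u \<in> ball c \<delta>" "\<Phi> u = z" using chart_inv z by (auto simp: u_def)
  obtain r where r: "r > 0" "cball u r \<subseteq> ball c \<delta>"
    using open_contains_cball[THEN iffD1, OF open_ball, rule_format, OF u(1)] by blast
  have ae: "AE v in lborel. v \<in> ball u r \<longrightarrow> \<Phi> differentiable (at v)" by (rule chart_differentiable_ae[OF r(2)])
  have "\<exists>v. v \<in> ball u r \<and> dist v u < inverse (real (Suc k)) \<and> \<Phi> differentiable (at v)" for k
  proof -
    have "ball u (min r (inverse (real (Suc k)))) \<noteq> {}"
      using r(1) by (simp add: not_le)
    from AE_lborel_imp_ex_in_open[OF ae open_ball this] show ?thesis by (auto simp: dist_commute)
  qed
  then have "\<forall>k. \<exists>v. v \<in> ball u r \<and> dist v u < inverse (real (Suc k)) \<and> \<Phi> differentiable (at v)" by blast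
  from choice[OF this] obtain v where v': "\<forall>k. v k \<in> ball u r \<and> dist (v k) u < inverse (real (Suc k)) \<and> \<Phi> differentiable (at (v k))"
    by (elim exE)
  have vb: "v k \<in> ball c \<delta>" for k using v' r(2) by (auto simp: subset_iff less_imp_le)
  have O: "\<Phi> (v k) \<in> O_set F" for k
    using v' chart_tangent(3)[OF vb] by (auto simp: differentiable_def)
  have "(\<lambda>k. dist (v k) u) \<longlonglongrightarrow> 0"
    by (rule Lim_null_comparison[OF _ LIMSEQ_inverse_real_of_nat])
      (use v' in \<open>simp add: always_eventually less_imp_le\<close>)
  then have "v \<longlonglongrightarrow> u" by (rule tendsto_dist_iff[THEN iffD2])
  then have lim: "(\<lambda>k. \<Phi> (v k)) \<longlonglongrightarrow> z"
    using lipschitz_on_continuous_on[OF chart_lipschitz] u vb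
    by (auto intro: continuous_on_tendsto_compose)
  define L where "L = (\<lambda>k. dual_subspace (tangent_cone (gph F) (\<Phi> (v k))))"
  have L: "L k \<in> Zn" for k unfolding L_def using O by (intro dual_subspace_Zn) (auto simp: O_set_def)
  from Zn_seq_compact[of L, OF L]
  obtain s M where s: "strict_mono (s :: nat \<Rightarrow> nat)" and M: "M \<in> Zn" "(\<lambda>k. dZ M (L (s k))) \<longlonglongrightarrow> 0"
    by (elim exE conjE)
  have "M \<in> SCD_dual F z"
    unfolding SCD_dual_def mem_Collect_eq
  proof (intro conjI exI[of _ "(\<lambda>k. \<Phi> (v k)) \<circ> s"] allI)
    show "((\<lambda>k. \<Phi> (v k)) \<circ> s) \<longlonglongrightarrow> z" by (rule LIMSEQ_subseq_LIMSEQ[OF lim s])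
  qed (use M O in \<open>simp_all add: L_def\<close>)
  then show "SCD_property_at F z" unfolding SCD_property_at_def by blast
qed (use chart_open zW in auto)

end

section \<open>Metrically regular monotone mappings\<close>

lemma edist_set_le: "a \<in> A \<Longrightarrow> edist_set x A \<le> ereal (dist x a)"
  unfolding edist_set_def by (rule INF_lower)

lemma edist_set_less_ex:
  assumes "edist_set x A \<le> ereal r" "r < s"
  shows "\<exists>a\<in>A. dist x a < s"
proof -
  have "edist_set x A < ereal s" using assms by (metis ereal_less_eq(3) less_eq_ereal_def less_ereal.simps(1) order_le_less_trans)
  then show ?thesis unfolding edist_set_def by (auto simp: INF_less_iff)
qed

lemma le_ereal_times_edist_set:
  assumes "\<kappa> > 0" and le: "\<And>b. b \<in> B \<Longrightarrow> e \<le> ereal (\<kappa> * dist y b)"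
  shows "e \<le> ereal \<kappa> * edist_set y B"
proof -
  have "e / ereal \<kappa> \<le> edist_set y B"
    unfolding edist_set_def
  proof (rule INF_greatest)
    fix b assume "b \<in> B"
    then show "e / ereal \<kappa> \<le> ereal (dist y b)"
      using le[of b] \<open>\<kappa> > 0\<close> by (simp add: ereal_divide_le_pos)
  qed
  then show ?thesis using \<open>\<kappa> > 0\<close> by (simp add: ereal_divide_le_pos)
qed

text \<open>Replaces distances to sets by actual points. The infimum may not be attained, so the
  constant grows to \<open>\<kappa> + 1\<close>, which leaves strict room whenever
  \<open>y \<noteq> y'\<close>.\<close>

lemma metrically_regular_selection:
  fixes F :: "real^'n \<Rightarrow> (real^'n) set"
  assumes "metrically_regular_around F x0 y0"
  shows "\<exists>\<kappa>>0. \<exists>X Y. open X \<and> open Y \<and> x0 \<in> X \<and> y0 \<in> Y \<and>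
    (\<forall>x\<in>X. \<forall>y\<in>Y. \<forall>y'\<in>F x. \<exists>x'. y \<in> F x' \<and> dist x x' \<le> \<kappa> * dist y y')"
proof -
  obtain \<kappa> :: real and X Y where \<kappa>: "\<kappa> \<ge> 0" and XY: "open X" "open Y" "x0 \<in> X" "y0 \<in> Y"
    and mr: "\<And>x y. x \<in> X \<Longrightarrow> y \<in> Y \<Longrightarrow> edist_set x (inverse_map F y) \<le> ereal \<kappa> * edist_set y (F x)"
    using assms unfolding metrically_regular_around_def by blast
  have "\<exists>x'. y \<in> F x' \<and> dist x x' \<le> (\<kappa> + 1) * dist y y'" if xy: "x \<in> X" "y \<in> Y" "y' \<in> F x" for x y y'
  proof (cases "y = y'")
    case True
    then show ?thesis using xy(3) by (intro exI[of _ x]) simp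
  next
    case False
    have "edist_set x (inverse_map F y) \<le> ereal \<kappa> * edist_set y (F x)" by (rule mr[OF xy(1,2)])
    also have "\<dots> \<le> ereal \<kappa> * ereal (dist y y')"
      using \<kappa> by (intro ereal_mult_left_mono edist_set_le xy(3)) simp
    finally have "edist_set x (inverse_map F y) \<le> ereal (\<kappa> * dist y y')" by simp
    moreover have "\<kappa> * dist y y' < (\<kappa> + 1) * dist y y'" using False by simp
    ultimately obtain x' where "x' \<in> inverse_map F y" "dist x x' < (\<kappa> + 1) * dist y y'"
      using edist_set_less_ex by blast
    then show ?thesis by (intro exI[of _ x']) (simp add: inverse_map_def)
  qed
  then show ?thesis using \<kappa> XY by (intro exI[of _ "\<kappa> + 1"] conjI exI[of _ X] exI[of _ Y]) auto
qed

text \<open>A value \<open>y'\<close> of \<open>F\<close> at \<open>x\<close> that lies in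
  \<open>Y\<close> forces \<open>x = h y'\<close>, and the Lipschitz bound applies. Any other value
  is far from \<open>y\<close>, and a crude estimate suffices.\<close>

lemma metrically_regularI:
  fixes F :: "real^'n \<Rightarrow> (real^'n) set"
  assumes X: "open X" "x0 \<in> X" and Y: "open Y" "y0 \<in> Y" and h0: "h y0 = x0"
    and gr: "gph F \<inter> X \<times> Y = {(h y, y) | y. y \<in> Y}" and lip: "\<kappa>-lipschitz_on Y h"
  shows "metrically_regular_around F x0 y0"
proof -
  obtain r where r: "r > 0" "ball x0 r \<subseteq> X" using X open_contains_ball by blast
  obtain \<delta> where \<delta>: "\<delta> > 0" "ball y0 \<delta> \<subseteq> Y" using Y open_contains_ball by blast
  have \<kappa>: "\<kappa> \<ge> 0" using lip by (rule lipschitz_on_nonneg)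
  \<comment> \<open>In the far case \<open>dist y y'\<close> is at least
    \<open>\<delta> / 2\<close>, while \<open>dist x x0\<close> and \<open>dist x0 (h y)\<close> are
    each at most \<open>(\<kappa> + 1) * \<delta> / 4\<close>.\<close>
  define \<rho> where "\<rho> = min r ((\<kappa> + 1) * \<delta> / 4)"
  have \<rho>: "\<rho> > 0" "\<rho> \<le> r" "\<rho> \<le> (\<kappa> + 1) * \<delta> / 4" using r \<delta> \<kappa> by (auto simp: \<rho>_def)
  have "edist_set x (inverse_map F y) \<le> ereal (\<kappa> + 1) * edist_set y (F x)"
    if x: "x \<in> ball x0 \<rho>" and y: "y \<in> ball y0 (\<delta> / 4)" for x y
  proof (rule le_ereal_times_edist_set)
    fix y' assume y': "y' \<in> F x"
    have yY: "y \<in> Y" using y \<delta> by (auto simp: subset_iff)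
    then have "(h y, y) \<in> gph F" using gr by blast
    then have "h y \<in> inverse_map F y" by (simp add: gph_def inverse_map_def)
    from edist_set_le[OF this] have le: "edist_set x (inverse_map F y) \<le> ereal (dist x (h y))" .
    have "dist x (h y) \<le> (\<kappa> + 1) * dist y y'"
    proof (cases "y' \<in> Y")
      case True
      have "x \<in> X" using x \<rho>(2) r(2) by (auto simp: subset_iff)
      then have "(x, y') \<in> {(h y, y) | y. y \<in> Y}" using y' True unfolding gr[symmetric] by (simp add: gph_def)
      then have "x = h y'" by blast
      then have "dist x (h y) \<le> \<kappa> * dist y' y" using lipschitz_onD[OF lip True yY] by simp
      then show ?thesis using mult_right_mono[of \<kappa> "\<kappa> + 1" "dist y y'"] by (simp add: dist_commute)
    next
      case False
      then have "\<not> dist y0 y' < \<delta>" using \<delta>(2) by (auto simp: subset_iff)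
      then have "dist y y' \<ge> \<delta> / 2" using y dist_triangle[of y0 y' y] \<delta>(1) by simp
      then have far: "(\<kappa> + 1) * (\<delta> / 2) \<le> (\<kappa> + 1) * dist y y'" using \<kappa> by (intro mult_left_mono) auto
      have "dist (h y0) (h y) \<le> \<kappa> * dist y0 y" by (rule lipschitz_onD[OF lip Y(2) yY])
      also have "\<dots> \<le> (\<kappa> + 1) * (\<delta> / 4)" using y \<kappa> by (intro mult_mono) auto
      finally have "dist x0 (h y) \<le> (\<kappa> + 1) * (\<delta> / 4)" by (simp add: h0)
      moreover have "dist x (h y) \<le> dist x x0 + dist x0 (h y)" by (rule dist_triangle)
      moreover have "dist x x0 \<le> (\<kappa> + 1) * \<delta> / 4" using x \<rho>(3) by (simp add: dist_commute)
      ultimately show ?thesis using far by simp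
    qed
    then show "edist_set x (inverse_map F y) \<le> ereal ((\<kappa> + 1) * dist y y')"
      using le by (metis ereal_less_eq(3) order_trans)
  qed (use \<kappa> in simp)
  then show ?thesis
    unfolding metrically_regular_around_def using \<kappa> \<rho>(1) \<delta>(1)
    by (intro exI[of _ "\<kappa> + 1"] conjI exI[of _ "ball x0 \<rho>"] exI[of _ "ball y0 (\<delta> / 4)"]) auto
qed

text \<open>Supplies the step length for the two perturbation arguments, uniqueness of preimages and
  local maximality, that end in a contradiction with monotonicity.\<close>

lemma small_step_in_ball:
  fixes y v :: "'a::real_normed_vector"
  assumes "y \<in> ball y0 \<delta>" "s > 0"
  shows "\<exists>t>0. \<kappa> * t < s \<and> y + t *\<^sub>R v \<in> ball y0 \<delta>"
proof -
  have "((\<lambda>t. \<kappa> * t) \<longlongrightarrow> \<kappa> * 0) (at_right 0)" by (intro tendsto_intros)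
  from order_tendstoD(2)[OF this, of s] have 1: "\<forall>\<^sub>F t in at_right 0. \<kappa> * t < s" using assms by simp
  have "((\<lambda>t. dist y0 (y + t *\<^sub>R v)) \<longlongrightarrow> dist y0 (y + 0 *\<^sub>R v)) (at_right 0)" by (intro tendsto_intros)
  from order_tendstoD(2)[OF this, of \<delta>] have 2: "\<forall>\<^sub>F t in at_right 0. dist y0 (y + t *\<^sub>R v) < \<delta>" using assms by simp
  have "\<forall>\<^sub>F t in at_right (0::real). t > 0" by (simp add: eventually_at_right_less)
  with 1 2 have "\<forall>\<^sub>F t in at_right 0. t > 0 \<and> \<kappa> * t < s \<and> y + t *\<^sub>R v \<in> ball y0 \<delta>"
    by eventually_elim simp
  then show ?thesis using eventually_happens[of _ "at_right (0::real)"] by (auto simp: trivial_limit_at_right_real)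
qed

definition lipschitz_inverse ::
    "(real^'n \<Rightarrow> (real^'n) set) \<Rightarrow> real^'n \<Rightarrow> real^'n \<Rightarrow> real \<Rightarrow> real \<Rightarrow> real \<Rightarrow> (real^'n \<Rightarrow> real^'n) \<Rightarrow> bool" where
  "lipschitz_inverse F x0 y0 r \<delta> \<kappa> h \<longleftrightarrow> r > 0 \<and> \<delta> > 0 \<and> h y0 = x0 \<and>
     gph F \<inter> ball x0 r \<times> ball y0 \<delta> = {(h y, y) | y. y \<in> ball y0 \<delta>} \<and>
     \<kappa>-lipschitz_on (ball y0 \<delta>) h \<and> monotone_graph (gph F \<inter> ball x0 r \<times> ball y0 \<delta>)"

text \<open>If \<open>x1 \<noteq> x2\<close> were two preimages of \<open>y\<close>, regularity would yield a preimage of \<open>y + t (x1 - x2)\<close>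
  within \<open>O(t)\<close> of \<open>x2\<close>, which violates monotonicity against \<open>(x1, y)\<close> for small \<open>t\<close>.\<close>
lemma lipschitz_inverse_exists:
  fixes F :: "real^'n \<Rightarrow> (real^'n) set"
  assumes z0: "(x0, y0) \<in> gph F" and mono: "locally_monotone_at F x0 y0"
    and mr: "metrically_regular_around F x0 y0"
  shows "\<exists>r \<delta> \<kappa> h. lipschitz_inverse F x0 y0 r \<delta> \<kappa> h"
proof -
  obtain X Y where XY: "open X" "open Y" "x0 \<in> X" "y0 \<in> Y" and mg: "monotone_graph (gph F \<inter> X \<times> Y)"
    using mono unfolding locally_monotone_at_def by blast
  from metrically_regular_selection[OF mr]
  obtain \<kappa> X' Y' where \<kappa>: "\<kappa> > 0" and XY': "open X'" "open Y'" "x0 \<in> X'" "y0 \<in> Y'"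
    and sel': "\<forall>x\<in>X'. \<forall>y\<in>Y'. \<forall>y'\<in>F x. \<exists>x'. y \<in> F x' \<and> dist x x' \<le> \<kappa> * dist y y'"
    by (elim exE conjE)
  have sel: "\<exists>x'. y \<in> F x' \<and> dist x x' \<le> \<kappa> * dist y y'" if "x \<in> X'" "y \<in> Y'" "y' \<in> F x" for x y y'
    using sel' that by blast
  have "open (X \<inter> X')" "x0 \<in> X \<inter> X'" using XY XY' by auto
  then obtain R where R: "R > 0" "ball x0 R \<subseteq> X \<inter> X'" using open_contains_ball by blast
  have "open (Y \<inter> Y')" "y0 \<in> Y \<inter> Y'" using XY XY' by auto
  then obtain \<eta> where \<eta>: "\<eta> > 0" "ball y0 \<eta> \<subseteq> Y \<inter> Y'" using open_contains_ball by blast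
  define r where "r = R / 2"
  \<comment> \<open>Two points of the small \<open>y\<close>-ball are at most
    \<open>2 * \<delta>\<close> apart, so a regularity step starting in \<open>ball x0 r\<close> has
    length at most \<open>r\<close> and ends in \<open>ball x0 R\<close>, where preimages are
    unique.\<close>
  define \<delta> where "\<delta> = min \<eta> (r / (2 * \<kappa>))"
  have r: "r > 0" "r \<le> R" "2 * r = R" using R by (auto simp: r_def)
  have \<delta>: "\<delta> > 0" "\<delta> \<le> \<eta>" using \<eta> r \<kappa> by (auto simp: \<delta>_def)
  have "\<delta> \<le> r / (2 * \<kappa>)" by (simp add: \<delta>_def)
  then have \<kappa>\<delta>: "\<kappa> * (2 * \<delta>) \<le> r" using \<kappa> by (simp add: field_simps)
  have inX: "x \<in> X" "x \<in> X'" if "x \<in> ball x0 R" for x using that R by blast+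
  have inY: "y \<in> Y" "y \<in> Y'" if "y \<in> ball y0 \<delta>" for y using that \<eta> \<delta> by (auto simp: subset_iff)
  have mn: "(y1 - y2) \<bullet> (x1 - x2) \<ge> 0"
    if "y1 \<in> F x1" "y2 \<in> F x2" "x1 \<in> ball x0 R" "x2 \<in> ball x0 R" "y1 \<in> ball y0 \<delta>" "y2 \<in> ball y0 \<delta>" for x1 x2 y1 y2
    using mg that inX inY unfolding monotone_graph_def by (auto simp: gph_def simp del: mem_ball)
  have uniq: "x1 = x2" if F12: "y \<in> F x1" "y \<in> F x2" and x12: "x1 \<in> ball x0 R" "x2 \<in> ball x0 R" and y: "y \<in> ball y0 \<delta>" for x1 x2 y
  proof (rule ccontr)
    assume "x1 \<noteq> x2"
    define d where "d = x1 - x2"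
    have d: "norm d > 0" using \<open>x1 \<noteq> x2\<close> by (simp add: d_def)
    have gap: "R - dist x0 x2 > 0" using x12 by simp
    \<comment> \<open>The bound by 1 yields the contradiction at the end; the other bound keeps the
      new preimage in \<open>ball x0 R\<close>, where monotonicity is available.\<close>
    obtain t where t: "t > 0" "\<kappa> * t < min 1 ((R - dist x0 x2) / norm d)" "y + t *\<^sub>R d \<in> ball y0 \<delta>"
      using small_step_in_ball[OF y, of "min 1 ((R - dist x0 x2) / norm d)" \<kappa> d] d gap by auto
    obtain x' where x': "y + t *\<^sub>R d \<in> F x'" "dist x2 x' \<le> \<kappa> * dist (y + t *\<^sub>R d) y"
      using sel[OF inX(2)[OF x12(2)] inY(2)[OF t(3)] F12(2)] by blast
    have dx: "norm (x' - x2) \<le> \<kappa> * t * norm d" using x'(2) t(1) by (simp add: dist_norm norm_minus_commute mult.assoc)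
    also have "\<dots> < R - dist x0 x2" using t(2) d by (simp add: pos_less_divide_eq)
    finally have "x' \<in> ball x0 R" using dist_triangle[of x0 x' x2] by (simp add: dist_norm norm_minus_commute)
    from mn[OF x'(1) F12(1) this x12(1) t(3) y] have "0 \<le> t * (d \<bullet> (x' - x1))" by simp
    then have "0 \<le> d \<bullet> (x' - x1)" using t(1) by (simp add: zero_le_mult_iff)
    also have "d \<bullet> (x' - x1) = d \<bullet> (x' - x2) - (norm d)\<^sup>2"
      by (simp add: d_def power2_norm_eq_inner inner_simps)
    finally have "(norm d)\<^sup>2 \<le> d \<bullet> (x' - x2)" by simp
    also have "\<dots> \<le> norm d * norm (x' - x2)" by (rule norm_cauchy_schwarz)
    also have "\<dots> \<le> norm d * (\<kappa> * t * norm d)" using dx by (intro mult_left_mono) auto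
    also have "\<dots> = \<kappa> * t * (norm d)\<^sup>2" by (simp add: power2_eq_square)
    also have "\<dots> < 1 * (norm d)\<^sup>2" using t(2) d by (intro mult_strict_right_mono) auto
    finally show False by simp
  qed
  have y0F: "y0 \<in> F x0" using z0 by (simp add: gph_def)
  have "\<exists>x. y \<in> F x \<and> x \<in> ball x0 r" if y: "y \<in> ball y0 \<delta>" for y
  proof -
    obtain x where x: "y \<in> F x" "dist x0 x \<le> \<kappa> * dist y y0"
      using sel[OF XY'(3) inY(2)[OF y] y0F] by blast
    have "\<kappa> * dist y y0 < \<kappa> * (2 * \<delta>)" using y \<kappa> \<delta>(1) by (intro mult_strict_left_mono) (auto simp: dist_commute)
    then show ?thesis using x \<kappa>\<delta> by (intro exI[of _ x]) simp
  qed
  then have "\<forall>y. \<exists>x. y \<in> ball y0 \<delta> \<longrightarrow> y \<in> F x \<and> x \<in> ball x0 r" by blast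
  from choice[OF this] obtain h where h': "\<forall>y. y \<in> ball y0 \<delta> \<longrightarrow> y \<in> F (h y) \<and> h y \<in> ball x0 r"
    by (elim exE)
  then have h: "y \<in> F (h y)" "h y \<in> ball x0 r" if "y \<in> ball y0 \<delta>" for y using that by blast+
  have rR: "x \<in> ball x0 R" if "x \<in> ball x0 r" for x using that r(2) by simp
  have "lipschitz_inverse F x0 y0 r \<delta> \<kappa> h"
    unfolding lipschitz_inverse_def
  proof (intro conjI)
    have y0: "y0 \<in> ball y0 \<delta>" using \<delta> by simp
    show "h y0 = x0" using R by (intro uniq[OF h(1)[OF y0] y0F rR[OF h(2)[OF y0]] _ y0]) simp
    show "gph F \<inter> ball x0 r \<times> ball y0 \<delta> = {(h y, y) | y. y \<in> ball y0 \<delta>}"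
    proof (intro subset_antisym subsetI)
      fix z assume "z \<in> gph F \<inter> ball x0 r \<times> ball y0 \<delta>"
      then obtain x y where z: "z = (x, y)" "y \<in> F x" "x \<in> ball x0 r" "y \<in> ball y0 \<delta>" by (auto simp: gph_def)
      have "x = h y" by (rule uniq[OF z(2) h(1)[OF z(4)] rR[OF z(3)] rR[OF h(2)[OF z(4)]] z(4)])
      then show "z \<in> {(h y, y) | y. y \<in> ball y0 \<delta>}" using z by blast
    next
      fix z assume "z \<in> {(h y, y) | y. y \<in> ball y0 \<delta>}"
      then obtain y where "z = (h y, y)" "y \<in> ball y0 \<delta>" by blast
      then show "z \<in> gph F \<inter> ball x0 r \<times> ball y0 \<delta>" using h by (simp add: gph_def del: mem_ball)
    qed
    show "\<kappa>-lipschitz_on (ball y0 \<delta>) h"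
    proof (rule lipschitz_onI)
      fix y1 y2 assume y: "y1 \<in> ball y0 \<delta>" "y2 \<in> ball y0 \<delta>"
      obtain x' where x': "y2 \<in> F x'" "dist (h y1) x' \<le> \<kappa> * dist y2 y1"
        using sel[OF inX(2)[OF rR[OF h(2)[OF y(1)]]] inY(2)[OF y(2)] h(1)[OF y(1)]] by blast
      have "dist y2 y1 \<le> 2 * \<delta>" using y dist_triangle[of y2 y1 y0] by (simp add: dist_commute)
      then have "\<kappa> * dist y2 y1 \<le> r" using \<kappa>\<delta> \<kappa> mult_left_mono[of "dist y2 y1" "2 * \<delta>" \<kappa>] by linarith
      then have "dist x0 x' < R" using x'(2) h(2)[OF y(1)] dist_triangle[of x0 x' "h y1"] r(3) by simp
      then have "x' = h y2" by (intro uniq[OF x'(1) h(1)[OF y(2)] _ rR[OF h(2)[OF y(2)]] y(2)]) simp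
      then show "dist (h y1) (h y2) \<le> \<kappa> * dist y1 y2" using x'(2) by (simp add: dist_commute)
    qed (use \<kappa> in simp)
    show "monotone_graph (gph F \<inter> ball x0 r \<times> ball y0 \<delta>)"
      unfolding monotone_graph_def using mn rR by (auto simp: gph_def simp del: mem_ball)
  qed (use r \<delta> in simp_all)
  then show ?thesis by blast
qed

text \<open>The local form of the fact that continuous monotone maps are maximal. For
  \<open>(x, y)\<close> in a monotone extension and \<open>v = x - h y\<close>, testing against the
  point over \<open>y + t *\<^sub>R v\<close> gives
  \<open>norm v ^ 2 \<le> \<kappa> * t * norm v ^ 2\<close>, impossible for small \<open>t\<close>
  unless \<open>v = 0\<close>.\<close>

lemma lipschitz_inverse_locally_maximally_monotone:
  fixes F :: "real^'n \<Rightarrow> (real^'n) set"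
  assumes inv: "lipschitz_inverse F x0 y0 r \<delta> \<kappa> h"
  shows "locally_maximally_monotone_at F x0 y0"
proof -
  have r: "r > 0" "\<delta> > 0" and gr: "gph F \<inter> ball x0 r \<times> ball y0 \<delta> = {(h y, y) | y. y \<in> ball y0 \<delta>}"
    and lip: "\<kappa>-lipschitz_on (ball y0 \<delta>) h" and mono: "monotone_graph (gph F \<inter> ball x0 r \<times> ball y0 \<delta>)"
    using inv unfolding lipschitz_inverse_def by blast+
  have "gph F \<inter> ball x0 r \<times> ball y0 \<delta> = gph T \<inter> ball x0 r \<times> ball y0 \<delta>"
    if T: "monotone_mapping T" and sub: "gph F \<inter> ball x0 r \<times> ball y0 \<delta> \<subseteq> gph T" for T
  proof (intro subset_antisym subsetI)
    fix z assume "z \<in> gph T \<inter> ball x0 r \<times> ball y0 \<delta>"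
    then obtain x y where z: "z = (x, y)" "(x, y) \<in> gph T" "y \<in> ball y0 \<delta>" by auto
    have hT: "(h y', y') \<in> gph T" if "y' \<in> ball y0 \<delta>" for y' using sub that unfolding gr by blast
    define v where "v = x - h y"
    have "v = 0"
    proof (rule ccontr)
      assume v: "v \<noteq> 0"
      obtain t where t: "t > 0" "\<kappa> * t < 1" "y + t *\<^sub>R v \<in> ball y0 \<delta>"
        using small_step_in_ball[OF z(3), of 1 \<kappa> v] by auto
      have "0 \<le> (y + t *\<^sub>R v - y) \<bullet> (h (y + t *\<^sub>R v) - x)"
        using T hT[OF t(3)] z(2) unfolding monotone_mapping_def monotone_graph_def by blast
      then have "0 \<le> v \<bullet> (h (y + t *\<^sub>R v) - x)" using t(1) by (simp add: zero_le_mult_iff)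
      also have "\<dots> = v \<bullet> (h (y + t *\<^sub>R v) - h y) - (norm v)\<^sup>2"
        by (simp add: v_def power2_norm_eq_inner inner_simps)
      finally have "(norm v)\<^sup>2 \<le> v \<bullet> (h (y + t *\<^sub>R v) - h y)" by simp
      also have "\<dots> \<le> norm v * norm (h (y + t *\<^sub>R v) - h y)" by (rule norm_cauchy_schwarz)
      also have "\<dots> \<le> norm v * (\<kappa> * (t * norm v))"
        using lipschitz_onD[OF lip t(3) z(3)] t(1) by (intro mult_left_mono) (auto simp: dist_norm)
      also have "\<dots> = \<kappa> * t * (norm v)\<^sup>2" by (simp add: power2_eq_square)
      also have "\<dots> < 1 * (norm v)\<^sup>2" using t(2) v by (intro mult_strict_right_mono) auto
      finally show False by simp
    qed
    then have "z = (h y, y)" using z by (simp add: v_def)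
    then show "z \<in> gph F \<inter> ball x0 r \<times> ball y0 \<delta>" unfolding gr using z(3) by blast
  qed (use sub in blast)
  then show ?thesis
    unfolding locally_maximally_monotone_at_def using r mono
    by (intro exI[of _ "ball x0 r"] exI[of _ "ball y0 \<delta>"]) (simp del: mem_ball add: centre_in_ball)
qed

lemma lipschitz_inverse_tangent:
  fixes F :: "real^'n \<Rightarrow> (real^'n) set"
  assumes inv: "lipschitz_inverse F x0 y0 r \<delta> \<kappa> h"
    and z: "z \<in> gph F" "z \<in> ball x0 r \<times> ball y0 \<delta>" and pq: "(p, q) \<in> tangent_cone (gph F) z"
  shows "norm p \<le> \<kappa> * norm q" "p \<bullet> q \<ge> 0"
proof -
  have gr: "gph F \<inter> ball x0 r \<times> ball y0 \<delta> = {(h y, y) | y. y \<in> ball y0 \<delta>}"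
    and lip: "\<kappa>-lipschitz_on (ball y0 \<delta>) h" and mono: "monotone_graph (gph F \<inter> ball x0 r \<times> ball y0 \<delta>)"
    using inv unfolding lipschitz_inverse_def by blast+
  have op: "open (ball x0 r \<times> ball y0 \<delta>)" by (simp add: open_Times)
  have "0 \<le> (\<lambda>w. \<kappa> * norm (snd w) - norm (fst w)) (p, q)"
  proof (rule tangent_cone_pair_inequality[OF op z(2,1) _ _ _ pq])
    fix a b :: "(real^'n) \<times> (real^'n)"
    assume ab: "a \<in> gph F \<inter> ball x0 r \<times> ball y0 \<delta>" "b \<in> gph F \<inter> ball x0 r \<times> ball y0 \<delta>"
    then have "dist (fst b) (fst a) \<le> \<kappa> * dist (snd b) (snd a)"
      unfolding gr using lipschitz_onD[OF lip] by auto
    then show "0 \<le> \<kappa> * norm (snd (b - a)) - norm (fst (b - a))" by (simp add: dist_norm)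
  next
    fix t :: real and w :: "(real^'n) \<times> (real^'n)"
    assume t: "t > 0" "0 \<le> \<kappa> * norm (snd (t *\<^sub>R w)) - norm (fst (t *\<^sub>R w))"
    then have "0 \<le> t * (\<kappa> * norm (snd w) - norm (fst w))" by (simp add: algebra_simps)
    then show "0 \<le> \<kappa> * norm (snd w) - norm (fst w)" using t(1) by (simp add: zero_le_mult_iff)
  qed (intro continuous_intros)
  then show "norm p \<le> \<kappa> * norm q" by simp
  have "0 \<le> (\<lambda>w. snd w \<bullet> fst w) (p, q)"
  proof (rule tangent_cone_pair_inequality[OF op z(2,1) _ _ _ pq])
    fix a b :: "(real^'n) \<times> (real^'n)"
    assume ab: "a \<in> gph F \<inter> ball x0 r \<times> ball y0 \<delta>" "b \<in> gph F \<inter> ball x0 r \<times> ball y0 \<delta>"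
    have "0 \<le> (snd b - snd a) \<bullet> (fst b - fst a)"
      using mono[unfolded monotone_graph_def, rule_format, of "fst b" "snd b" "fst a" "snd a"] ab by simp
    then show "0 \<le> snd (b - a) \<bullet> fst (b - a)" by simp
  next
    fix t :: real and w :: "(real^'n) \<times> (real^'n)"
    assume t: "t > 0" "0 \<le> snd (t *\<^sub>R w) \<bullet> fst (t *\<^sub>R w)"
    then show "0 \<le> snd w \<bullet> fst w" by (simp add: zero_le_mult_iff)
  qed (intro continuous_intros)
  then show "p \<bullet> q \<ge> 0" by (simp add: inner_commute)
qed

text \<open>The slope bound and \<open>p \<bullet> q \<ge> 0\<close> hold on all tangent spaces at
  points of \<open>O_set F\<close> in one neighbourhood, and both are closed conditions. The slope
  bound reaches dual limits through \<open>slope_le_dual_iff\<close>; the sign condition, applied to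
  \<open>(C_mat L *v p, p)\<close>, is semidefiniteness.\<close>

lemma lipschitz_inverse_SCD:
  fixes F :: "real^'n \<Rightarrow> (real^'n) set"
  assumes inv: "lipschitz_inverse F x0 y0 r \<delta> \<kappa> h"
  shows "SCD_dual F (x0, y0) \<subseteq> Zn_reg" "SCD F (x0, y0) \<subseteq> Zn_reg"
    "L \<in> SCD F (x0, y0) \<Longrightarrow> (C_mat L *v p) \<bullet> p \<ge> 0"
proof -
  define U where "U = ball x0 r \<times> ball y0 \<delta>"
  have U: "open U" "(x0, y0) \<in> U" using inv by (auto simp: U_def lipschitz_inverse_def open_Times)
  have slope: "slope_le \<kappa> (tangent_cone (gph F) z)" if "z \<in> O_set F" "z \<in> U" for z
    using lipschitz_inverse_tangent(1)[OF inv] that by (auto simp: slope_le_def O_set_def U_def simp del: mem_ball)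
  have psd: "fst w \<bullet> snd w \<ge> 0" if "z \<in> O_set F" "z \<in> U" "w \<in> tangent_cone (gph F) z" for z w
    using lipschitz_inverse_tangent(2)[OF inv, of z "fst w" "snd w"] that by (auto simp: O_set_def U_def simp del: mem_ball)
  have ev: "\<forall>\<^sub>F k in sequentially. zs k \<in> U" if "zs \<longlonglongrightarrow> (x0, y0)" for zs :: "nat \<Rightarrow> (real^'n) \<times> (real^'n)"
    using topological_tendstoD[OF that U] .
  show "SCD_dual F (x0, y0) \<subseteq> Zn_reg"
  proof
    fix L assume "L \<in> SCD_dual F (x0, y0)"
    then obtain zs where L: "L \<in> Zn" and zs: "\<And>k. zs k \<in> O_set F" "zs \<longlonglongrightarrow> (x0, y0)"
      and lim: "(\<lambda>k. dZ L (dual_subspace (tangent_cone (gph F) (zs k)))) \<longlonglongrightarrow> 0" unfolding SCD_dual_def by blast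
    have T: "tangent_cone (gph F) (zs k) \<in> Zn" for k using zs(1) by (simp add: O_set_def)
    have "slope_le \<kappa> L"
    proof (rule Zn_limit_slope_le[OF L dual_subspace_Zn[OF T] lim])
      show "\<forall>\<^sub>F k in sequentially. slope_le \<kappa> (dual_subspace (tangent_cone (gph F) (zs k)))"
        using ev[OF zs(2)] by eventually_elim (simp add: slope_le_dual_iff[OF T] slope[OF zs(1)])
    qed
    then show "L \<in> Zn_reg" by (rule Zn_reg_if_slope_le[OF L])
  qed
  have *: "L \<in> Zn_reg \<and> (\<forall>(p, q) \<in> L. p \<bullet> q \<ge> 0)" if SL: "L \<in> SCD F (x0, y0)" for L
  proof -
    from SL obtain zs where L: "L \<in> Zn" and zs: "\<And>k. zs k \<in> O_set F" "zs \<longlonglongrightarrow> (x0, y0)"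
      and lim: "(\<lambda>k. dZ L (tangent_cone (gph F) (zs k))) \<longlonglongrightarrow> 0" unfolding SCD_def by blast
    have T: "tangent_cone (gph F) (zs k) \<in> Zn" for k using zs(1) by (simp add: O_set_def)
    have "slope_le \<kappa> L"
    proof (rule Zn_limit_slope_le[OF L T lim])
      show "\<forall>\<^sub>F k in sequentially. slope_le \<kappa> (tangent_cone (gph F) (zs k))"
        using ev[OF zs(2)] by eventually_elim (simp add: slope[OF zs(1)])
    qed
    moreover have "fst w \<bullet> snd w \<ge> 0" if w: "w \<in> L" for w
    proof -
      have l: "(\<lambda>k. orth_proj (tangent_cone (gph F) (zs k)) w) \<longlonglongrightarrow> w" by (rule Zn_limit_approx[OF L T lim w])
      show ?thesis
      proof (rule tendsto_lowerbound)
        show "(\<lambda>k. fst (orth_proj (tangent_cone (gph F) (zs k)) w) \<bullet> snd (orth_proj (tangent_cone (gph F) (zs k)) w))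
           \<longlonglongrightarrow> fst w \<bullet> snd w" by (intro tendsto_inner tendsto_fst tendsto_snd l)
        show "\<forall>\<^sub>F k in sequentially. 0 \<le> fst (orth_proj (tangent_cone (gph F) (zs k)) w) \<bullet> snd (orth_proj (tangent_cone (gph F) (zs k)) w)"
          using ev[OF zs(2)] by eventually_elim (rule psd[OF zs(1) _ orth_proj_in[OF T]])
      qed simp
    qed
    ultimately show ?thesis using Zn_reg_if_slope_le[OF L] by force
  qed
  then show "SCD F (x0, y0) \<subseteq> Zn_reg" by blast
  show "(C_mat L *v p) \<bullet> p \<ge> 0" if "L \<in> SCD F (x0, y0)"
    using *[OF that] C_mat_mem[of L p] by blast
qed

section \<open>Strong monotonicity and the equivalence\<close>

lemma AE_lborel_translate:
  fixes c :: "'a::euclidean_space"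
  assumes "AE x in lborel. P x"
  shows "AE x in lborel. P (x + c)"
proof -
  have "AE x in distr lborel borel ((+) c). P x" using assms unfolding lborel_distr_plus .
  then have "AE x in lborel. P (c + x)" by (rule AE_distrD[rotated]) simp
  then show ?thesis by (simp add: add.commute)
qed

text \<open>Averaging over the small ball \<open>C\<close> makes the increment along \<open>w\<close> differentiable everywhere
  in the step, so the mean value theorem applies although \<open>Q\<close> is differentiable only a.e.\<close>
lemma strongly_monotone_if_derivative_ae:
  fixes Q :: "'a::euclidean_space \<Rightarrow> 'a"
  assumes lip: "K-lipschitz_on UNIV Q"
    and der: "AE u in lborel. u \<in> ball c \<rho> \<longrightarrow> (\<exists>D. (Q has_derivative D) (at u) \<and> (\<forall>w. D w \<bullet> w \<ge> m * (w \<bullet> w)))"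
    and u: "u1 \<in> ball c \<rho>" "u2 \<in> ball c \<rho>"
  shows "(Q u1 - Q u2) \<bullet> (u1 - u2) \<ge> m * ((u1 - u2) \<bullet> (u1 - u2))"
proof (rule ccontr)
  define w where "w = u1 - u2"
  define f where "f = (\<lambda>u. Q u \<bullet> w)"
  have K: "K \<ge> 0" using lip by (rule lipschitz_on_nonneg)
  have lipf: "(K * norm w)-lipschitz_on UNIV f"
  proof (rule lipschitz_onI)
    fix x y
    have "dist (f x) (f y) = \<bar>(Q x - Q y) \<bullet> w\<bar>" by (simp add: f_def dist_norm inner_diff_left)
    also have "\<dots> \<le> norm (Q x - Q y) * norm w" by (rule Cauchy_Schwarz_ineq2)
    also have "\<dots> \<le> (K * dist x y) * norm w" using lipschitz_onD[OF lip, of x y]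
      by (intro mult_right_mono) (auto simp: dist_norm)
    finally show "dist (f x) (f y) \<le> K * norm w * dist x y" by (simp add: mult_ac)
  qed (use K in simp)
  have contf: "continuous_on UNIV f" using lipf by (rule lipschitz_on_continuous_on)
  note [measurable] = borel_measurable_dir_quot[OF contf] borel_measurable_continuous_onI[OF contf]
  have D_m[measurable]: "dir_deriv f w \<in> borel_measurable borel"
    unfolding dir_deriv_def by (intro borel_measurable_lim_metric) simp
  assume "\<not> ?thesis"
  then have "f (u2 + w) - f u2 < m * (w \<bullet> w)" by (simp add: f_def w_def inner_diff_left)
  \<comment> \<open>The gap on both sides of \<open>e\<close> lets the failure at \<open>u2\<close>
    persist for all base points in a small ball.\<close>
  then obtain e where e: "f (u2 + w) - f u2 < e" "e < m * (w \<bullet> w)" using dense by blast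
  define N where "N = {u. f (u + w) - f u < e} \<inter> ball c \<rho> \<inter> (\<lambda>u. u + w) -` ball c \<rho>"
  have "open {u. f (u + w) - f u < e}"
    by (intro open_Collect_less continuous_intros continuous_on_compose2[OF contf]) auto
  moreover have "open ((\<lambda>u. u + w) -` ball c \<rho>)" by (intro open_vimage open_ball continuous_intros)
  ultimately have "open N" unfolding N_def by (intro open_Int open_ball)
  moreover have "u2 \<in> N" using e u by (simp add: N_def w_def)
  ultimately obtain \<eta> where \<eta>: "\<eta> > 0" "cball u2 \<eta> \<subseteq> N" using open_contains_cball by blast
  define C where "C = cball u2 \<eta>"
  have Ce: "f (u + w) - f u < e" if "u \<in> C" for u using that \<eta> by (auto simp: C_def N_def subset_iff)
  have Cs: "u + s *\<^sub>R w \<in> ball c \<rho>" if "u \<in> C" "0 \<le> s" "s \<le> 1" for u s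
  proof -
    have "u \<in> ball c \<rho>" "u + w \<in> ball c \<rho>" using that(1) \<eta>(2) by (auto simp: C_def N_def subset_iff)
    then have "(1 - s) *\<^sub>R u + s *\<^sub>R (u + w) \<in> ball c \<rho>"
      using convex_ball[of c \<rho>] that(2,3) unfolding convex_alt by blast
    then show ?thesis by (simp add: algebra_simps)
  qed
  have intC: "integrable lborel (indicator C :: 'a \<Rightarrow> real)"
    unfolding C_def by (intro integrable_real_indicator) (use emeasure_bounded_finite[OF bounded_cball] in \<open>auto simp: less_top\<close>)
  have Cm[measurable]: "C \<in> sets borel" by (simp add: C_def)
  define V where "V = (\<integral>u. indicator C u \<partial>lborel :: real)"
  have V: "V > 0"
  proof -
    have "V = measure lborel C" by (simp add: V_def)
    moreover have "measure lborel C > 0" unfolding C_def using content_cball_pos[OF \<eta>(1), of u2] by simp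
    ultimately show ?thesis by simp
  qed
  \<comment> \<open>The averaged value of \<open>f\<close> after the fraction \<open>s\<close> of
    the step, up to the factor \<open>V\<close>; \<open>J'\<close> is its derivative.\<close>
  define J where "J = (\<lambda>s. \<integral>u. indicator C u * f (u + s *\<^sub>R w) \<partial>lborel)"
  define J' where "J' = (\<lambda>s. \<integral>u. indicator C u * dir_deriv f w (u + s *\<^sub>R w) \<partial>lborel)"
  have intf: "integrable lborel (\<lambda>u. indicator C u * f (u + a))" for a
  proof -
    have "compact ((\<lambda>u. f (u + a)) ` C)" unfolding C_def
      by (intro compact_continuous_image continuous_on_compose2[OF contf] continuous_intros) auto
    then obtain B where B: "\<And>u. u \<in> C \<Longrightarrow> \<bar>f (u + a)\<bar> \<le> B" using compact_imp_bounded bounded_iff by (metis image_eqI real_norm_def)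
    show ?thesis
    proof (rule Bochner_Integration.integrable_bound)
      show "integrable lborel (\<lambda>u. B * indicator C u)" using intC by (rule integrable_mult_right)
      show "AE u in lborel. norm (indicator C u * f (u + a)) \<le> norm (B * indicator C u)"
        using B by (intro AE_I2) (force simp: indicator_def)
    qed measurable
  qed
  \<comment> \<open>For a fixed \<open>s\<close> the exceptional set is a translate of one null set.
    It varies with \<open>s\<close>, which is harmless because the integral over \<open>C\<close> is
    taken for one \<open>s\<close> at a time.\<close>
  have good: "AE u in lborel. u \<in> C \<longrightarrow> (dir_quot f w (u + s *\<^sub>R w) \<longlongrightarrow> dir_deriv f w (u + s *\<^sub>R w)) (at 0)
      \<and> dir_deriv f w (u + s *\<^sub>R w) \<ge> m * (w \<bullet> w)" if s: "0 \<le> s" "s \<le> 1" for s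
    using AE_lborel_translate[OF der, of "s *\<^sub>R w"]
  proof eventually_elim
    case (elim u)
    show ?case
    proof
      assume "u \<in> C"
      define v where "v = u + s *\<^sub>R w"
      obtain D where D: "(Q has_derivative D) (at v)" "\<And>w. D w \<bullet> w \<ge> m * (w \<bullet> w)"
        using elim Cs[OF \<open>u \<in> C\<close> s] unfolding v_def by blast
      have "((\<lambda>t. v + t *\<^sub>R w) has_derivative (\<lambda>t. t *\<^sub>R w)) (at 0)"
        by (auto intro!: derivative_eq_intros)
      then have "((\<lambda>t. Q (v + t *\<^sub>R w)) has_derivative (\<lambda>t. D (t *\<^sub>R w))) (at 0)"
        by (rule has_derivative_compose) (use D(1) in simp)
      then have "((\<lambda>t. f (v + t *\<^sub>R w)) has_derivative (\<lambda>t. D (t *\<^sub>R w) \<bullet> w)) (at 0)"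
        unfolding f_def by (rule has_derivative_inner_left)
      moreover have "(\<lambda>t. D (t *\<^sub>R w) \<bullet> w) = (*) (D w \<bullet> w)"
        using has_derivative_linear[OF D(1)] by (auto simp: linear_cmul fun_eq_iff)
      ultimately have d: "((\<lambda>t. f (v + t *\<^sub>R w)) has_real_derivative D w \<bullet> w) (at 0)"
        by (simp add: has_field_derivative_def)
      have "dir_deriv f w v = D w \<bullet> w" using d by (rule dir_deriv_eqI)
      then show "(dir_quot f w (u + s *\<^sub>R w) \<longlongrightarrow> dir_deriv f w (u + s *\<^sub>R w)) (at 0)
        \<and> dir_deriv f w (u + s *\<^sub>R w) \<ge> m * (w \<bullet> w)"
        using d D(2)[of w] unfolding v_def[symmetric] by (simp add: dir_quot_tendsto_iff)
    qed
  qed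
  have bnd: "norm (indicator C u * dir_quot f w x t) \<le> K * norm w * norm w * indicator C u" for u x t
    using dir_quot_bound[OF lipf, of w x t] by (auto simp: indicator_def)
  have intb: "integrable lborel (\<lambda>u. K * norm w * norm w * indicator C u)" using intC by (rule integrable_mult_right)
  have deriv: "(J has_real_derivative J' s) (at s)" if s: "0 \<le> s" "s \<le> 1" for s
    unfolding DERIV_def tendsto_at_iff_sequentially
  proof (intro allI impI)
    fix t :: "nat \<Rightarrow> real" assume t: "\<forall>i. t i \<in> UNIV - {0}" "t \<longlonglongrightarrow> 0"
    have t0: "filterlim t (at 0) sequentially" using t by (intro filterlim_atI) auto
    have "(\<lambda>k. \<integral>u. indicator C u * dir_quot f w (u + s *\<^sub>R w) (t k) \<partial>lborel) \<longlonglongrightarrow> J' s"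
      unfolding J'_def
    proof (rule integral_dominated_convergence[OF _ _ intb])
      show "AE u in lborel. (\<lambda>k. indicator C u * dir_quot f w (u + s *\<^sub>R w) (t k))
              \<longlonglongrightarrow> indicator C u * dir_deriv f w (u + s *\<^sub>R w)"
        using good[OF s]
      proof eventually_elim
        case (elim u)
        show ?case
        proof (cases "u \<in> C")
          case True
          with elim have "(dir_quot f w (u + s *\<^sub>R w) \<longlongrightarrow> dir_deriv f w (u + s *\<^sub>R w)) (at 0)" by blast
          from filterlim_compose[OF this t0] show ?thesis using True by simp
        qed simp
      qed
      show "AE u in lborel. norm (indicator C u * dir_quot f w (u + s *\<^sub>R w) (t k)) \<le> K * norm w * norm w * indicator C u" for k
        using bnd by (intro AE_I2)
    qed measurable
    moreover have "(\<integral>u. indicator C u * dir_quot f w (u + s *\<^sub>R w) (t k) \<partial>lborel) = (J (s + t k) - J s) / t k" for k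
    proof -
      have "(\<integral>u. indicator C u * dir_quot f w (u + s *\<^sub>R w) (t k) \<partial>lborel)
        = (\<integral>u. (indicator C u * f (u + (s + t k) *\<^sub>R w) - indicator C u * f (u + s *\<^sub>R w)) / t k \<partial>lborel)"
        by (intro Bochner_Integration.integral_cong) (simp_all add: dir_quot_def algebra_simps diff_divide_distrib)
      also have "\<dots> = (\<integral>u. indicator C u * f (u + (s + t k) *\<^sub>R w) - indicator C u * f (u + s *\<^sub>R w) \<partial>lborel) / t k"
        by (rule integral_divide_zero)
      also have "(\<integral>u. indicator C u * f (u + (s + t k) *\<^sub>R w) - indicator C u * f (u + s *\<^sub>R w) \<partial>lborel) = J (s + t k) - J s"
        unfolding J_def by (intro Bochner_Integration.integral_diff intf)
      finally show ?thesis .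
    qed
    ultimately show "((\<lambda>h. (J (s + h) - J s) / h) \<circ> t) \<longlonglongrightarrow> J' s" by (simp add: comp_def)
  qed
  have J'_ge: "J' s \<ge> m * (w \<bullet> w) * V" if s: "0 \<le> s" "s \<le> 1" for s
  proof -
    have "m * (w \<bullet> w) * V = (\<integral>u. m * (w \<bullet> w) * indicator C u \<partial>lborel)" by (simp add: V_def)
    also have "\<dots> \<le> J' s" unfolding J'_def
    proof (rule integral_mono_AE)
      show "integrable lborel (\<lambda>u. m * (w \<bullet> w) * indicator C u)" using intC by (rule integrable_mult_right)
      show "integrable lborel (\<lambda>u. indicator C u * dir_deriv f w (u + s *\<^sub>R w))"
      proof (rule Bochner_Integration.integrable_bound[OF intb])
        show "AE u in lborel. norm (indicator C u * dir_deriv f w (u + s *\<^sub>R w)) \<le> norm (K * norm w * norm w * indicator C u)"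
          using good[OF s]
        proof eventually_elim
          case (elim u)
          show ?case
          proof (cases "u \<in> C")
            case True
            with elim have l: "(dir_quot f w (u + s *\<^sub>R w) \<longlongrightarrow> dir_deriv f w (u + s *\<^sub>R w)) (at 0)" by blast
            have "\<bar>dir_deriv f w (u + s *\<^sub>R w)\<bar> \<le> K * norm w * norm w"
              by (rule tendsto_upperbound[OF tendsto_rabs[OF l]]) (auto intro!: always_eventually dir_quot_bound[OF lipf])
            then show ?thesis using True by simp
          qed simp
        qed
      qed measurable
      show "AE u in lborel. m * (w \<bullet> w) * indicator C u \<le> indicator C u * dir_deriv f w (u + s *\<^sub>R w)"
        using good[OF s] by eventually_elim (auto simp: indicator_def)
    qed
    finally show ?thesis .
  qed
  obtain s where s: "0 < s" "s < 1" "J 1 - J 0 = (1 - 0) * J' s"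
    using MVT2[of 0 1 J J'] deriv by auto
  have "J 1 - J 0 = (\<integral>u. indicator C u * f (u + 1 *\<^sub>R w) - indicator C u * f (u + 0 *\<^sub>R w) \<partial>lborel)"
    unfolding J_def by (intro Bochner_Integration.integral_diff[symmetric] intf)
  also have "\<dots> \<le> (\<integral>u. e * indicator C u \<partial>lborel)"
  proof (rule integral_mono)
    show "integrable lborel (\<lambda>u. e * indicator C u)" using intC by (rule integrable_mult_right)
    show "integrable lborel (\<lambda>u. indicator C u * f (u + 1 *\<^sub>R w) - indicator C u * f (u + 0 *\<^sub>R w))"
      by (intro Bochner_Integration.integrable_diff intf)
    fix u
    show "indicator C u * f (u + 1 *\<^sub>R w) - indicator C u * f (u + 0 *\<^sub>R w) \<le> e * indicator C u"
      using Ce[of u] by (auto simp: indicator_def)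
  qed
  also have "\<dots> = e * V" by (simp add: V_def)
  also have "\<dots> < m * (w \<bullet> w) * V" using e V by (intro mult_strict_right_mono)
  also have "\<dots> \<le> J' s" using J'_ge s by simp
  finally show False using s(3) by simp
qed

text \<open>Reduces to a globally Lipschitz map by precomposing with the nearest-point projection,
  which fixes the open ball and hence the derivatives there.\<close>

lemma strongly_monotone_if_derivative_ae_cball:
  fixes Q :: "'a::euclidean_space \<Rightarrow> 'a"
  assumes lip: "K-lipschitz_on (cball c \<rho>) Q" and \<rho>: "\<rho> > 0"
    and der: "AE u in lborel. u \<in> ball c \<rho> \<longrightarrow> (\<exists>D. (Q has_derivative D) (at u) \<and> (\<forall>w. D w \<bullet> w \<ge> m * (w \<bullet> w)))"
    and u: "u1 \<in> ball c \<rho>" "u2 \<in> ball c \<rho>"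
  shows "(Q u1 - Q u2) \<bullet> (u1 - u2) \<ge> m * ((u1 - u2) \<bullet> (u1 - u2))"
proof -
  define p where "p = closest_point (cball c \<rho>)"
  have "1-lipschitz_on UNIV p"
    unfolding p_def using \<rho> by (intro lipschitz_onI) (auto intro: closest_point_lipschitz)
  moreover have "p ` UNIV \<subseteq> cball c \<rho>"
    unfolding p_def using \<rho> by (auto intro: closest_point_in_set simp del: mem_cball)
  ultimately have lip': "(K * 1)-lipschitz_on UNIV (\<lambda>u. Q (p u))"
    using lipschitz_on_subset[OF lip] by (intro lipschitz_on_compose2)
  have eq: "Q y = Q (p y)" if "y \<in> ball c \<rho>" for y
    using that by (simp add: p_def closest_point_self)
  have "AE u in lborel. u \<in> ball c \<rho> \<longrightarrow> (\<exists>D. ((\<lambda>u. Q (p u)) has_derivative D) (at u) \<and> (\<forall>w. D w \<bullet> w \<ge> m * (w \<bullet> w)))"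
    using der
  proof eventually_elim
    case (elim u)
    show ?case
    proof
      assume ub: "u \<in> ball c \<rho>"
      then obtain D where D: "(Q has_derivative D) (at u)" "\<forall>w. D w \<bullet> w \<ge> m * (w \<bullet> w)" using elim by blast
      have "((\<lambda>u. Q (p u)) has_derivative D) (at u)"
        by (rule has_derivative_transform_within_open[OF D(1) open_ball ub eq])
      then show "\<exists>D. ((\<lambda>u. Q (p u)) has_derivative D) (at u) \<and> (\<forall>w. D w \<bullet> w \<ge> m * (w \<bullet> w))" using D(2) by blast
    qed
  qed
  from strongly_monotone_if_derivative_ae[OF lip' this u] show ?thesis
    unfolding eq[OF u(1), symmetric] eq[OF u(2), symmetric] .
qed

text \<open>With \<open>w = a + b\<close>, the slope bound gives
  \<open>norm w \<le> (\<kappa> + 1) * norm b\<close>, and the sign condition gives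
  \<open>b \<bullet> w \<ge> b \<bullet> b\<close>.\<close>

lemma regular_slope_imp_coercive:
  fixes a b :: "'a::real_inner"
  assumes "\<kappa> > 0" "norm a \<le> \<kappa> * norm b" "b \<bullet> a \<ge> 0"
  shows "b \<bullet> (a + b) \<ge> (1 / (\<kappa> + 1)\<^sup>2) * ((a + b) \<bullet> (a + b))"
proof -
  have "norm (a + b) \<le> (\<kappa> + 1) * norm b" using norm_triangle_ineq[of a b] assms(2) by (simp add: distrib_right)
  then have "(norm (a + b))\<^sup>2 \<le> ((\<kappa> + 1) * norm b)\<^sup>2" by (rule power_mono) simp
  then have "(a + b) \<bullet> (a + b) \<le> (\<kappa> + 1)\<^sup>2 * (b \<bullet> b)" by (simp add: power2_norm_eq_inner power_mult_distrib)
  moreover have "b \<bullet> b \<le> b \<bullet> (a + b)" using assms(3) by (simp add: inner_add_right)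
  then have "(\<kappa> + 1)\<^sup>2 * (b \<bullet> b) \<le> (\<kappa> + 1)\<^sup>2 * (b \<bullet> (a + b))" by (intro mult_left_mono) auto
  ultimately have "(a + b) \<bullet> (a + b) \<le> (\<kappa> + 1)\<^sup>2 * (b \<bullet> (a + b))" by linarith
  moreover have "(\<kappa> + 1)\<^sup>2 > 0" using assms(1) by simp
  ultimately show ?thesis by (simp add: pos_divide_le_eq mult.commute)
qed

text \<open>In the chart, inverting \<open>F\<close> amounts to inverting \<open>Q\<close>: the
  solution over \<open>y\<close> is the first component of \<open>\<Phi>\<close> at the parameter
  that \<open>Q\<close> sends to \<open>y\<close>.\<close>

lemma SCD_regular_imp_metrically_regular:
  fixes F :: "real^'n \<Rightarrow> (real^'n) set"
  assumes z0: "(x0, y0) \<in> gph F" and max: "locally_maximally_monotone_at F x0 y0"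
    and reg: "SCD_dual F (x0, y0) \<subseteq> Zn_reg"
  shows "metrically_regular_around F x0 y0"
proof -
  define c where "c = x0 + y0"
  obtain \<delta> \<Phi> W where chart: "minty_chart F c \<delta> \<Phi> W" and zW: "(x0, y0) \<in> W"
    using minty_chart_exists[OF max z0] unfolding c_def by blast
  note \<delta> = chart_pos[OF chart] and lip\<Phi> = chart_lipschitz[OF chart]
  have \<Phi>c: "\<Phi> c = (x0, y0)" using chart_inv(2)[OF chart z0 zW] by (simp add: c_def)
  obtain \<kappa> \<epsilon> where \<kappa>: "\<kappa> > 0" and \<epsilon>: "\<epsilon> > 0"
    and slope: "\<And>z. z \<in> O_set F \<Longrightarrow> dist z (x0, y0) < \<epsilon> \<Longrightarrow> slope_le \<kappa> (tangent_cone (gph F) z)"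
    using SCD_dual_regular_imp_slope_le[OF reg] by blast
  \<comment> \<open>Since \<open>\<Phi>\<close> is 1-Lipschitz, parameters within
    \<open>\<rho>\<close> of \<open>c\<close> give graph points within \<open>\<epsilon>\<close> of
    the base point, where the slope bound holds.\<close>
  define \<rho> where "\<rho> = min \<delta> \<epsilon> / 2"
  have \<rho>: "\<rho> > 0" "\<rho> < \<delta>" "\<rho> < \<epsilon>" using \<delta> \<epsilon> by (auto simp: \<rho>_def)
  have sub: "cball c \<rho> \<subseteq> ball c \<delta>" "ball c \<rho> \<subseteq> ball c \<delta>" using \<rho>(2) by auto
  define m where "m = 1 / (\<kappa> + 1)\<^sup>2"
  have m: "m > 0" using \<kappa> by (simp add: m_def)
  define Q where "Q = (\<lambda>u. snd (\<Phi> u))"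
  have lipQ: "1-lipschitz_on (ball c \<delta>) Q"
  proof (rule lipschitz_onI)
    fix u v assume "u \<in> ball c \<delta>" "v \<in> ball c \<delta>"
    from lipschitz_onD[OF lip\<Phi> this] show "dist (Q u) (Q v) \<le> 1 * dist u v"
      unfolding Q_def using dist_snd_le[of "\<Phi> u" "\<Phi> v"] by linarith
  qed simp
  have der: "AE u in lborel. u \<in> ball c \<rho> \<longrightarrow> (\<exists>D. (Q has_derivative D) (at u) \<and> (\<forall>w. D w \<bullet> w \<ge> m * (w \<bullet> w)))"
    using chart_differentiable_ae[OF chart sub(1)]
  proof eventually_elim
    case (elim u)
    show ?case
    proof
      assume u: "u \<in> ball c \<rho>"
      then have u\<delta>: "u \<in> ball c \<delta>" using sub by blast
      obtain D where D: "(\<Phi> has_derivative D) (at u)" using elim u by (auto simp: differentiable_def)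
      note T = chart_tangent[OF chart u\<delta> D]
      have "dist (\<Phi> u) (\<Phi> c) \<le> 1 * dist u c" using \<delta> by (intro lipschitz_onD[OF lip\<Phi> u\<delta>]) simp
      then have "dist (\<Phi> u) (x0, y0) < \<epsilon>" using u \<rho>(3) by (simp add: \<Phi>c dist_commute)
      from slope[OF T(3) this] have sl: "norm (fst (D w)) \<le> \<kappa> * norm (snd (D w))" for w
        unfolding T(1) slope_le_def by (metis (no_types, lifting) case_prodD prod.collapse rangeI)
      have mono: "0 \<le> snd (D w) \<bullet> fst (D w)" for w
      proof -
        have "0 \<le> (\<lambda>w. snd w \<bullet> fst w) (D w)"
        proof (rule tangent_cone_pair_inequality[OF chart_open[OF chart] chart_mem(2)[OF chart u\<delta>] chart_mem(1)[OF chart u\<delta>]])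
          fix a b :: "(real^'n) \<times> (real^'n)"
          assume ab: "a \<in> gph F \<inter> W" "b \<in> gph F \<inter> W"
          have "monotone_graph (gph F \<inter> W)" using chart by (simp add: minty_chart_def)
          from this[unfolded monotone_graph_def, rule_format, of "fst b" "snd b" "fst a" "snd a"]
          show "0 \<le> snd (b - a) \<bullet> fst (b - a)" using ab by simp
        next
          fix t :: real and w :: "(real^'n) \<times> (real^'n)"
          assume t: "t > 0" "0 \<le> snd (t *\<^sub>R w) \<bullet> fst (t *\<^sub>R w)"
          then show "0 \<le> snd w \<bullet> fst w" by (simp add: zero_le_mult_iff)
        next
          show "D w \<in> tangent_cone (gph F) (\<Phi> u)" unfolding T(1) by blast
        qed (intro continuous_intros)
        then show ?thesis by simp
      qed
      have "snd (D w) \<bullet> w \<ge> m * (w \<bullet> w)" for w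
        using regular_slope_imp_coercive[OF \<kappa> sl mono, of w] unfolding T(2) m_def .
      moreover have "(Q has_derivative (\<lambda>w. snd (D w))) (at u)" unfolding Q_def by (rule has_derivative_snd[OF D])
      ultimately show "\<exists>D. (Q has_derivative D) (at u) \<and> (\<forall>w. D w \<bullet> w \<ge> m * (w \<bullet> w))" by blast
    qed
  qed
  have sm: "m * norm (u - v) \<le> norm (Q u - Q v)" if uv: "u \<in> ball c \<rho>" "v \<in> ball c \<rho>" for u v
  proof -
    have "m * ((u - v) \<bullet> (u - v)) \<le> (Q u - Q v) \<bullet> (u - v)"
      by (rule strongly_monotone_if_derivative_ae_cball[OF lipschitz_on_subset[OF lipQ sub(1)] \<rho>(1) der uv])
    also have "\<dots> \<le> norm (Q u - Q v) * norm (u - v)" by (rule norm_cauchy_schwarz)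
    finally have "norm (u - v) * (m * norm (u - v)) \<le> norm (u - v) * norm (Q u - Q v)"
      by (simp add: power2_norm_eq_inner[symmetric] power2_eq_square mult_ac)
    then show ?thesis by (cases "u = v") auto
  qed
  have inj: "inj_on Q (ball c \<rho>)"
  proof (rule inj_onI)
    fix u v assume "u \<in> ball c \<rho>" "v \<in> ball c \<rho>" "Q u = Q v"
    with sm[of u v] m show "u = v" by (simp add: mult_le_0_iff)
  qed
  define Y where "Y = Q ` ball c \<rho>"
  \<comment> \<open>\<open>Q\<close> is merely Lipschitz and injective; invariance of domain
    provides the open image that makes the inverse defined on a neighbourhood of
    \<open>y0\<close>.\<close>
  have "open Y" unfolding Y_def
    by (rule invariance_of_domain[OF lipschitz_on_continuous_on[OF lipschitz_on_subset[OF lipQ sub(2)]] open_ball inj])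
  have cb: "c \<in> ball c \<rho>" using \<rho> by simp
  have "y0 \<in> Y" unfolding Y_def using cb \<Phi>c by (intro image_eqI[of _ _ c]) (simp_all add: Q_def)
  define g where "g = the_inv_into (ball c \<rho>) Q"
  have g: "g y \<in> ball c \<rho>" "Q (g y) = y" if "y \<in> Y" for y
    using that the_inv_into_into[OF inj] f_the_inv_into_f[OF inj] unfolding g_def Y_def by blast+
  have gQ: "g (Q u) = u" if "u \<in> ball c \<rho>" for u unfolding g_def using inj that by (rule the_inv_into_f_f)
  define h where "h = (\<lambda>y. fst (\<Phi> (g y)))"
  have \<Phi>g: "\<Phi> (g y) = (h y, y)" if "y \<in> Y" for y
    using g(2)[OF that] by (simp add: h_def Q_def prod_eq_iff)
  have lip: "(1 / m)-lipschitz_on Y h"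
  proof (rule lipschitz_onI)
    fix y y' assume y: "y \<in> Y" "y' \<in> Y"
    have "m * norm (g y - g y') \<le> norm (y - y')" using sm[OF g(1)[OF y(1)] g(1)[OF y(2)]] g(2) y by simp
    then have "dist (g y) (g y') \<le> (1 / m) * dist y y'" using m by (simp add: dist_norm pos_le_divide_eq mult.commute)
    moreover have "dist (h y) (h y') \<le> dist (\<Phi> (g y)) (\<Phi> (g y'))" unfolding h_def by (rule dist_fst_le)
    moreover have "dist (\<Phi> (g y)) (\<Phi> (g y')) \<le> 1 * dist (g y) (g y')"
      using g(1)[OF y(1)] g(1)[OF y(2)] sub(2) by (intro lipschitz_onD[OF lip\<Phi>]) blast+
    ultimately show "dist (h y) (h y') \<le> (1 / m) * dist y y'" by linarith
  qed (use m in simp)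
  define S where "S = W \<inter> (\<lambda>z. fst z + snd z) -` ball c \<rho>"
  have "open ((\<lambda>z :: (real^'n) \<times> (real^'n). fst z + snd z) -` ball c \<rho>)"
    by (intro open_vimage open_ball continuous_intros)
  then have "open S" unfolding S_def by (intro open_Int chart_open[OF chart])
  moreover have "(x0, y0) \<in> S" using zW cb by (simp add: S_def c_def)
  ultimately obtain X1 Y1 where XY: "open X1" "open Y1" "(x0, y0) \<in> X1 \<times> Y1" "X1 \<times> Y1 \<subseteq> S"
    by (rule open_prod_elim)
  have h0: "h y0 = x0" using gQ[OF cb] by (simp add: h_def Q_def \<Phi>c)
  have conth: "continuous_on Y h" using lip by (rule lipschitz_on_continuous_on)
  \<comment> \<open>Shrinking to the preimage of \<open>X1\<close> under \<open>h\<close> ensures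
    that over every \<open>y\<close> in \<open>Y2\<close> the solution \<open>h y\<close> lies in
    \<open>X1\<close>, so the graph over the product neighbourhood is exactly that of
    \<open>h\<close>.\<close>
  define Y2 where "Y2 = Y \<inter> Y1 \<inter> (h -` X1 \<inter> Y)"
  have "open (h -` X1 \<inter> Y)" using conth \<open>open Y\<close> XY(1) by (simp add: continuous_on_open_vimage)
  then have oY2: "open Y2" unfolding Y2_def using \<open>open Y\<close> XY by blast
  have y0: "y0 \<in> Y2" using \<open>y0 \<in> Y\<close> XY h0 by (simp add: Y2_def)
  have "gph F \<inter> X1 \<times> Y2 = {(h y, y) | y. y \<in> Y2}"
  proof (intro subset_antisym subsetI)
    fix z assume z: "z \<in> gph F \<inter> X1 \<times> Y2"
    then have "z \<in> X1 \<times> Y1" by (auto simp: Y2_def)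
    then have zS: "z \<in> S" using XY(4) by blast
    define u where "u = fst z + snd z"
    have u: "u \<in> ball c \<rho>" "\<Phi> u = z" using zS z chart_inv(2)[OF chart, of z] by (auto simp: S_def u_def)
    then have "g (snd z) = u" using gQ[OF u(1)] by (simp add: Q_def)
    then have "h (snd z) = fst z" by (simp add: h_def u(2))
    then have "z = (h (snd z), snd z)" "snd z \<in> Y2" using z by (auto simp: prod_eq_iff)
    then show "z \<in> {(h y, y) | y. y \<in> Y2}" by blast
  next
    fix z assume "z \<in> {(h y, y) | y. y \<in> Y2}"
    then obtain y where y: "z = (h y, y)" "y \<in> Y2" by blast
    then have yY: "y \<in> Y" "h y \<in> X1" by (auto simp: Y2_def)
    have "\<Phi> (g y) \<in> gph F" using g(1)[OF yY(1)] sub(2) by (intro chart_mem(1)[OF chart]) blast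
    then show "z \<in> gph F \<inter> X1 \<times> Y2" using \<Phi>g[OF yY(1)] y yY by simp
  qed
  from metrically_regularI[OF XY(1) _ oY2 y0 h0 this lipschitz_on_subset[OF lip]] XY(3)
  show ?thesis by (auto simp: Y2_def)
qed

theorem corollary7p6:
  fixes F :: "real^'n \<Rightarrow> (real^'n) set" and xbar ybar :: "real^'n"
  assumes "(xbar, ybar) \<in> gph F"
    and "locally_closed_around (gph F) (xbar, ybar)"
    and "locally_monotone_at F xbar ybar"
  shows "(strongly_metrically_regular_around F xbar ybar \<longleftrightarrow>
            metrically_regular_around F xbar ybar)
       \<and> (metrically_regular_around F xbar ybar \<longleftrightarrow>
            SCD_regular_around F xbar ybar \<and> locally_maximally_monotone_at F xbar ybar)
       \<and> (metrically_regular_around F xbar ybar \<longrightarrow>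
            (\<forall>L \<in> SCD F (xbar, ybar). L \<in> Zn_reg \<and> (\<forall>p. (C_mat L *v p) \<bullet> p \<ge> 0)))"
proof -
  note z0 = assms(1)
  have inv: "\<exists>r \<delta> \<kappa> h. lipschitz_inverse F xbar ybar r \<delta> \<kappa> h" if "metrically_regular_around F xbar ybar"
    using lipschitz_inverse_exists[OF z0 assms(3) that] .
  have strong: "strongly_metrically_regular_around F xbar ybar" if mr: "metrically_regular_around F xbar ybar"
  proof -
    obtain r \<delta> \<kappa> h where h: "lipschitz_inverse F xbar ybar r \<delta> \<kappa> h" using inv[OF mr] by blast
    show ?thesis
      unfolding strongly_metrically_regular_around_def
      using mr h by (intro conjI exI[of _ "ball xbar r"] exI[of _ "ball ybar \<delta>"] exI[of _ h])
        (auto simp: lipschitz_inverse_def)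
  qed
  have SCD: "SCD_regular_around F xbar ybar \<and> locally_maximally_monotone_at F xbar ybar"
    if mr: "metrically_regular_around F xbar ybar"
  proof -
    obtain r \<delta> \<kappa> h where h: "lipschitz_inverse F xbar ybar r \<delta> \<kappa> h" using inv[OF mr] by blast
    have max: "locally_maximally_monotone_at F xbar ybar"
      by (rule lipschitz_inverse_locally_maximally_monotone[OF h])
    then obtain \<eta> \<Phi> W where "minty_chart F (xbar + ybar) \<eta> \<Phi> W" "(xbar, ybar) \<in> W"
      using minty_chart_exists[OF _ z0] by blast
    then have "SCD_property_around F (xbar, ybar)" by (rule chart_SCD_property)
    then show ?thesis
      using max lipschitz_inverse_SCD(1)[OF h] by (simp add: SCD_regular_around_def)
  qed
  have C: "L \<in> Zn_reg \<and> (\<forall>p. (C_mat L *v p) \<bullet> p \<ge> 0)"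
    if mr: "metrically_regular_around F xbar ybar" and L: "L \<in> SCD F (xbar, ybar)" for L
  proof -
    obtain r \<delta> \<kappa> h where h: "lipschitz_inverse F xbar ybar r \<delta> \<kappa> h" using inv[OF mr] by blast
    show ?thesis using lipschitz_inverse_SCD(2,3)[OF h] L by blast
  qed
  have MR: "metrically_regular_around F xbar ybar"
    if "SCD_regular_around F xbar ybar" "locally_maximally_monotone_at F xbar ybar"
    using that SCD_regular_imp_metrically_regular[OF z0] by (simp add: SCD_regular_around_def)
  show ?thesis
    using strong SCD C MR unfolding strongly_metrically_regular_around_def by blast
qed

end
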